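(* Let $n$ be a positive integer. Exactly one third of all rhombus tilings of the hexagon $H(2n-1,2n)$ with side lengths $2n-1,2n,2n-1,2n-1,2n,2n-1$ (all angles $120^\circ$) contain the central rhombus. Likewise, exactly one third of all rhombus tilings of the hexagon $H(2n,2n-1)$ with side lengths $2n,2n-1,2n,2n,2n-1,2n$ (all angles $120^\circ$) contain the central rhombus.
   Context: For integers $N\ge1$, $M\ge1$ let $H(N,M)$ be the hexagon in the plane with all angles $120^\circ$ and sides, in cyclic order, $N,M,N,N,M,N$, placed so that its vertices are $(0,\pm\frac M2)$, $(\frac{\sqrt3}{2}N,\pm\frac{M+N}{2})$, $(\sqrt3N,\pm\frac M2)$. $H(N,M)$ is subdivided into unit equilateral triangles by the triangular lattice generated by $(0,1)$ and $(\frac{\sqrt3}{2},\frac12)$, translated so that the vertices of $H(N,M)$ are lattice points. A rhombus means the union of two of these unit triangles sharing an edge (side lengths $1$, angles $60^\circ$ and $120^\circ$). A rhombus tiling of $H(N,M)$ is a set of rhombi with pairwise disjoint interiors whose union is $H(N,M)$; it contains (covers) a given rhombus if that rhombus is one of its tiles. When $N$ and $M$ have opposite parity, the central rhombus is the unique rhombus centered at the center $(\frac{\sqrt3}{2}N,0)$ of the hexagon; its vertices are $(\frac{\sqrt3}{2}(N-1),0)$, $(\frac{\sqrt3}{2}(N+1),0)$, $(\frac{\sqrt3}{2}N,\pm\frac12)$. *)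

theory Defs
  imports "HOL-Analysis.Analysis"
begin

definition hexagon :: "nat \<Rightarrow> nat \<Rightarrow> (real \<times> real) set" where
  "hexagon N M = convex hull
     {(0, real M / 2), (0, - real M / 2),
      (sqrt 3 / 2 * real N, (real M + real N) / 2),
      (sqrt 3 / 2 * real N, - (real M + real N) / 2),
      (sqrt 3 * real N, real M / 2), (sqrt 3 * real N, - real M / 2)}"

text \<open>The lattice generated by \<open>(0, 1)\<close> and \<open>(sqrt 3 / 2, 1 / 2)\<close>, translated by the vertex
  \<open>(0, M / 2)\<close> of the hexagon. All six vertices of \<open>hexagon N M\<close> then lie in it, for every \<open>N\<close>.\<close>

definition lattice_points :: "nat \<Rightarrow> (real \<times> real) set" where
  "lattice_points M =
     {(0, real M / 2) + of_int a *\<^sub>R (0, 1) + of_int b *\<^sub>R (sqrt 3 / 2, 1 / 2) | a b :: int. True}"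

text \<open>The unit triangles of the lattice are spanned by the triples of lattice points at mutual
  distance 1.\<close>

definition unit_triple :: "nat \<Rightarrow> real \<times> real \<Rightarrow> real \<times> real \<Rightarrow> real \<times> real \<Rightarrow> bool" where
  "unit_triple M p q r \<longleftrightarrow>
     {p, q, r} \<subseteq> lattice_points M \<and> dist p q = 1 \<and> dist q r = 1 \<and> dist p r = 1"

text \<open>Unions of two distinct unit triangles in the hexagon that share the edge from \<open>p\<close> to \<open>q\<close>.\<close>

definition rhombi :: "nat \<Rightarrow> nat \<Rightarrow> (real \<times> real) set set" where
  "rhombi N M =
     {convex hull {p, q, r} \<union> convex hull {p, q, s} | p q r s.
        unit_triple M p q r \<and> unit_triple M p q s \<and> r \<noteq> s \<and>
        convex hull {p, q, r} \<subseteq> hexagon N M \<and> convex hull {p, q, s} \<subseteq> hexagon N M}"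

definition rhombus_tilings :: "nat \<Rightarrow> nat \<Rightarrow> (real \<times> real) set set set" where
  "rhombus_tilings N M =
     {T. T \<subseteq> rhombi N M \<and> pairwise (\<lambda>R S. disjnt (interior R) (interior S)) T \<and>
         \<Union>T = hexagon N M}"

text \<open>A member of \<open>rhombi N M\<close> only if \<open>N\<close> and \<open>M\<close> have opposite parity.\<close>

definition central_rhombus :: "nat \<Rightarrow> (real \<times> real) set" where
  "central_rhombus N = convex hull
     {(sqrt 3 / 2 * (real N - 1), 0), (sqrt 3 / 2 * (real N + 1), 0),
      (sqrt 3 / 2 * real N, 1 / 2), (sqrt 3 / 2 * real N, - 1 / 2)}"

end

(*
Tiles without vertical sides aside, a tiling is a family of M nonintersecting lattice paths
  crossing the hexagon from left to right. Cut at the middle column: each half is counted by a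
  Vandermonde determinant, so a set H of N positions in the column missed by the paths occurs in a
  number of tilings proportional to the squared Vandermonde product of H. The tiling contains the
  central rhombus iff H contains the center c of the column. For this ensemble the proportion of
  sets containing c is Q(c), where Q is the polynomial of degree < N reproducing the value at c
  under summation over the column. Expanding Q in discrete Chebyshev polynomials yields a
  terminating hypergeometric sum, which a Wilf-Zeilberger pair shows to be 1/3 for every n.
*)

theory Submission
  imports Defs "Jordan_Normal_Form.Determinant"
begin

section \<open>Vandermonde determinants\<close>

text \<open>Paths are never formed as objects. A tiling becomes a bijection between vertical edges
  that is peeled off column by column, and all that one column passes to the next is the set of its
  edges crossed by paths. A closed form for the number of histories of such a set is verified
  against this one-column recurrence. Its linear weights vanish at moves that leave the hexagon and
  its Vandermonde factor at collisions, so a sum over legal moves equals the full expansion of a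
  determinant. The square arises because the right half, read backwards and translated, obeys the
  recurrence of the left half. The two hexagons share one computation: both have a middle column of
  4n - 1 edges, and the centred orthogonal polynomials of odd degree vanish at the centre, so
  raising the degree bound from 2n - 1 to 2n changes nothing. The remaining sum over even degrees
  stops before its terms vanish, so telescoping leaves a boundary term; it cancels the additional
  last term in each step from n to n + 1.\<close>

lemma prod_list_diag_mat:
  fixes A :: "'a :: comm_monoid_mult mat"
  assumes "A \<in> carrier_mat n n"
  shows "prod_list (diag_mat A) = (\<Prod>i\<in>{0..<n}. A $$ (i, i))"
  using assms by (simp add: diag_mat_def flip: prod.distinct_set_conv_list)

text \<open>Expanding the polynomials in monomials factors the matrix into the Vandermonde matrix
  and the matrix of coefficients, which the degree bound makes triangular.\<close>

lemma det_poly_eval_matrix: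
  fixes x :: "nat \<Rightarrow> real" and q :: "nat \<Rightarrow> real poly"
  assumes deg: "\<And>j. j < n \<Longrightarrow> degree (q j) \<le> j"
  shows "Determinant.det (mat n n (\<lambda>(i, j). poly (q j) (x i))) =
    (\<Prod>j\<in>{0..<n}. coeff (q j) j) * Determinant.det (mat n n (\<lambda>(i, j). x i ^ j))"
proof -
  let ?V = "mat n n (\<lambda>(i, j). x i ^ j)" and ?C = "mat n n (\<lambda>(k, j). coeff (q j) k)"
  have "mat n n (\<lambda>(i, j). poly (q j) (x i)) = ?V * ?C"
  proof (rule eq_matI)
    fix i j assume "i < dim_row (?V * ?C)" "j < dim_col (?V * ?C)"
    then have ij: "i < n" "j < n" by auto
    have "poly (q j) (x i) = (\<Sum>k\<le>degree (q j). coeff (q j) k * x i ^ k)"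
      by (rule poly_altdef)
    also have "\<dots> = (\<Sum>k\<in>{0..<n}. coeff (q j) k * x i ^ k)"
      using deg[OF ij(2)] ij by (intro sum.mono_neutral_left) (auto simp: coeff_eq_0)
    finally show "mat n n (\<lambda>(i, j). poly (q j) (x i)) $$ (i, j) = (?V * ?C) $$ (i, j)"
      using ij by (simp add: scalar_prod_def mult.commute)
  qed auto
  moreover have "Determinant.det ?C = (\<Prod>j\<in>{0..<n}. coeff (q j) j)"
  proof -
    have "upper_triangular ?C"
      by (auto simp: upper_triangular_def intro!: coeff_eq_0 order.strict_trans1[OF deg])
    then show ?thesis
      by (subst det_upper_triangular[of _ n]) (auto simp: prod_list_diag_mat[of _ n])
  qed
  ultimately show ?thesis
    by (simp add: Determinant.det_mult[of _ n])
qed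

text \<open>Monomials may be replaced by the monic Newton polynomials \<open>q j\<close>, which
  vanish at the first \<open>j\<close> nodes and make the matrix triangular.\<close>

lemma det_vandermonde:
  fixes x :: "nat \<Rightarrow> real"
  shows "Determinant.det (mat n n (\<lambda>(i, j). x i ^ j)) = (\<Prod>j\<in>{0..<n}. \<Prod>i\<in>{0..<j}. x j - x i)"
proof -
  define q where "q = (\<lambda>j. \<Prod>i\<in>{0..<j}. [:- x i, 1:])"
  have deg: "degree (q j) = j" for j
    unfolding q_def by (subst degree_prod_sum_eq) auto
  have lead: "coeff (q j) j = 1" for j
    using lead_coeff_prod[of "\<lambda>i. [:- x i, 1:]" "{0..<j}"] deg[of j] by (simp add: q_def)
  have "Determinant.det (mat n n (\<lambda>(i, j). x i ^ j)) =
      Determinant.det (mat n n (\<lambda>(i, j). poly (q j) (x i)))"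
    by (subst det_poly_eval_matrix) (simp_all add: deg lead)
  also have "\<dots> = (\<Prod>j\<in>{0..<n}. poly (q j) (x j))"
    by (subst Determinant.det_lower_triangular[of n])
      (auto simp: prod_list_diag_mat[of _ n] q_def poly_prod intro!: bexI)
  also have "\<dots> = (\<Prod>j\<in>{0..<n}. \<Prod>i\<in>{0..<j}. x j - x i)"
    by (simp add: q_def poly_prod)
  finally show ?thesis .
qed

text \<open>Positions are sheared: read from right to left, a path keeps its position or gains 1 per
  column, while geometrically it goes half a unit down or up.\<close>

definition moved :: "int set \<Rightarrow> int \<Rightarrow> int" where
  "moved S p = (if p \<in> S then p + 1 else p)"

definition vandermonde :: "('a::linorder \<Rightarrow> real) \<Rightarrow> 'a set \<Rightarrow> real" where
  "vandermonde g P = (\<Prod>b\<in>P. \<Prod>a\<in>{a\<in>P. a < b}. g b - g a)"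

text \<open>The sum is the determinant with rows \<open>T p\<close>, where \<open>T p(x) = (x + A) p(x) - (x + 1) p(x + 1)\<close> maps
  \<open>x ^ j\<close> to a polynomial of degree \<open>j\<close> with leading coefficient \<open>A - 1 - j\<close>.\<close>

lemma sum_shifted_vandermonde_nat:
  fixes x :: "nat \<Rightarrow> real" and A :: real
  shows "(\<Sum>S\<in>Pow {0..<n}. (\<Prod>i\<in>S. -1 - x i) * (\<Prod>i\<in>{0..<n} - S. x i + A) *
      vandermonde (\<lambda>i. if i \<in> S then x i + 1 else x i) {0..<n}) =
    (\<Prod>j<n. A - 1 - real j) * vandermonde x {0..<n}"
proof -
  define q :: "nat \<Rightarrow> real poly"
    where "q = (\<lambda>j. monom A j + monom 1 (j + 1) - [:1, 1:] ^ (j + 1))"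
  \<comment> \<open>The terms of degree \<open>j + 1\<close> cancel; in degree \<open>j\<close> the
    binomial power contributes \<open>- (j + 1)\<close>.\<close>
  have coeff_q: "coeff (q j) j = A - 1 - real j" "i > j \<Longrightarrow> coeff (q j) i = 0" for i j
    by (auto simp: q_def coeff_linear_poly_power degree_linear_power coeff_eq_0 simp del: power_Suc)
  have deg: "degree (q j) \<le> j" for j
    by (rule degree_le) (use coeff_q in auto)
  have poly_q: "poly (q j) y = (-1 - y) * (y + 1) ^ j + (y + A) * y ^ j" for j y
    by (simp add: q_def poly_monom algebra_simps)
  have vand: "vandermonde y {0..<n} = Determinant.det (mat n n (\<lambda>(i, j). y i ^ j))" for y
    unfolding det_vandermonde vandermonde_def
    by (intro prod.cong refl) auto
  have perm_less: "p i < n" if "p permutes {0..<n}" "i < n" for p i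
    using permutes_in_image[OF that(1), of i] that(2) by simp
  let ?w = "\<lambda>S. (\<Prod>i\<in>S. -1 - x i) * (\<Prod>i\<in>{0..<n} - S. x i + A)"
  let ?y = "\<lambda>S i. if i \<in> S then x i + 1 else x i"
  have "(\<Prod>j<n. A - 1 - real j) * vandermonde x {0..<n} =
      Determinant.det (mat n n (\<lambda>(i, j). poly (q j) (x i)))"
    by (simp add: vand det_poly_eval_matrix[OF deg] coeff_q lessThan_atLeast0)
  also have "\<dots> = (\<Sum>p | p permutes {0..<n}. signof p *
      (\<Prod>i\<in>{0..<n}. (-1 - x i) * (x i + 1) ^ p i + (x i + A) * x i ^ p i))"
    by (subst det_def'[of _ n]) (auto intro!: sum.cong prod.cong simp: poly_q perm_less)
  \<comment> \<open>\<open>prod_add\<close> multiplies out the binomials; \<open>S\<close> collects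
    the rows in which the summand with the node \<open>x i + 1\<close> is chosen. Summing over the
    permutations first then yields the Vandermonde determinant of the nodes
    \<open>?y S\<close>.\<close>
  also have "\<dots> = (\<Sum>p | p permutes {0..<n}. \<Sum>S\<in>Pow {0..<n}. signof p *
      (?w S * (\<Prod>i\<in>{0..<n}. ?y S i ^ p i)))"
  proof (intro sum.cong refl)
    fix p
    have "(\<Prod>i\<in>S. (-1 - x i) * (x i + 1) ^ p i) * (\<Prod>i\<in>{0..<n} - S. (x i + A) * x i ^ p i) =
        ?w S * (\<Prod>i\<in>{0..<n}. ?y S i ^ p i)" if "S \<in> Pow {0..<n}" for S
    proof -
      have S: "S \<subseteq> {0..<n}" using that by simp
      have "(\<Prod>i\<in>{0..<n}. ?y S i ^ p i) = (\<Prod>i\<in>{0..<n} - S. ?y S i ^ p i) * (\<Prod>i\<in>S. ?y S i ^ p i)"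
        using S by (simp add: prod.subset_diff)
      then show ?thesis
        by (simp add: prod.distrib)
    qed
    then show "signof p * (\<Prod>i\<in>{0..<n}. (-1 - x i) * (x i + 1) ^ p i + (x i + A) * x i ^ p i) =
        (\<Sum>S\<in>Pow {0..<n}. signof p * (?w S * (\<Prod>i\<in>{0..<n}. ?y S i ^ p i)))"
      by (subst prod_add) (simp_all add: sum_distrib_left)
  qed
  also have "\<dots> = (\<Sum>S\<in>Pow {0..<n}. ?w S * (\<Sum>p | p permutes {0..<n}. signof p *
      (\<Prod>i\<in>{0..<n}. ?y S i ^ p i)))"
    by (subst sum.swap) (simp add: sum_distrib_left mult_ac)
  also have "\<dots> = (\<Sum>S\<in>Pow {0..<n}. ?w S * vandermonde (?y S) {0..<n})"
    by (intro sum.cong refl arg_cong2[where f="(*)"], unfold vand, subst det_def'[of _ n])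
      (auto intro!: sum.cong prod.cong simp: perm_less)
  finally show ?thesis by simp
qed

lemma vandermonde_reindex:
  assumes "strict_mono_on P f"
  shows "vandermonde g (f ` P) = vandermonde (g \<circ> f) P"
proof -
  have inj: "inj_on f P" using assms by (rule strict_mono_on_imp_inj_on)
  have "{a \<in> f ` P. a < f b} = f ` {a \<in> P. a < b}" if "b \<in> P" for b
    using assms that by (auto simp: strict_mono_on_less)
  then show ?thesis
    unfolding vandermonde_def prod.reindex[OF inj] o_def
    by (intro prod.cong refl) (simp add: prod.reindex inj_on_subset[OF inj])
qed

lemma sum_shifted_vandermonde:
  fixes A :: real
  assumes "finite P"
  shows "(\<Sum>S\<in>Pow P. (\<Prod>p\<in>S. -1 - real_of_int p) * (\<Prod>p\<in>P - S. real_of_int p + A) *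
      vandermonde (\<lambda>p. of_int (moved S p)) P) =
    (\<Prod>j<card P. A - 1 - real j) * vandermonde of_int P"
proof -
  obtain f where f: "bij_betw f {0..<card P} P" "strict_mono_on {0..<card P} f"
  proof
    show "bij_betw (\<lambda>i. sorted_list_of_set P ! i) {0..<card P} P"
      using assms by (intro bij_betw_nth) (auto simp: atLeast0LessThan)
    show "strict_mono_on {0..<card P} (\<lambda>i. sorted_list_of_set P ! i)"
      using sorted_wrt_nth_less[OF strict_sorted_list_of_set[of P]]
      by (auto simp: strict_mono_on_def)
  qed
  then have P: "P = f ` {0..<card P}" and inj: "inj_on f {0..<card P}"
    by (auto simp: bij_betw_def)
  define n where "n = card P"
  have Pn: "P = f ` {0..<n}" and injn: "inj_on f {0..<n}" and mono: "strict_mono_on {0..<n} f"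
    using P inj f by (simp_all add: n_def)
  have "(\<Sum>S\<in>Pow P. (\<Prod>p\<in>S. -1 - real_of_int p) * (\<Prod>p\<in>P - S. real_of_int p + A) *
      vandermonde (\<lambda>p. of_int (moved S p)) P) =
    (\<Sum>S\<in>Pow {0..<n}. (\<Prod>p\<in>f ` S. -1 - real_of_int p) * (\<Prod>p\<in>P - f ` S. real_of_int p + A) *
      vandermonde (\<lambda>p. of_int (moved (f ` S) p)) P)"
    unfolding Pn image_Pow_surj[OF refl, symmetric]
    by (subst sum.reindex) (auto intro: inj_on_image_Pow injn)
  also have "\<dots> = (\<Sum>S\<in>Pow {0..<n}. (\<Prod>i\<in>S. -1 - real_of_int (f i)) * (\<Prod>i\<in>{0..<n} - S. f i + A) *
      vandermonde (\<lambda>i. if i \<in> S then real_of_int (f i) + 1 else f i) {0..<n})"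
  proof (intro sum.cong refl)
    fix S assume "S \<in> Pow {0..<n}"
    then have S: "S \<subseteq> {0..<n}" by simp
    have 1: "P - f ` S = f ` ({0..<n} - S)"
      unfolding Pn using inj_on_image_set_diff[OF injn _ S, of "{0..<n}"] by simp
    have 2: "vandermonde (\<lambda>p. of_int (moved (f ` S) p)) P =
        vandermonde (\<lambda>i. if i \<in> S then real_of_int (f i) + 1 else f i) {0..<n}"
      unfolding Pn vandermonde_reindex[OF mono] unfolding vandermonde_def o_def moved_def
      using S inj_on_image_mem_iff[OF injn _ S] by (intro prod.cong refl) auto
    show "(\<Prod>p\<in>f ` S. -1 - real_of_int p) * (\<Prod>p\<in>P - f ` S. real_of_int p + A) *
      vandermonde (\<lambda>p. of_int (moved (f ` S) p)) P = (\<Prod>i\<in>S. -1 - real_of_int (f i)) * (\<Prod>i\<in>{0..<n} - S. f i + A) *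
      vandermonde (\<lambda>i. if i \<in> S then real_of_int (f i) + 1 else f i) {0..<n}"
      unfolding 1 2 using S inj_on_subset[OF injn]
      by (simp add: prod.reindex)
  qed
  also have "\<dots> = (\<Prod>j<n. A - 1 - real j) * vandermonde (\<lambda>i. of_int (f i)) {0..<n}"
    by (rule sum_shifted_vandermonde_nat)
  also have "vandermonde (\<lambda>i. of_int (f i)) {0..<n} = vandermonde of_int P"
    unfolding Pn vandermonde_reindex[OF mono] o_def ..
  finally show ?thesis by (simp add: n_def)
qed

section \<open>Counting path families\<close>

text \<open>For \<open>P\<close> inside the column of \<open>M + j\<close> positions, the factorials
  are the product of the distances from \<open>p\<close> to all other positions. The weight is
  therefore the Vandermonde product of the holes divided by that of the whole column.\<close>

definition path_weight :: "nat \<Rightarrow> nat \<Rightarrow> int set \<Rightarrow> real" where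
  "path_weight M j P = vandermonde of_int P / (\<Prod>p\<in>P. fact (nat (-1 - p)) * fact (nat (int (M + j) + p)))"

text \<open>The possible states in the column \<open>C\<close> next to a column with state
  \<open>P\<close>; injectivity says that no two paths meet.\<close>

definition shifts :: "int set \<Rightarrow> int set \<Rightarrow> int set set" where
  "shifts C P = {S \<in> Pow P. inj_on (moved S) P \<and> moved S ` P \<subseteq> C}"

lemma finite_shifts [simp]: "finite P \<Longrightarrow> finite (shifts C P)"
  by (simp add: shifts_def)

text \<open>Shifts that leave the column or make two particles collide contribute 0 to the sum over all
  subsets, so the restriction to \<open>shifts\<close> is harmless.\<close>

lemma path_weight_step:
  assumes P: "P \<subseteq> {- int (M + Suc j)..-1}" and card: "card P = M"
  shows "(\<Sum>S\<in>shifts {- int (M + j)..-1} P. path_weight M j (moved S ` P)) =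
    (\<Prod>i<M. real M + real j - real i) * path_weight M (Suc j) P"
proof -
  let ?d = "\<lambda>j p. fact (nat (-1 - p)) * fact (nat (int (M + j) + p)) :: real"
  let ?D = "\<Prod>p\<in>P. ?d (Suc j) p"
  have fin: "finite P" using P finite_subset by blast
  define A where "A = real (M + Suc j)"
  define t where "t S = (\<Prod>p\<in>S. -1 - real_of_int p) * (\<Prod>p\<in>P - S. real_of_int p + A) *
      vandermonde (\<lambda>p. of_int (moved S p)) P" for S
  have valid: "path_weight M j (moved S ` P) = t S / ?D" if S: "S \<in> shifts {- int (M + j)..-1} P" for S
  proof -
    have SP: "S \<subseteq> P" and inj: "inj_on (moved S) P" and range: "\<And>p. p \<in> P \<Longrightarrow> moved S p \<in> {- int (M + j)..-1}"
      using S by (auto simp: shifts_def)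
    \<comment> \<open>Shifts by 0 or 1 can at worst make two integers coincide, so an injective
      shift preserves the strict order.\<close>
    have mono: "strict_mono_on P (moved S)"
    proof (rule strict_mono_onI)
      fix r s assume "r \<in> P" "s \<in> P" "r < s"
      then have "moved S r \<noteq> moved S s" using inj by (auto dest: inj_onD)
      with \<open>r < s\<close> show "moved S r < moved S s" by (auto simp: moved_def split: if_splits)
    qed
    \<comment> \<open>This is the origin of the two linear weights: compared with the previous
      column exactly one of the two factorials of a particle grows by a factor, the first if the
      particle moves and the second if it stays.\<close>
    have dp: "?d (Suc j) p = ?d j (moved S p) * (if p \<in> S then -1 - real_of_int p else real_of_int p + A)"
      if "p \<in> P" for p
    proof (cases "p \<in> S")
      case True
      have "nat (-1 - p) = Suc (nat (-1 - (p + 1)))" using range[OF that] True by (auto simp: moved_def)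
      moreover have "real (Suc (nat (-1 - (p + 1)))) = -1 - real_of_int p"
        using range[OF that] True by (auto simp: moved_def)
      moreover have "int (M + Suc j) + p = int (M + j) + (p + 1)" by simp
      ultimately show ?thesis using True by (simp only: fact_Suc moved_def if_True mult_ac)
    next
      case False
      have "nat (int (M + Suc j) + p) = Suc (nat (int (M + j) + p))"
        using range[OF that] False by (auto simp: moved_def)
      moreover have "real (Suc (nat (int (M + j) + p))) = real_of_int p + A"
        using range[OF that] False by (auto simp: moved_def A_def)
      ultimately show ?thesis using False by (simp only: fact_Suc moved_def if_False mult_ac)
    qed
    have "(\<Prod>p\<in>P. if p \<in> S then -1 - real_of_int p else real_of_int p + A) =
        (\<Prod>p\<in>S. -1 - real_of_int p) * (\<Prod>p\<in>P - S. real_of_int p + A)" (is "?e = _")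
      using SP fin by (subst prod.subset_diff[OF SP fin]) (simp add: mult.commute)
    then have "t S = ?e * vandermonde of_int (moved S ` P)"
      by (simp add: t_def vandermonde_reindex[OF mono] o_def)
    moreover have "?D = (\<Prod>p\<in>moved S ` P. ?d j p) * ?e"
      unfolding prod.reindex[OF inj] o_def prod.distrib[symmetric] by (rule prod.cong[OF refl dp])
    moreover have "?D \<noteq> 0" using fin by simp
    ultimately show ?thesis
      unfolding path_weight_def by (simp add: field_simps)
  qed
  have invalid: "t S = 0" if inv: "S \<in> Pow P - shifts {- int (M + j)..-1} P" for S
  proof -
    have SP: "S \<subseteq> P" using inv by simp
    consider "\<not> inj_on (moved S) P" | p where "p \<in> P" "moved S p \<notin> {- int (M + j)..-1}"
    proof (cases "inj_on (moved S) P")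
      case True
      then have "\<not> moved S ` P \<subseteq> {- int (M + j)..-1}" using inv by (simp add: shifts_def)
      then show thesis using that(2) by blast
    qed (use that(1) in simp)
    then show ?thesis
    proof cases
      case 1
      then obtain r s where rs: "r \<in> P" "s \<in> P" "r < s" "moved S r = moved S s"
        unfolding inj_on_def by (metis linorder_neqE)
      have "vandermonde (\<lambda>p. of_int (moved S p)) P = 0"
        unfolding vandermonde_def using rs fin by (intro prod_zero bexI[of _ s] bexI[of _ r]) auto
      then show ?thesis by (simp add: t_def)
    next
      case 2
      \<comment> \<open>The only moves out of the shorter column: up from its top position
        \<open>-1\<close>, or staying at the bottom position, which the longer column alone has.
        Each makes one linear weight 0.\<close>
      have "p = -1 \<and> p \<in> S \<or> p = - int (M + Suc j) \<and> p \<in> P - S"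
        using P 2 SP by (auto simp: moved_def split: if_splits)
      then show ?thesis
      proof
        assume "p = -1 \<and> p \<in> S"
        then have "(\<Prod>p\<in>S. -1 - real_of_int p) = 0"
          using finite_subset[OF SP fin] by (auto intro!: bexI[of _ p])
        then show ?thesis by (simp add: t_def)
      next
        assume "p = - int (M + Suc j) \<and> p \<in> P - S"
        then have "(\<Prod>p\<in>P - S. real_of_int p + A) = 0"
          using fin by (auto simp: A_def intro!: bexI[of _ p])
        then show ?thesis by (simp add: t_def)
      qed
    qed
  qed
  have "(\<Sum>S\<in>shifts {- int (M + j)..-1} P. path_weight M j (moved S ` P)) =
      (\<Sum>S\<in>shifts {- int (M + j)..-1} P. t S / ?D)"
    by (intro sum.cong refl valid)
  also have "\<dots> = (\<Sum>S\<in>Pow P. t S) / ?D"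
    unfolding sum_divide_distrib[symmetric]
    by (intro arg_cong2[where f="(/)"] refl sum.mono_neutral_left) (use fin invalid in \<open>auto simp: shifts_def\<close>)
  also have "(\<Sum>S\<in>Pow P. t S) = (\<Prod>i<M. A - 1 - real i) * vandermonde of_int P"
    unfolding t_def sum_shifted_vandermonde[OF fin] card ..
  finally show ?thesis by (simp add: path_weight_def A_def)
qed

text \<open>A closed form for the number of path families from the full column 0 to the state
  \<open>P\<close> of column \<open>j\<close>. That it counts them is expressed by the initial value
  \<open>path_count_0\<close> and the recurrence \<open>path_count_Suc\<close>.\<close>

definition path_count :: "nat \<Rightarrow> nat \<Rightarrow> int set \<Rightarrow> real" where
  "path_count M j P =
     (\<Prod>l<j. \<Prod>i<M. real M + real l - real i) * path_weight M j P / path_weight M 0 {- int M..-1}"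

lemma path_weight_pos: "finite P \<Longrightarrow> path_weight M j P > 0"
  unfolding path_weight_def vandermonde_def
  by (intro divide_pos_pos prod_pos mult_pos_pos) auto

lemma path_count_0:
  assumes "P \<subseteq> {- int M..-1}" "card P = M"
  shows "path_count M 0 P = 1"
proof -
  have "P = {- int M..-1}" using assms by (intro card_subset_eq) auto
  then show ?thesis using path_weight_pos[of P M 0] by (simp add: path_count_def)
qed

lemma path_count_Suc:
  assumes "P \<subseteq> {- int (M + Suc j)..-1}" "card P = M"
  shows "path_count M (Suc j) P = (\<Sum>S\<in>shifts {- int (M + j)..-1} P. path_count M j (moved S ` P))"
  unfolding path_count_def
  by (simp only: path_weight_step[OF assms] flip: sum_distrib_left sum_divide_distrib) simp

text \<open>In the affine coordinates \<open>pt\<close> below, the vertical unit edges of column \<open>k\<close> inside the hexagon join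
  \<open>(k, a)\<close> and \<open>(k, a + 1)\<close> for \<open>a\<close> in the following set; such an edge is denoted by \<open>(k, a)\<close>.\<close>

definition slots :: "nat \<Rightarrow> nat \<Rightarrow> nat \<Rightarrow> int set" where
  "slots N M k = {a. - int (M + N) \<le> a \<and> a \<le> -1 \<and> - int M \<le> a + int k \<and> a + int k \<le> int N - 1}"

definition particles :: "nat \<Rightarrow> nat \<Rightarrow> nat \<Rightarrow> int set set" where
  "particles N M k = {P. P \<subseteq> slots N M k \<and> card P = M}"

lemma slots_left: "k \<le> N \<Longrightarrow> slots N M k = {- int (M + k)..-1}"
  by (auto simp: slots_def)

lemma slots_right: "N \<le> k \<Longrightarrow> slots N M k = {- int (M + N)..int N - 1 - int k}"
  by (auto simp: slots_def)

lemma finite_slots [simp]: "finite (slots N M k)"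
  by (rule finite_subset[of _ "{- int (M + N)..-1}"]) (auto simp: slots_def)

lemma finite_particles [simp]: "finite (particles N M k)"
  by (rule finite_subset[of _ "Pow (slots N M k)"]) (auto simp: particles_def)

lemma finite_particle: "P \<in> particles N M k \<Longrightarrow> finite P"
  by (auto simp: particles_def intro: finite_subset)

text \<open>A particle moved by \<open>S\<close> is left alone by \<open>P - S\<close> and
  conversely, so both shifts together add 1 to every particle: the complement undoes a step up to a
  translation. Injectivity keeps moved particles from landing in \<open>P - S\<close>.\<close>

lemma moved_complement:
  assumes SP: "S \<subseteq> P" and inj: "inj_on (moved S) P"
  shows "(\<lambda>p. p - 1) ` moved (P - S) ` moved S ` P = P"
    "(\<lambda>p. p - 1) ` (moved S ` P - (P - S)) = S"
    "inj_on (moved (P - S)) (moved S ` P)" "P - S \<subseteq> moved S ` P"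
proof -
  have S: "p + 1 \<notin> P - S" if "p \<in> S" for p
  proof
    assume "p + 1 \<in> P - S"
    then have "moved S p = moved S (p + 1)" "p + 1 \<in> P" using that by (auto simp: moved_def)
    then show False using inj_onD[OF inj, of p "p + 1"] SP that by auto
  qed
  have eq: "moved (P - S) (moved S p) = p + 1" if "p \<in> P" for p
    using S that by (auto simp: moved_def)
  show "(\<lambda>p. p - 1) ` moved (P - S) ` moved S ` P = P"
    by (simp add: image_image eq)
  show "inj_on (moved (P - S)) (moved S ` P)"
    by (rule inj_onI) (auto simp: eq)
  have "p \<in> moved S ` P" if "p \<in> P - S" for p
    using that by (intro image_eqI[of _ _ p]) (auto simp: moved_def)
  then show "P - S \<subseteq> moved S ` P" by blast
  have "x \<in> moved S ` P - (P - S) \<longleftrightarrow> x - 1 \<in> S" for x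
  proof
    assume "x \<in> moved S ` P - (P - S)"
    then show "x - 1 \<in> S" by (auto simp: moved_def split: if_splits)
  next
    assume x: "x - 1 \<in> S"
    then have "x = moved S (x - 1)" by (simp add: moved_def)
    then have "x \<in> moved S ` P" using x SP by blast
    then show "x \<in> moved S ` P - (P - S)" using S[OF x] by simp
  qed
  then have "moved S ` P - (P - S) = (\<lambda>p. p + 1) ` S"
    by (intro Set.set_eqI) (auto simp: image_iff intro: bexI[of _ "_ - 1"])
  then show "(\<lambda>p. p - 1) ` (moved S ` P - (P - S)) = S"
    by (simp add: image_image)
qed

text \<open>The composition in the other order, with the translation by 1 inserted after the first
  shift. Both lemmas together give the bijection behind \<open>sum_shifts_dual\<close>.\<close>

lemma moved_complement_inverse:
  assumes SP: "S \<subseteq> P" and inj: "inj_on (moved S) P"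
  shows "moved ((\<lambda>p. p - 1) ` (P - S)) ` (\<lambda>p. p - 1) ` moved S ` P = P"
    "(\<lambda>p. p - 1) ` moved S ` P - (\<lambda>p. p - 1) ` (P - S) = S"
    "inj_on (moved ((\<lambda>p. p - 1) ` (P - S))) ((\<lambda>p. p - 1) ` moved S ` P)"
    "(\<lambda>p. p - 1) ` (P - S) \<subseteq> (\<lambda>p. p - 1) ` moved S ` P"
proof -
  let ?T = "(\<lambda>p. p - 1) ` (P - S)" and ?P' = "(\<lambda>p. p - 1) ` moved S ` P"
  have S: "p + 1 \<notin> P - S" if "p \<in> S" for p
  proof
    assume "p + 1 \<in> P - S"
    then have "moved S p = moved S (p + 1)" "p + 1 \<in> P" using that by (auto simp: moved_def)
    then show False using inj_onD[OF inj, of p "p + 1"] SP that by auto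
  qed
  have T: "x \<in> ?T \<longleftrightarrow> x + 1 \<in> P - S" for x
    using image_eqI[of x "\<lambda>p. p - 1" "x + 1" "P - S"] by auto
  have eq: "moved ?T (moved S p - 1) = p" if "p \<in> P" for p
    using S[of p] that unfolding moved_def T by auto
  show "moved ?T ` ?P' = P"
    by (simp add: image_image eq)
  show "inj_on (moved ?T) ?P'"
    by (rule inj_onI) (auto simp: eq)
  have "p - 1 \<in> ?P'" if "p \<in> P - S" for p
    using that by (intro image_eqI[of _ _ p]) (auto simp: moved_def)
  then show "?T \<subseteq> ?P'" by blast
  show "?P' - ?T = S"
  proof (intro equalityI subsetI)
    fix x assume "x \<in> ?P' - ?T"
    then show "x \<in> S" unfolding Diff_iff T by (auto simp: moved_def split: if_splits)
  next
    fix x assume x: "x \<in> S"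
    then have "x = moved S x - 1" by (simp add: moved_def)
    then have "x \<in> ?P'" using x SP by blast
    then show "x \<in> ?P' - ?T" using S[OF x] by (simp only: Diff_iff T) auto
  qed
qed

text \<open>Reading a step backwards: the particles that stay put in one direction are those that
  move relative to the sheared lattice in the other.\<close>

lemma sum_shifts_dual:
  fixes f g :: "int set \<Rightarrow> real"
  shows "(\<Sum>P'\<in>particles N M (Suc k). (\<Sum>S\<in>{S \<in> shifts (slots N M k) P'. ok (moved S ` P')}. f (moved S ` P')) * g P') =
    (\<Sum>P\<in>{P \<in> particles N M k. ok P}. f P *
      (\<Sum>S\<in>shifts ((+) 1 ` slots N M (Suc k)) P. g ((\<lambda>p. p - 1) ` moved S ` P)))"
proof -
  let ?A = "SIGMA P':particles N M (Suc k). {S \<in> shifts (slots N M k) P'. ok (moved S ` P')}"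
  let ?B = "SIGMA P:{P \<in> particles N M k. ok P}. shifts ((+) 1 ` slots N M (Suc k)) P"
  have "(\<Sum>P'\<in>particles N M (Suc k). (\<Sum>S\<in>{S \<in> shifts (slots N M k) P'. ok (moved S ` P')}. f (moved S ` P')) * g P') =
      (\<Sum>(P', S)\<in>?A. f (moved S ` P') * g P')"
    unfolding sum_distrib_right by (rule sum.Sigma) (auto simp: finite_particle)
  also have "\<dots> = (\<Sum>(P, S)\<in>?B. f P * g ((\<lambda>p. p - 1) ` moved S ` P))"
  proof (rule sum.reindex_bij_witness[where
        i = "\<lambda>(P, S). ((\<lambda>p. p - 1) ` moved S ` P, (\<lambda>p. p - 1) ` (P - S))" and
        j = "\<lambda>(P', S). (moved S ` P', P' - S)"])
    {
      fix a assume "a \<in> ?A"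
      then obtain P S where a: "a = (P, S)" "P \<in> particles N M (Suc k)" "S \<subseteq> P" "inj_on (moved S) P"
        "moved S ` P \<subseteq> slots N M k" "ok (moved S ` P)"
        by (auto simp: shifts_def)
      note f = moved_complement[OF a(3,4)]
      show "(case case a of (P', S) \<Rightarrow> (moved S ` P', P' - S) of
          (P, S) \<Rightarrow> ((\<lambda>p. p - 1) ` moved S ` P, (\<lambda>p. p - 1) ` (P - S))) = a"
        using f by (simp add: a(1))
      have "moved (P - S) ` moved S ` P = (+) 1 ` P"
        using arg_cong[OF f(1), of "image ((+) 1)"] by (simp add: image_image)
      then have "moved (P - S) ` moved S ` P \<subseteq> (+) 1 ` slots N M (Suc k)"
        using a(2) by (auto simp: particles_def)
      then show "(case a of (P', S) \<Rightarrow> (moved S ` P', P' - S)) \<in> ?B"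
        using a f by (simp add: shifts_def particles_def card_image)
      show "(case case a of (P', S) \<Rightarrow> (moved S ` P', P' - S) of
          (P, S) \<Rightarrow> f P * g ((\<lambda>p. p - 1) ` moved S ` P)) = (case a of (P', S) \<Rightarrow> f (moved S ` P') * g P')"
        using f by (simp add: a(1))
    }
    {
      fix b assume "b \<in> ?B"
      then obtain P S where b: "b = (P, S)" "P \<in> particles N M k" "ok P" "S \<subseteq> P" "inj_on (moved S) P"
        "moved S ` P \<subseteq> (+) 1 ` slots N M (Suc k)"
        by (auto simp: shifts_def)
      note f = moved_complement_inverse[OF b(4,5)]
      show "(case case b of (P, S) \<Rightarrow> ((\<lambda>p. p - 1) ` moved S ` P, (\<lambda>p. p - 1) ` (P - S)) of
          (P', S) \<Rightarrow> (moved S ` P', P' - S)) = b"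
        using f by (simp add: b(1))
      have "(\<lambda>p. p - 1) ` moved S ` P \<subseteq> slots N M (Suc k)"
        using b(6) by auto
      moreover have "card ((\<lambda>p. p - 1) ` moved S ` P) = M"
        using b(2) card_image[OF b(5)] by (simp add: card_image inj_on_def particles_def)
      ultimately show "(case b of (P, S) \<Rightarrow> ((\<lambda>p. p - 1) ` moved S ` P, (\<lambda>p. p - 1) ` (P - S))) \<in> ?A"
        using b f by (simp add: shifts_def particles_def)
    }
  qed
  also have "\<dots> = (\<Sum>P\<in>{P \<in> particles N M k. ok P}. f P *
      (\<Sum>S\<in>shifts ((+) 1 ` slots N M (Suc k)) P. g ((\<lambda>p. p - 1) ` moved S ` P)))"
    unfolding sum_distrib_left by (rule sum.Sigma[symmetric]) (auto simp: finite_particle)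
  finally show ?thesis .
qed

lemma card_slots_last: "card (slots N M (2 * N)) = M"
  by (simp add: slots_right)

text \<open>Adding \<open>k - N\<close> carries column \<open>k\<close> of the right half to column
  \<open>2 * N - k\<close> of the left half, and column \<open>k + 1\<close>, raised by 1 as in
  \<open>sum_shifts_dual\<close>, to column \<open>2 * N - k - 1\<close>. Under this translation the
  claim is \<open>path_count_Suc\<close>.\<close>

lemma path_count_backwards:
  assumes "N \<le> k" "k < 2 * N" and P: "P \<in> particles N M k"
  shows "path_count M (2 * N - k) ((+) (int k - int N) ` P) =
    (\<Sum>S\<in>shifts ((+) 1 ` slots N M (Suc k)) P.
      path_count M (2 * N - Suc k) ((+) (int (Suc k) - int N) ` (\<lambda>p. p - 1) ` moved S ` P))"
proof -
  define d j where "d = int k - int N" and "j = 2 * N - Suc k"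
  have k: "2 * N - k = Suc j" and j: "int j = 2 * int N - int k - 1" using assms by (auto simp: j_def)
  have range: "(+) d ` P \<subseteq> {- int (M + Suc j)..-1}"
    using P assms by (auto simp: particles_def slots_right d_def j)
  have card: "card ((+) d ` P) = M"
    using P by (simp add: card_image particles_def)
  have mem: "d + x \<in> (+) d ` S \<longleftrightarrow> x \<in> S" for x S
    using inj_image_mem_iff[of "(+) d" x S] by simp
  have moved: "moved ((+) d ` S) (d + p) = d + moved S p" for S p
    by (simp add: moved_def mem)
  have shift: "moved ((+) d ` S) ` (+) d ` P = (+) d ` moved S ` P" for S
    by (simp add: image_image moved)
  have inj: "inj_on (moved ((+) d ` S)) ((+) d ` P) \<longleftrightarrow> inj_on (moved S) P" for S
    by (simp add: inj_on_def moved)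
  have slots: "(+) 1 ` slots N M (Suc k) = {- int (M + N) + 1..int N - 1 - int k}"
    using assms by (simp add: slots_right algebra_simps)
  have target: "(+) d ` A \<subseteq> {- int (M + j)..-1} \<longleftrightarrow> A \<subseteq> (+) 1 ` slots N M (Suc k)" for A
    unfolding slots image_subset_iff unfolding subset_eq by (intro ball_cong refl) (auto simp: d_def j)
  have "{T \<in> f ` A. R T} = f ` {S \<in> A. R (f S)}"
    for f :: "int set \<Rightarrow> int set" and A R by auto
  then have shifts: "shifts {- int (M + j)..-1} ((+) d ` P) = (`) ((+) d) ` shifts ((+) 1 ` slots N M (Suc k)) P"
    unfolding shifts_def image_Pow_surj[OF refl, symmetric] by (simp only: inj shift target)
  have "path_count M (Suc j) ((+) d ` P) =
      (\<Sum>S\<in>shifts ((+) 1 ` slots N M (Suc k)) P. path_count M j (moved ((+) d ` S) ` (+) d ` P))"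
    unfolding path_count_Suc[OF range card] shifts
    by (subst sum.reindex) (simp_all add: inj_on_def inj_image_eq_iff)
  moreover have "(+) d ` A = (+) (d + 1) ` (\<lambda>p. p - 1) ` A" for A
    by (simp add: image_image)
  moreover have "int (Suc k) - int N = d + 1" by (simp add: d_def)
  ultimately show ?thesis
    unfolding shift k j_def[symmetric] d_def[symmetric] by (simp only:)
qed

text \<open>\<open>W\<close> stands for the number of partial matchings with a given right end. Its
  pairing with the number \<open>bwd\<close> of completions is the same in all columns right of
  \<open>N\<close>, since \<open>sum_shifts_dual\<close> moves one step from one factor to the
  other. In the last column the pairing is the number sought; in column \<open>N\<close>, where
  \<open>ok\<close> enters, both factors are \<open>path_count M N P\<close>.\<close>

lemma count_eq_sum_path_count_squares:
  fixes W :: "nat \<Rightarrow> int set \<Rightarrow> real" and ok :: "int set \<Rightarrow> bool"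
  assumes "N \<ge> 1"
    and init: "\<And>P. P \<in> particles N M 0 \<Longrightarrow> W 0 P = 1"
    and step: "\<And>k P. k < 2 * N \<Longrightarrow> P \<in> particles N M (Suc k) \<Longrightarrow>
      W (Suc k) P = (\<Sum>S\<in>{S \<in> shifts (slots N M k) P. k = N \<longrightarrow> ok (moved S ` P)}. W k (moved S ` P))"
  shows "W (2 * N) (slots N M (2 * N)) = (\<Sum>P\<in>{P \<in> particles N M N. ok P}. (path_count M N P)\<^sup>2)"
proof -
  have left: "k \<le> N \<Longrightarrow> P \<in> particles N M k \<Longrightarrow> W k P = path_count M k P" for k P
  proof (induction k arbitrary: P)
    case 0
    then show ?case using init[of P] path_count_0[of P M] by (simp add: particles_def slots_left)
  next
    case (Suc k)
    have P: "P \<subseteq> {- int (M + Suc k)..-1}" "card P = M"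
      using Suc.prems by (auto simp: particles_def slots_left)
    have "W (Suc k) P = (\<Sum>S\<in>shifts (slots N M k) P. W k (moved S ` P))"
      using Suc.prems by (subst step) auto
    also have "\<dots> = (\<Sum>S\<in>shifts (slots N M k) P. path_count M k (moved S ` P))"
      using Suc.prems P(2)
      by (intro sum.cong refl Suc.IH) (auto simp: shifts_def particles_def card_image)
    finally show ?case
      using Suc.prems by (simp only: path_count_Suc[OF P] slots_left)
  qed
  define bwd where "bwd k P = path_count M (2 * N - k) ((+) (int k - int N) ` P)" for k P
  define I where "I k = (\<Sum>P\<in>particles N M k. W k P * bwd k P)" for k
  have I_Suc: "I (Suc k) = (\<Sum>P\<in>{P \<in> particles N M k. k = N \<longrightarrow> ok P}. W k P * bwd k P)"
    if "N \<le> k" "k < 2 * N" for k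
  proof -
    have "I (Suc k) = (\<Sum>P\<in>particles N M (Suc k).
        (\<Sum>S\<in>{S \<in> shifts (slots N M k) P. k = N \<longrightarrow> ok (moved S ` P)}. W k (moved S ` P)) * bwd (Suc k) P)"
      unfolding I_def using that by (intro sum.cong refl arg_cong2[where f="(*)"] step) auto
    also have "\<dots> = (\<Sum>P\<in>{P \<in> particles N M k. k = N \<longrightarrow> ok P}. W k P *
        (\<Sum>S\<in>shifts ((+) 1 ` slots N M (Suc k)) P. bwd (Suc k) ((\<lambda>p. p - 1) ` moved S ` P)))"
      by (rule sum_shifts_dual)
    also have "\<dots> = (\<Sum>P\<in>{P \<in> particles N M k. k = N \<longrightarrow> ok P}. W k P * bwd k P)"
      unfolding bwd_def using that by (intro sum.cong refl) (simp add: path_count_backwards)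
    finally show ?thesis .
  qed
  have "I (Suc k) = I k" if "N < k" "k < 2 * N" for k
    using that by (subst I_Suc) (simp_all add: I_def)
  then have "Suc N + i \<le> 2 * N \<Longrightarrow> I (Suc N + i) = I (Suc N)" for i
    by (induction i) simp_all
  from this[of "N - 1"] have "I (2 * N) = I (Suc N)"
    using \<open>N \<ge> 1\<close> by (simp add: mult_2)
  also have "\<dots> = (\<Sum>P\<in>{P \<in> particles N M N. ok P}. W N P * bwd N P)"
    using \<open>N \<ge> 1\<close> by (subst I_Suc) auto
  also have "\<dots> = (\<Sum>P\<in>{P \<in> particles N M N. ok P}. (path_count M N P)\<^sup>2)"
    by (intro sum.cong refl) (simp add: left bwd_def power2_eq_square)
  finally have "I (2 * N) = (\<Sum>P\<in>{P \<in> particles N M N. ok P}. (path_count M N P)\<^sup>2)" .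
  moreover have "particles N M (2 * N) = {slots N M (2 * N)}"
    using card_slots_last[of N M] card_subset_eq[OF finite_slots[of N M "2 * N"]]
    by (auto simp: particles_def)
  moreover have "bwd (2 * N) (slots N M (2 * N)) = 1"
    unfolding bwd_def using card_slots_last[of N M]
    by (simp add: card_image path_count_0 slots_right)
  ultimately show ?thesis by (simp add: I_def)
qed

section \<open>Sets of holes weighted by squared Vandermonde products\<close>

definition sqdisc :: "int set \<Rightarrow> real" where
  "sqdisc S = (\<Prod>a\<in>S. \<Prod>b\<in>S - {a}. real_of_int \<bar>a - b\<bar>)"

lemma sqdisc_pos: "finite S \<Longrightarrow> sqdisc S > 0"
  unfolding sqdisc_def by (intro prod_pos) auto

text \<open>\<open>sqdisc\<close> runs over ordered pairs, so every difference occurs twice; this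
  symmetric form makes it easy to split a set.\<close>

lemma sqdisc_vandermonde:
  assumes "finite P"
  shows "sqdisc P = (vandermonde of_int P)\<^sup>2"
proof -
  have "sqdisc P = (\<Prod>a\<in>P. (\<Prod>b\<in>{b\<in>P. b < a}. real_of_int (a - b)) * (\<Prod>b\<in>{b\<in>P. a < b}. real_of_int (b - a)))"
    unfolding sqdisc_def
  proof (intro prod.cong refl)
    fix a assume "a \<in> P"
    have "P - {a} = {b\<in>P. b < a} \<union> {b\<in>P. a < b}" by auto
    then have "(\<Prod>b\<in>P - {a}. real_of_int \<bar>a - b\<bar>) =
        (\<Prod>b\<in>{b\<in>P. b < a} \<union> {b\<in>P. a < b}. real_of_int \<bar>a - b\<bar>)" by (rule arg_cong)
    also have "\<dots> = (\<Prod>b\<in>{b\<in>P. b < a}. real_of_int \<bar>a - b\<bar>) * (\<Prod>b\<in>{b\<in>P. a < b}. real_of_int \<bar>a - b\<bar>)"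
      by (rule prod.union_disjoint) (use assms in auto)
    also have "(\<Prod>b\<in>{b\<in>P. b < a}. real_of_int \<bar>a - b\<bar>) = (\<Prod>b\<in>{b\<in>P. b < a}. real_of_int (a - b))"
      by (rule prod.cong) auto
    also have "(\<Prod>b\<in>{b\<in>P. a < b}. real_of_int \<bar>a - b\<bar>) = (\<Prod>b\<in>{b\<in>P. a < b}. real_of_int (b - a))"
      by (rule prod.cong) auto
    finally show "(\<Prod>b\<in>P - {a}. real_of_int \<bar>a - b\<bar>) =
        (\<Prod>b\<in>{b\<in>P. b < a}. real_of_int (a - b)) * (\<Prod>b\<in>{b\<in>P. a < b}. real_of_int (b - a))" .
  qed
  moreover have "(\<Prod>a\<in>P. \<Prod>b\<in>{b\<in>P. a < b}. real_of_int (b - a)) =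
      (\<Prod>b\<in>P. \<Prod>a\<in>{a\<in>P. a < b}. real_of_int (b - a))"
    by (rule prod.swap_restrict[OF assms assms, of "\<lambda>a b. real_of_int (b - a)" "(<)"])
  ultimately show ?thesis
    by (simp add: prod.distrib vandermonde_def power2_eq_square)
qed

text \<open>With \<open>H = X - P\<close>, the ordered pairs of \<open>X\<close> split into those
  inside \<open>P\<close>, those inside \<open>H\<close> and the mixed ones, which contribute
  \<open>m\<close> twice. The product of the distances from \<open>P\<close> is
  \<open>sqdisc P * m\<close>.\<close>

lemma sqdisc_complement:
  assumes "finite X" "P \<subseteq> X"
  shows "sqdisc (X - P) * (\<Prod>p\<in>P. \<Prod>x\<in>X - {p}. real_of_int \<bar>p - x\<bar>)\<^sup>2 = sqdisc X * sqdisc P"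
proof -
  define H where "H = X - P"
  have fin: "finite P" "finite H" using assms finite_subset by (auto simp: H_def)
  have X: "X = P \<union> H" "P \<inter> H = {}" using assms by (auto simp: H_def)
  define m where "m = (\<Prod>p\<in>P. \<Prod>h\<in>H. real_of_int \<bar>p - h\<bar>)"
  have split: "(\<Prod>a\<in>A. \<Prod>b\<in>A \<union> B - {a}. real_of_int \<bar>a - b\<bar>) =
      sqdisc A * (\<Prod>a\<in>A. \<Prod>b\<in>B. real_of_int \<bar>a - b\<bar>)"
    if "finite A" "finite B" "A \<inter> B = {}" for A B
  proof -
    have "(\<Prod>b\<in>A \<union> B - {a}. real_of_int \<bar>a - b\<bar>) =
      (\<Prod>b\<in>A - {a}. real_of_int \<bar>a - b\<bar>) * (\<Prod>b\<in>B. real_of_int \<bar>a - b\<bar>)" if "a \<in> A" for a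
    proof -
      have "A \<union> B - {a} = (A - {a}) \<union> B" using that \<open>A \<inter> B = {}\<close> by auto
      then show ?thesis
        using that \<open>A \<inter> B = {}\<close> \<open>finite A\<close> \<open>finite B\<close> by (simp only:) (rule prod.union_disjoint, auto)
    qed
    then show ?thesis by (simp add: sqdisc_def prod.distrib)
  qed
  have m': "(\<Prod>h\<in>H. \<Prod>p\<in>P. real_of_int \<bar>h - p\<bar>) = m"
    unfolding m_def by (subst prod.swap) (simp add: abs_minus_commute)
  have d: "(\<Prod>p\<in>P. \<Prod>x\<in>X - {p}. real_of_int \<bar>p - x\<bar>) = sqdisc P * m"
    using split[OF fin X(2)] by (simp add: X(1) m_def)
  have d': "(\<Prod>h\<in>H. \<Prod>x\<in>X - {h}. real_of_int \<bar>h - x\<bar>) = sqdisc H * m"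
    using split[OF fin(2,1)] X m' by (simp add: Un_commute Int_commute)
  have "sqdisc X = (sqdisc P * m) * (sqdisc H * m)"
    unfolding d[symmetric] d'[symmetric] unfolding sqdisc_def
    by (subst (1) X(1)) (rule prod.union_disjoint, use fin X in auto)
  then show ?thesis
    unfolding d by (simp add: H_def[symmetric] power2_eq_square)
qed

lemma prod_abs_diff_interval:
  assumes "p \<in> {- int L..-1}"
  shows "(\<Prod>x\<in>{- int L..-1} - {p}. real_of_int \<bar>p - x\<bar>) = fact (nat (-1 - p)) * fact (nat (int L + p))"
proof -
  have "{- int L..-1} - {p} = (\<lambda>i. p + int i) ` {1..nat (-1 - p)} \<union> (\<lambda>i. p - int i) ` {1..nat (int L + p)}"
  proof (intro Set.set_eqI iffI)
    fix x assume x: "x \<in> {- int L..-1} - {p}"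
    show "x \<in> (\<lambda>i. p + int i) ` {1..nat (-1 - p)} \<union> (\<lambda>i. p - int i) ` {1..nat (int L + p)}"
    proof (cases "x > p")
      case True
      then show ?thesis using x by (intro UnI1 image_eqI[of _ _ "nat (x - p)"]) auto
    next
      case False
      then show ?thesis using x by (intro UnI2 image_eqI[of _ _ "nat (p - x)"]) auto
    qed
  qed (use assms in auto)
  then have "(\<Prod>x\<in>{- int L..-1} - {p}. real_of_int \<bar>p - x\<bar>) =
      (\<Prod>x\<in>(\<lambda>i. p + int i) ` {1..nat (-1 - p)}. real_of_int \<bar>p - x\<bar>) *
      (\<Prod>x\<in>(\<lambda>i. p - int i) ` {1..nat (int L + p)}. real_of_int \<bar>p - x\<bar>)"
    by (simp only:) (rule prod.union_disjoint, auto)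
  also have "\<dots> = fact (nat (-1 - p)) * fact (nat (int L + p))"
    by (simp add: prod.reindex inj_on_def fact_prod)
  finally show ?thesis .
qed

text \<open>The factorials in \<open>path_weight\<close> form the distance product of
  \<open>sqdisc_complement\<close>, which turns the weight of the particles into one of the holes;
  \<kappa> collects the factors independent of \<open>P\<close>.\<close>

lemma path_count_square_eq_sqdisc:
  "\<exists>\<kappa>>0. \<forall>P\<subseteq>{- int (M + N)..-1}. (path_count M N P)\<^sup>2 = \<kappa> * sqdisc ({- int (M + N)..-1} - P)"
proof -
  let ?X = "{- int (M + N)..-1}"
  define K where "K = (\<Prod>l<N. \<Prod>i<M. real M + real l - real i) / path_weight M 0 {- int M..-1}"
  have "K > 0" unfolding K_def by (intro divide_pos_pos prod_pos path_weight_pos) auto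
  moreover have "(path_count M N P)\<^sup>2 = K\<^sup>2 / sqdisc ?X * sqdisc (?X - P)" if P: "P \<subseteq> ?X" for P
  proof -
    have fin: "finite P" using P finite_subset by blast
    define D where "D = (\<Prod>p\<in>P. fact (nat (-1 - p)) * fact (nat (int (M + N) + p)) :: real)"
    have "D > 0" unfolding D_def by (intro prod_pos) auto
    have "D = (\<Prod>p\<in>P. \<Prod>x\<in>?X - {p}. real_of_int \<bar>p - x\<bar>)"
      unfolding D_def using P by (intro prod.cong refl prod_abs_diff_interval[symmetric]) auto
    then have "sqdisc (?X - P) * D\<^sup>2 = sqdisc ?X * sqdisc P"
      using sqdisc_complement[OF _ P] by simp
    then have "(vandermonde of_int P)\<^sup>2 / D\<^sup>2 = sqdisc (?X - P) / sqdisc ?X"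
      using \<open>D > 0\<close> sqdisc_pos[of ?X] by (simp add: sqdisc_vandermonde[OF fin] field_simps)
    moreover have "(path_count M N P)\<^sup>2 = K\<^sup>2 * ((vandermonde of_int P)\<^sup>2 / D\<^sup>2)"
      by (simp add: path_count_def path_weight_def[of M N P] D_def K_def power_mult_distrib power_divide)
    ultimately show ?thesis
      by (simp only: times_divide_eq_right times_divide_eq_left)
  qed
  ultimately show ?thesis
    using sqdisc_pos[of ?X] by (intro exI[of _ "K\<^sup>2 / sqdisc ?X"]) (simp add: zero_less_divide_iff)
qed

lemma sqdisc_insert:
  assumes "finite H" "x \<notin> H"
  shows "sqdisc (insert x H) = sqdisc H * (\<Prod>h\<in>H. real_of_int x - real_of_int h)\<^sup>2"
proof -
  have "(\<Prod>b\<in>insert x H - {a}. real_of_int \<bar>a - b\<bar>) = real_of_int \<bar>a - x\<bar> * (\<Prod>b\<in>H - {a}. real_of_int \<bar>a - b\<bar>)"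
    if "a \<in> H" for a
  proof -
    have "insert x H - {a} = insert x (H - {a})" using that assms by auto
    then show ?thesis using assms by simp
  qed
  then have "sqdisc (insert x H) = (\<Prod>h\<in>H. real_of_int \<bar>x - h\<bar>) * ((\<Prod>h\<in>H. real_of_int \<bar>h - x\<bar>) * sqdisc H)"
    using assms by (simp add: sqdisc_def prod.distrib insert_Diff_if)
  moreover have "real_of_int \<bar>x - h\<bar> * real_of_int \<bar>h - x\<bar> = (real_of_int x - real_of_int h)\<^sup>2" for h
    by (cases "x \<le> h") (simp_all add: power2_eq_square algebra_simps)
  then have "(\<Prod>h\<in>H. real_of_int \<bar>x - h\<bar>) * (\<Prod>h\<in>H. real_of_int \<bar>h - x\<bar>) =
      (\<Prod>h\<in>H. real_of_int x - real_of_int h)\<^sup>2"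
    by (simp only: prod_power_distrib flip: prod.distrib)
  ultimately show ?thesis by simp
qed

lemma lagrange_interpolation:
  fixes Q :: "real poly" and H :: "real set"
  assumes "finite H" "degree Q < card H"
  shows "poly Q c = (\<Sum>x\<in>H. poly Q x * (\<Prod>h\<in>H - {x}. (c - h) / (x - h)))"
proof -
  define R where "R = (\<Sum>x\<in>H. Polynomial.smult (poly Q x) (\<Prod>h\<in>H - {x}. Polynomial.smult (1 / (x - h)) [:- h, 1:]))"
  have "degree (\<Prod>h\<in>H - {x}. Polynomial.smult (1 / (x - h)) [:- h, 1:]) \<le> card H - 1" if "x \<in> H" for x
    using degree_prod_sum_le[of "H - {x}" "\<lambda>h. Polynomial.smult (1 / (x - h)) [:- h, 1:]"] assms that
    by (simp add: order.trans[OF _ sum_bounded_above[of "H - {x}" _ 1]])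
  then have deg: "degree R \<le> card H - 1"
    unfolding R_def using assms(1) by (intro degree_sum_le order.trans[OF degree_smult_le]) auto
  have poly_R: "poly R y = (\<Sum>x\<in>H. poly Q x * (\<Prod>h\<in>H - {x}. (y - h) / (x - h)))" for y
    by (simp add: R_def poly_sum poly_prod diff_divide_distrib)
  have "poly R y = poly Q y" if "y \<in> H" for y
  proof -
    have "poly Q x * (\<Prod>h\<in>H - {x}. (y - h) / (x - h)) = (if x = y then poly Q y else 0)" if "x \<in> H" for x
      using that \<open>y \<in> H\<close> assms(1) by auto
    then show ?thesis unfolding poly_R using assms(1) that by simp
  qed
  then have "R = Q"
    using deg assms(2) by (intro poly_eqI_degree[of H]) auto
  then show ?thesis using poly_R[of c] by simp
qed

text \<open>Splitting off the element \<open>c\<close> leaves the square of a polynomial evaluated at \<open>c\<close>. One of the two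
  factors is expanded with the reproducing polynomial \<open>Q\<close>, and resumming over the set that contains the new
  point turns the other one into the Lagrange interpolation formula for \<open>Q\<close>.\<close>

lemma sum_sqdisc_containing:
  fixes Q :: "real poly"
  assumes X: "finite X" "c \<in> X" and deg: "degree Q < N"
    and repr: "\<And>q. degree q < N \<Longrightarrow> (\<Sum>x\<in>X. poly Q (of_int x) * poly q (of_int x)) = poly q (of_int c)"
  shows "(\<Sum>H | H \<subseteq> X \<and> card H = N \<and> c \<in> H. sqdisc H) =
    poly Q (of_int c) * (\<Sum>H | H \<subseteq> X \<and> card H = N. sqdisc H)"
proof -
  define \<pi> where "\<pi> H x = (\<Prod>h\<in>H. real_of_int x - real_of_int h)" for H x
  let ?G = "{H. H \<subseteq> X \<and> card H = N - 1}"
  have fin: "finite H" if "H \<subseteq> X" for H using X that finite_subset by blast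
  have finG: "finite ?G" using X by simp
  have N: "N > 0" using deg by simp
  have inj: "inj_on real_of_int A" for A by (simp add: inj_on_def)
  have "(\<Sum>H | H \<subseteq> X \<and> card H = N \<and> c \<in> H. sqdisc H) =
      (\<Sum>H | H \<subseteq> X \<and> card H = N - 1 \<and> c \<notin> H. sqdisc H * (\<pi> H c)\<^sup>2)"
  proof (rule sum.reindex_bij_witness[of _ "insert c" "\<lambda>H. H - {c}"])
    fix H assume H: "H \<in> {H. H \<subseteq> X \<and> card H = N \<and> c \<in> H}"
    then show "insert c (H - {c}) = H" and
      "H - {c} \<in> {H. H \<subseteq> X \<and> card H = N - 1 \<and> c \<notin> H}" by auto
    show "sqdisc (H - {c}) * (\<pi> (H - {c}) c)\<^sup>2 = sqdisc H"
      using H fin sqdisc_insert[of "H - {c}" c] by (simp add: \<pi>_def insert_absorb)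
  next
    fix H assume H: "H \<in> {H. H \<subseteq> X \<and> card H = N - 1 \<and> c \<notin> H}"
    then show "insert c H - {c} = H" by simp
    show "insert c H \<in> {H. H \<subseteq> X \<and> card H = N \<and> c \<in> H}"
      using H X N fin by simp
  qed
  also have "\<dots> = (\<Sum>H\<in>?G. sqdisc H * (\<pi> H c)\<^sup>2)"
    by (rule sum.mono_neutral_left) (use finG fin in \<open>auto simp: \<pi>_def\<close>)
  also have "\<dots> = (\<Sum>H\<in>?G. \<Sum>x\<in>X - H. sqdisc H * poly Q (of_int x) * \<pi> H x * \<pi> H c)"
  proof (intro sum.cong refl)
    fix H assume H: "H \<in> ?G"
    define q where "q = (\<Prod>h\<in>H. [:- real_of_int h, 1:])"
    have "degree q = N - 1"
      unfolding q_def using H by (subst degree_prod_sum_eq) auto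
    then have "\<pi> H c = (\<Sum>x\<in>X. poly Q (of_int x) * \<pi> H x)"
      using repr[of q] N by (simp add: q_def \<pi>_def poly_prod)
    also have "\<dots> = (\<Sum>x\<in>X - H. poly Q (of_int x) * \<pi> H x)"
      by (rule sum.mono_neutral_right) (use X H fin in \<open>auto simp: \<pi>_def\<close>)
    finally have "sqdisc H * (\<pi> H c)\<^sup>2 = sqdisc H * \<pi> H c * (\<Sum>x\<in>X - H. poly Q (of_int x) * \<pi> H x)"
      by (simp add: power2_eq_square)
    then show "sqdisc H * (\<pi> H c)\<^sup>2 = (\<Sum>x\<in>X - H. sqdisc H * poly Q (of_int x) * \<pi> H x * \<pi> H c)"
      by (simp add: sum_distrib_left mult_ac)
  qed
  also have "\<dots> = (\<Sum>(H, x)\<in>(SIGMA H:?G. X - H). sqdisc H * poly Q (of_int x) * \<pi> H x * \<pi> H c)"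
    by (rule sum.Sigma) (use finG X in auto)
  \<comment> \<open>Inserting \<open>x\<close> multiplies \<open>sqdisc\<close> by the square of
    \<open>\<pi> H x\<close>, which is nonzero as \<open>x\<close> is not in \<open>H\<close>.
    Dividing by it turns \<open>\<pi> H x * \<pi> H c\<close> into a Lagrange quotient.\<close>
  also have "\<dots> = (\<Sum>(H, x)\<in>(SIGMA H:{H. H \<subseteq> X \<and> card H = N}. H).
      sqdisc H * (poly Q (of_int x) * (\<pi> (H - {x}) c / \<pi> (H - {x}) x)))"
  proof (rule sum.reindex_bij_witness[of _ "\<lambda>(H, x). (H - {x}, x)" "\<lambda>(H, x). (insert x H, x)"])
    fix a assume "a \<in> (SIGMA H:?G. X - H)"
    then obtain H x where a: "a = (H, x)" "H \<subseteq> X" "card H = N - 1" "x \<in> X" "x \<notin> H" by auto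
    have nz: "\<pi> H x \<noteq> 0" using a fin[OF a(2)] by (auto simp: \<pi>_def)
    have "insert x H - {x} = H" using a by auto
    moreover have "sqdisc (insert x H) = sqdisc H * (\<pi> H x)\<^sup>2"
      using sqdisc_insert[OF fin[OF a(2)] a(5)] by (simp add: \<pi>_def)
    ultimately show "(case case a of (H, x) \<Rightarrow> (insert x H, x) of
        (H, x) \<Rightarrow> sqdisc H * (poly Q (of_int x) * (\<pi> (H - {x}) c / \<pi> (H - {x}) x))) =
        (case a of (H, x) \<Rightarrow> sqdisc H * poly Q (of_int x) * \<pi> H x * \<pi> H c)"
      using nz by (simp add: a(1) power2_eq_square)
    show "(case a of (H, x) \<Rightarrow> (insert x H, x)) \<in> (SIGMA H:{H. H \<subseteq> X \<and> card H = N}. H)"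
      using a N fin[OF a(2)] by simp
    show "(case case a of (H, x) \<Rightarrow> (insert x H, x) of (H, x) \<Rightarrow> (H - {x}, x)) = a"
      using a by simp
  next
    fix b assume "b \<in> (SIGMA H:{H. H \<subseteq> X \<and> card H = N}. H)"
    then obtain H x where b: "b = (H, x)" "H \<subseteq> X" "card H = N" "x \<in> H" by auto
    show "(case case b of (H, x) \<Rightarrow> (H - {x}, x) of (H, x) \<Rightarrow> (insert x H, x)) = b"
      using b by (simp add: insert_absorb)
    show "(case b of (H, x) \<Rightarrow> (H - {x}, x)) \<in> (SIGMA H:?G. X - H)"
      using b by auto
  qed
  also have "\<dots> = (\<Sum>H | H \<subseteq> X \<and> card H = N. \<Sum>x\<in>H.
      sqdisc H * (poly Q (of_int x) * (\<pi> (H - {x}) c / \<pi> (H - {x}) x)))"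
    by (rule sum.Sigma[symmetric]) (use X fin in auto)
  also have "\<dots> = (\<Sum>H | H \<subseteq> X \<and> card H = N. poly Q (of_int c) * sqdisc H)"
  proof (intro sum.cong refl)
    fix H assume "H \<in> {H. H \<subseteq> X \<and> card H = N}"
    then have H: "finite H" "card H = N" using fin by auto
    have "poly Q (of_int c) = (\<Sum>x\<in>of_int ` H. poly Q x * (\<Prod>h\<in>of_int ` H - {x}. (of_int c - h) / (x - h)))"
      using H deg by (intro lagrange_interpolation) (auto simp: card_image[OF inj])
    also have "\<dots> = (\<Sum>x\<in>H. poly Q (of_int x) * (\<Prod>h\<in>real_of_int ` H - {of_int x}. (of_int c - h) / (of_int x - h)))"
      by (simp add: sum.reindex[OF inj])
    also have "\<dots> = (\<Sum>x\<in>H. poly Q (of_int x) * (\<pi> (H - {x}) c / \<pi> (H - {x}) x))"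
    proof (intro sum.cong refl arg_cong2[where f="(*)"])
      fix x
      have "real_of_int ` H - {of_int x} = of_int ` (H - {x})" by auto
      then show "(\<Prod>h\<in>real_of_int ` H - {of_int x}. (of_int c - h) / (of_int x - h)) =
          \<pi> (H - {x}) c / \<pi> (H - {x}) x"
        by (simp add: prod.reindex[OF inj] \<pi>_def prod_dividef)
    qed
    finally show "(\<Sum>x\<in>H. sqdisc H * (poly Q (of_int x) * (\<pi> (H - {x}) c / \<pi> (H - {x}) x))) =
        poly Q (of_int c) * sqdisc H"
      by (simp only: sum_distrib_left[symmetric] mult.commute)
  qed
  finally show ?thesis by (simp add: sum_distrib_left)
qed

section \<open>Discrete Chebyshev polynomials\<close>

text \<open>Discrete Chebyshev polynomials for \<open>L\<close> equidistant nodes, recentred at 0.\<close>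

fun cheb :: "real \<Rightarrow> nat \<Rightarrow> real poly" where
  "cheb L 0 = 1"
| "cheb L (Suc 0) = [:0, 2:]"
| "cheb L (Suc (Suc k)) = Polynomial.smult (1 / real (k + 2))
    (Polynomial.smult (2 * real (2 * k + 3)) ([:0, 1:] * cheb L (Suc k)) -
     Polynomial.smult (real (k + 1) * (L\<^sup>2 - (real (k + 1))\<^sup>2)) (cheb L k))"

text \<open>One recurrence for all \<open>k\<close>: at \<open>k = 0\<close> the truncated index
  \<open>k - 1\<close> is multiplied by 0.\<close>

lemma poly_cheb_rec:
  "real (Suc k) * poly (cheb L (Suc k)) y =
    2 * real (2 * k + 1) * y * poly (cheb L k) y - real k * (L\<^sup>2 - (real k)\<^sup>2) * poly (cheb L (k - 1)) y"
  by (cases k) (simp_all add: field_simps)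

lemma cheb_degree_lead: "degree (cheb L k) = k \<and> lead_coeff (cheb L k) > 0"
proof (induction L k rule: cheb.induct)
  case (3 L k)
  define p where "p = Polynomial.smult (2 * real (2 * k + 3)) ([:0, 1:] * cheb L (Suc k))"
  define q where "q = Polynomial.smult (real (k + 1) * (L\<^sup>2 - (real (k + 1))\<^sup>2)) (cheb L k)"
  have eq: "cheb L (Suc (Suc k)) = Polynomial.smult (1 / real (k + 2)) (p - q)"
    unfolding p_def q_def by (rule cheb.simps(3))
  have nz: "cheb L (Suc k) \<noteq> 0" using 3 by auto
  have p: "degree p = k + 2"
    using 3 nz unfolding p_def by (simp add: degree_mult_eq)
  have q: "degree q < degree p"
    using 3 degree_smult_le[of _ "cheb L k"] unfolding p by (auto simp: q_def intro: le_less_trans)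
  have deg: "degree (p - q) = k + 2"
    using degree_add_eq_left[of "- q" p] q p by simp
  have "coeff q (k + 2) = 0" using q p by (intro coeff_eq_0) simp
  moreover have "coeff p (k + 2) = 2 * real (2 * k + 3) * lead_coeff (cheb L (Suc k))"
    using 3 by (simp add: p_def)
  moreover have "lead_coeff (cheb L (Suc k)) > 0" using 3(1) by (rule conjunct2)
  ultimately have "coeff (p - q) (k + 2) > 0"
    by (simp only: coeff_diff) (simp add: zero_less_mult_iff)
  then show ?case using deg unfolding eq by simp
qed simp_all

lemma degree_cheb [simp]: "degree (cheb L k) = k"
  using cheb_degree_lead by blast

lemma poly_cheb_reflect: "poly (cheb L k) (- y) = (-1) ^ k * poly (cheb L k) y"
  by (induction L k rule: cheb.induct) (simp_all add: algebra_simps)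

text \<open>The structure relation of the family, obtained by combining the recurrences at
  \<open>y\<close> and \<open>y - 1\<close>. For \<open>L = 2 * m + 1\<close> the quadratic \<sigma>
  vanishes at \<open>- m\<close> and \<open>m + 1\<close>, just where a telescoping sum over the
  nodes begins and ends.\<close>

lemma poly_cheb_difference:
  fixes L y :: real
  defines "\<sigma> \<equiv> L\<^sup>2 / 4 - (y - 1 / 2)\<^sup>2"
  shows "\<sigma> * (poly (cheb L k) y - poly (cheb L k) (y - 1)) =
    (real k * (real k + 1) / 2 - real k * y) * poly (cheb L k) y +
    real k * (L\<^sup>2 - (real k)\<^sup>2) / 2 * poly (cheb L (k - 1)) y"
proof (induction k rule: less_induct)
  case (less k)
  consider "k = 0" | "k = 1" | j where "k = Suc (Suc j)"
    by (metis One_nat_def not0_implies_Suc)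
  then show ?case
  proof cases
    case 3
    define t where "t i = poly (cheb L i) y" for i
    define u where "u i = poly (cheb L i) (y - 1)" for i
    define s where "s = real j"
    have IH1: "\<sigma> * (t (Suc j) - u (Suc j)) =
        ((s + 1) * (s + 2) / 2 - (s + 1) * y) * t (Suc j) + (s + 1) * (L\<^sup>2 - (s + 1)\<^sup>2) / 2 * t j"
      using less.IH[of "Suc j"] 3 by (simp add: t_def u_def s_def algebra_simps)
    have IH2: "\<sigma> * (t j - u j) = (s * (s + 1) / 2 - s * y) * t j + s * (L\<^sup>2 - s\<^sup>2) / 2 * t (j - 1)"
      using less.IH[of j] 3 by (simp add: t_def u_def s_def algebra_simps)
    have R: "s * (L\<^sup>2 - s\<^sup>2) * t (j - 1) = 2 * (2 * s + 1) * y * t j - (s + 1) * t (Suc j)"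
      using poly_cheb_rec[of j L y] by (simp add: t_def s_def algebra_simps)
    have T: "(s + 2) * t (Suc (Suc j)) = 2 * (2 * s + 3) * y * t (Suc j) - (s + 1) * (L\<^sup>2 - (s + 1)\<^sup>2) * t j"
      using poly_cheb_rec[of "Suc j" L y] by (simp add: t_def s_def algebra_simps)
    have U: "(s + 2) * u (Suc (Suc j)) =
        2 * (2 * s + 3) * (y - 1) * u (Suc j) - (s + 1) * (L\<^sup>2 - (s + 1)\<^sup>2) * u j"
      using poly_cheb_rec[of "Suc j" L "y - 1"] by (simp add: u_def s_def algebra_simps)
    \<comment> \<open>The recurrence eliminates \<open>t (j - 1)\<close>, so that only
      \<open>t (Suc j)\<close> and \<open>t j\<close> remain in the identity to be checked.\<close>
    have IH2': "\<sigma> * (t j - u j) = (s * (s + 1) / 2 - s * y) * t j + (2 * (2 * s + 1) * y * t j - (s + 1) * t (Suc j)) / 2"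
      unfolding IH2 R[symmetric] by (simp add: field_simps)
    have "(s + 2) * (\<sigma> * (t (Suc (Suc j)) - u (Suc (Suc j)))) =
        \<sigma> * ((s + 2) * t (Suc (Suc j)) - (s + 2) * u (Suc (Suc j)))" by (simp add: algebra_simps)
    also have "\<dots> = 2 * (2 * s + 3) * (\<sigma> * t (Suc j) + (y - 1) * (\<sigma> * (t (Suc j) - u (Suc j)))) -
        (s + 1) * (L\<^sup>2 - (s + 1)\<^sup>2) * (\<sigma> * (t j - u j))"
      unfolding T U by (simp add: algebra_simps)
    also have "\<dots> = ((s + 2) * (s + 3) / 2 - (s + 2) * y) * ((s + 2) * t (Suc (Suc j))) +
        (s + 2) * ((s + 2) * (L\<^sup>2 - (s + 2)\<^sup>2) / 2 * t (Suc j))"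
      unfolding T IH1 IH2' unfolding \<sigma>_def by (simp add: power2_eq_square field_simps)
    finally have "(s + 2) * (\<sigma> * (t (Suc (Suc j)) - u (Suc (Suc j)))) =
        (s + 2) * (((s + 2) * (s + 3) / 2 - (s + 2) * y) * t (Suc (Suc j)) +
          (s + 2) * (L\<^sup>2 - (s + 2)\<^sup>2) / 2 * t (Suc j))"
      by (simp add: algebra_simps)
    moreover have "s + 2 \<noteq> 0" by (simp add: s_def)
    ultimately have "\<sigma> * (t (Suc (Suc j)) - u (Suc (Suc j))) =
        ((s + 2) * (s + 3) / 2 - (s + 2) * y) * t (Suc (Suc j)) + (s + 2) * (L\<^sup>2 - (s + 2)\<^sup>2) / 2 * t (Suc j)"
      by (metis mult_left_cancel)
    then show ?thesis
      unfolding 3 t_def u_def s_def by (simp add: add_ac)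
  qed (simp_all add: \<sigma>_def power2_eq_square field_simps)
qed

section \<open>Orthogonality under summation over a centred column\<close>

definition lsum :: "nat \<Rightarrow> real poly \<Rightarrow> real" where
  "lsum m p = (\<Sum>i<2 * m + 1. poly p (real i - real m))"

lemma lsum_linear:
  "lsum m (p + q) = lsum m p + lsum m q" "lsum m (p - q) = lsum m p - lsum m q"
  "lsum m (Polynomial.smult a p) = a * lsum m p" "lsum m (sum f A) = (\<Sum>x\<in>A. lsum m (f x))"
  by (simp_all only: lsum_def poly_add poly_diff poly_smult sum.distrib sum_subtractf sum_distrib_left
      poly_sum sum.swap[of _ A])

text \<open>By the difference relation, \<open>\<sigma>(y) (t(y) - t(y - 1))\<close> is an antidifference of a multiple of \<open>t\<close>, and
  \<open>\<sigma>\<close> vanishes at both ends of the range of summation.\<close>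

lemma lsum_cheb:
  assumes "k \<ge> 1"
  shows "lsum m (cheb (2 * real m + 1) k) = 0"
proof -
  define L where "L = 2 * real m + 1"
  define t where "t = poly (cheb L k)"
  define \<sigma> where "\<sigma> y = L\<^sup>2 / 4 - (y - 1 / 2)\<^sup>2" for y :: real
  define A where "A y = \<sigma> y * (t y - t (y - 1))" for y
  \<comment> \<open>The structure relation at \<open>- y\<close>, the parity of the polynomials and
    the symmetry \<open>\<sigma> (- y) = \<sigma> (y + 1)\<close> express \<open>A (y + 1)\<close>.
    On subtracting \<open>A y\<close> the polynomial of index \<open>k - 1\<close> cancels, which
    leaves a difference equation with eigenvalue \<open>- k * (k + 1)\<close>.\<close>
  have diff: "A (y + 1) - A y = - (real k * (real k + 1) * t y)" for y
  proof -
    have 1: "A y = (real k * (real k + 1) / 2 - real k * y) * t y +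
        real k * (L\<^sup>2 - (real k)\<^sup>2) / 2 * poly (cheb L (k - 1)) y"
      unfolding A_def \<sigma>_def t_def by (rule poly_cheb_difference)
    have sign: "(-1) ^ (k - 1) = - ((-1::real) ^ k)" using assms by (cases k) auto
    have refl: "poly (cheb L k) (- y - 1) = (-1) ^ k * t (y + 1)"
      using poly_cheb_reflect[of L k "y + 1"] by (simp add: t_def)
    have "\<sigma> (- y) * ((-1) ^ k * t y - (-1) ^ k * t (y + 1)) =
        (real k * (real k + 1) / 2 + real k * y) * ((-1) ^ k * t y) -
        real k * (L\<^sup>2 - (real k)\<^sup>2) / 2 * ((-1) ^ k * poly (cheb L (k - 1)) y)"
      using poly_cheb_difference[of L "- y" k]
      unfolding refl poly_cheb_reflect sign by (simp add: \<sigma>_def t_def)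
    then have "(-1) ^ k * (\<sigma> (- y) * (t y - t (y + 1))) =
        (-1) ^ k * ((real k * (real k + 1) / 2 + real k * y) * t y -
        real k * (L\<^sup>2 - (real k)\<^sup>2) / 2 * poly (cheb L (k - 1)) y)"
      by (simp only: algebra_simps)
    then have "\<sigma> (- y) * (t y - t (y + 1)) = (real k * (real k + 1) / 2 + real k * y) * t y -
        real k * (L\<^sup>2 - (real k)\<^sup>2) / 2 * poly (cheb L (k - 1)) y"
      by (subst (asm) mult_cancel_left) simp
    moreover have "A (y + 1) = - (\<sigma> (- y) * (t y - t (y + 1)))"
    proof -
      have "\<sigma> (- y) = \<sigma> (y + 1)"
        by (simp add: \<sigma>_def power2_eq_square algebra_simps)
      then show ?thesis by (simp add: A_def algebra_simps)
    qed
    ultimately have 2: "A (y + 1) = - ((real k * (real k + 1) / 2 + real k * y) * t y -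
        real k * (L\<^sup>2 - (real k)\<^sup>2) / 2 * poly (cheb L (k - 1)) y)"
      by (simp only:)
    show ?thesis unfolding 1 2 by (simp add: field_simps)
  qed
  have "- (real k * (real k + 1) * lsum m (cheb L k)) =
      (\<Sum>i<2 * m + 1. A (real (Suc i) - real m) - A (real i - real m))"
    unfolding lsum_def sum_distrib_left sum_negf[symmetric]
  proof (intro sum.cong refl)
    fix i
    have "real (Suc i) - real m = real i - real m + 1" by simp
    then show "- (real k * (real k + 1) * poly (cheb L k) (real i - real m)) =
        A (real (Suc i) - real m) - A (real i - real m)"
      using diff[of "real i - real m"] by (simp only: t_def)
  qed
  also have "\<dots> = A (real (2 * m + 1) - real m) - A (real 0 - real m)"
    by (rule sum_lessThan_telescope)
  also have "\<dots> = 0"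
    by (simp add: A_def \<sigma>_def L_def power2_eq_square field_simps)
  finally show ?thesis using assms by (simp add: L_def)
qed

lemma cheb_times_x:
  "Polynomial.smult (2 * (2 * real k + 1)) ([:0, 1:] * cheb L k) =
    Polynomial.smult (real k + 1) (cheb L (Suc k)) + Polynomial.smult (real k * (L\<^sup>2 - (real k)\<^sup>2)) (cheb L (k - 1))"
proof (rule poly_eq_poly_eq_iff[THEN iffD1], rule ext)
  fix y
  show "poly (Polynomial.smult (2 * (2 * real k + 1)) ([:0, 1:] * cheb L k)) y =
    poly (Polynomial.smult (real k + 1) (cheb L (Suc k)) + Polynomial.smult (real k * (L\<^sup>2 - (real k)\<^sup>2)) (cheb L (k - 1))) y"
    using poly_cheb_rec[of k L y] by (simp add: algebra_simps del: cheb.simps)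
qed

text \<open>\<open>cheb_times_x\<close> trades one factor x for a change of the index by 1, and even
  \<open>k - 1\<close> still exceeds the lowered exponent.\<close>

lemma lsum_power_cheb:
  assumes "i < k"
  shows "lsum m ([:0, 1:] ^ i * cheb (2 * real m + 1) k) = 0"
  using assms
proof (induction i arbitrary: k)
  case 0
  then show ?case by (simp add: lsum_cheb)
next
  case (Suc i)
  let ?t = "cheb (2 * real m + 1)"
  have "2 * (2 * real k + 1) * lsum m ([:0, 1:] ^ Suc i * ?t k) =
      lsum m ([:0, 1:] ^ i * Polynomial.smult (2 * (2 * real k + 1)) ([:0, 1:] * ?t k))"
    by (simp add: lsum_linear[symmetric] mult_ac)
  also have "\<dots> = 0"
    unfolding cheb_times_x using Suc by (simp add: algebra_simps lsum_linear)
  finally show ?case by simp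
qed

lemma lsum_mult_cheb:
  assumes "degree p < k"
  shows "lsum m (p * cheb (2 * real m + 1) k) = 0"
proof -
  have "p = (\<Sum>i\<le>degree p. Polynomial.smult (coeff p i) ([:0, 1:] ^ i))"
    by (subst poly_as_sum_of_monoms[symmetric]) (simp add: monom_altdef)
  then have "lsum m (p * cheb (2 * real m + 1) k) =
      lsum m ((\<Sum>i\<le>degree p. Polynomial.smult (coeff p i) ([:0, 1:] ^ i)) * cheb (2 * real m + 1) k)"
    by (rule arg_cong)
  also have "\<dots> = (\<Sum>i\<le>degree p. coeff p i * lsum m ([:0, 1:] ^ i * cheb (2 * real m + 1) k))"
    by (simp add: sum_distrib_right lsum_linear)
  also have "\<dots> = 0"
    using assms by (intro sum.neutral) (auto simp: lsum_power_cheb)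
  finally show ?thesis .
qed

text \<open>The sum of \<open>cheb L k\<close> times x times \<open>cheb L (Suc k)\<close> is
  evaluated twice: x applied to the lower polynomial produces the norm of the upper one, and
  conversely. Orthogonality removes the other terms.\<close>

lemma lsum_cheb_square:
  fixes m :: nat
  defines "L \<equiv> 2 * real m + 1"
  shows "lsum m (cheb L 0 * cheb L 0) = L"
    and "(2 * real k + 3) * lsum m (cheb L (Suc k) * cheb L (Suc k)) =
      (2 * real k + 1) * (L\<^sup>2 - (real k + 1)\<^sup>2) * lsum m (cheb L k * cheb L k)"
proof -
  show "lsum m (cheb L 0 * cheb L 0) = L" by (simp add: lsum_def L_def)
  have orth: "lsum m (cheb L i * cheb L j) = 0" if "i < j" for i j
    using that unfolding L_def by (intro lsum_mult_cheb) simp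
  have "(real k + 1) * lsum m (cheb L (Suc k) * cheb L (Suc k)) =
      lsum m ((Polynomial.smult (real k + 1) (cheb L (Suc k)) + Polynomial.smult (real k * (L\<^sup>2 - (real k)\<^sup>2)) (cheb L (k - 1))) *
        cheb L (Suc k))"
    using orth[of "k - 1" "Suc k"] by (simp add: algebra_simps lsum_linear)
  also have "\<dots> = 2 * (2 * real k + 1) * lsum m (cheb L k * ([:0, 1:] * cheb L (Suc k)))"
    unfolding cheb_times_x[symmetric] by (simp add: lsum_linear[symmetric] mult_ac)
  finally have 1: "(real k + 1) * lsum m (cheb L (Suc k) * cheb L (Suc k)) =
      2 * (2 * real k + 1) * lsum m (cheb L k * ([:0, 1:] * cheb L (Suc k)))" .
  have "2 * (2 * real k + 3) * lsum m (cheb L k * ([:0, 1:] * cheb L (Suc k))) =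
      lsum m (cheb L k * Polynomial.smult (2 * (2 * real (Suc k) + 1)) ([:0, 1:] * cheb L (Suc k)))"
    unfolding mult_smult_right lsum_linear by simp
  also have "\<dots> = (real k + 1) * (L\<^sup>2 - (real k + 1)\<^sup>2) * lsum m (cheb L k * cheb L k)"
    unfolding cheb_times_x using orth[of k "Suc (Suc k)"]
    by (simp add: distrib_left lsum_linear add.commute del: cheb.simps)
  finally have 2: "2 * (2 * real k + 3) * lsum m (cheb L k * ([:0, 1:] * cheb L (Suc k))) =
      (real k + 1) * (L\<^sup>2 - (real k + 1)\<^sup>2) * lsum m (cheb L k * cheb L k)" .
  have "(real k + 1) * ((2 * real k + 3) * lsum m (cheb L (Suc k) * cheb L (Suc k))) =
      (2 * real k + 1) * (2 * (2 * real k + 3) * lsum m (cheb L k * ([:0, 1:] * cheb L (Suc k))))"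
    using arg_cong[OF 1, of "\<lambda>z. (2 * real k + 3) * z"] by (simp only: mult_ac)
  also have "\<dots> = (real k + 1) * ((2 * real k + 1) * (L\<^sup>2 - (real k + 1)\<^sup>2) * lsum m (cheb L k * cheb L k))"
    unfolding 2 by (simp only: mult_ac)
  finally show "(2 * real k + 3) * lsum m (cheb L (Suc k) * cheb L (Suc k)) =
      (2 * real k + 1) * (L\<^sup>2 - (real k + 1)\<^sup>2) * lsum m (cheb L k * cheb L k)"
    by (subst (asm) mult_cancel_left) simp
qed

lemma lsum_cheb_square_pos:
  assumes "k \<le> 2 * m"
  shows "lsum m (cheb (2 * real m + 1) k * cheb (2 * real m + 1) k) > 0"
  using assms
proof (induction k)
  case 0
  then show ?case by (simp add: lsum_cheb_square(1)[simplified])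
next
  case (Suc k)
  let ?L = "2 * real m + 1"
  have "(real k + 1)\<^sup>2 < ?L\<^sup>2"
    using Suc.prems by (intro power_strict_mono) auto
  then have "(2 * real k + 1) * (?L\<^sup>2 - (real k + 1)\<^sup>2) * lsum m (cheb ?L k * cheb ?L k) > 0"
    using Suc by (intro mult_pos_pos) auto
  then have "(2 * real k + 3) * lsum m (cheb ?L (Suc k) * cheb ?L (Suc k)) > 0"
    unfolding lsum_cheb_square(2) .
  then show ?case by (simp add: zero_less_mult_iff)
qed

text \<open>The Christoffel-Darboux kernel of the family with one argument fixed at the centre
  0.\<close>

definition kernel :: "nat \<Rightarrow> nat \<Rightarrow> real poly" where
  "kernel m N = (\<Sum>k<N. Polynomial.smult (poly (cheb (2 * real m + 1) k) 0 /
     lsum m (cheb (2 * real m + 1) k * cheb (2 * real m + 1) k)) (cheb (2 * real m + 1) k))"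

lemma degree_kernel: "N > 0 \<Longrightarrow> degree (kernel m N) < N"
  unfolding kernel_def by (intro degree_sum_less) (auto intro: le_less_trans[OF degree_smult_le])

text \<open>Removing leading terms reduces the claim to members of the family, where it is
  orthogonality. The bound on \<open>N\<close> keeps the norms in \<open>kernel\<close> nonzero; the
  polynomial of index \<open>2 * m + 1\<close> already vanishes at all nodes.\<close>

lemma kernel_reproduces:
  assumes "degree q < N" "N \<le> 2 * m + 1"
  shows "lsum m (kernel m N * q) = poly q 0"
  using assms(1)
proof (induction "degree q" arbitrary: q rule: less_induct)
  case less
  let ?t = "cheb (2 * real m + 1)"
  define d where "d = degree q"
  have d: "d < N" using less.prems by (simp add: d_def)
  have base: "lsum m (kernel m N * ?t d) = poly (?t d) 0"
  proof -
    have "lsum m (?t k * ?t d) = 0" if "k \<noteq> d" for k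
      using that lsum_mult_cheb[of "?t k" d m] lsum_mult_cheb[of "?t d" k m]
      by (cases "k < d") (simp_all add: mult.commute)
    then have "lsum m (kernel m N * ?t d) =
        (\<Sum>k<N. if k = d then poly (?t k) 0 / lsum m (?t k * ?t k) * lsum m (?t k * ?t d) else 0)"
      unfolding kernel_def sum_distrib_right lsum_linear mult_smult_left by (intro sum.cong) auto
    also have "\<dots> = poly (?t d) 0"
      using d assms(2) lsum_cheb_square_pos[of d m] by simp
    finally show ?thesis .
  qed
  define a where "a = lead_coeff q / lead_coeff (?t d)"
  define r where "r = q - Polynomial.smult a (?t d)"
  have q: "q = r + Polynomial.smult a (?t d)" by (simp add: r_def)
  have lead: "lead_coeff (?t d) \<noteq> 0" using cheb_degree_lead[of "2 * real m + 1" d] by simp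
  have "lsum m (kernel m N * r) = poly r 0"
  proof (cases "d = 0")
    case True
    then have "r = 0" using lead unfolding r_def a_def d_def by (auto elim!: degree_eq_zeroE)
    then show ?thesis by (simp add: lsum_def)
  next
    case False
    have "degree r < d"
    proof -
      have "degree r \<le> d" unfolding r_def by (rule degree_diff_le) (auto simp: d_def)
      moreover have "coeff r d = 0" using lead by (simp add: r_def a_def d_def)
      ultimately show ?thesis using False by (metis leading_coeff_0_iff le_neq_implies_less degree_0)
    qed
    then show ?thesis using less d by (simp add: d_def)
  qed
  then show ?case
    unfolding q by (simp add: distrib_left lsum_linear base)
qed

section \<open>The Wilf-Zeilberger summation and the value 1/3\<close>

lemma wz_sum:
  fixes F :: "nat \<Rightarrow> nat \<Rightarrow> real"
  assumes F0: "\<And>n. F n 0 = 1 / (4 * real n - 1)"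
    and FS: "\<And>n j. F n (Suc j) = F n j * ((2 * real j + 1) / (2 * real j + 2))\<^sup>2 *
      ((4 * real j + 5) / (4 * real j + 1)) *
      (((4 * real n - 1)\<^sup>2 - (2 * real j + 1)\<^sup>2) / ((4 * real n - 1)\<^sup>2 - (2 * real j + 2)\<^sup>2))"
    and "n \<ge> 1"
  shows "(\<Sum>j<n. F n j) = 1 / 3"
proof -
  \<comment> \<open>\<open>\<phi>\<close> and \<open>\<rho>\<close> are the quotients
    \<open>F n (j + 1) / F n j\<close> and \<open>F (n + 1) j / F n j\<close>, continued to real
    arguments.\<close>
  define \<phi> where "\<phi> x y = ((2 * y + 1) / (2 * y + 2))\<^sup>2 * ((4 * y + 5) / (4 * y + 1)) *
      ((4 * x - 2 - 2 * y) * (4 * x + 2 * y) / ((4 * x - 3 - 2 * y) * (4 * x + 1 + 2 * y)))" for x y :: real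
  \<comment> \<open>Wilf--Zeilberger certificate of \<open>F\<close>\<close>
  define R where "R x y = - (y\<^sup>2 * (4 * x + 1) * (4 * x - 1 - 2 * y) * (4 * x * (2 * x + 1) + 1 - 2 * y\<^sup>2 + y)) /
      (x * (2 * x + 1) * (4 * y + 1) * (4 * x + 1 + 2 * y) * (2 * x - y) * (2 * x + 1 - y))" for x y :: real
  define \<rho> where "\<rho> x y = (4 * x + 2 * y) * (4 * x + 2 + 2 * y) * (4 * x - 1 - 2 * y) * (4 * x + 1 - 2 * y) /
      ((4 * x + 2 - 2 * y) * (4 * x - 2 * y) * (4 * x + 1 + 2 * y) * (4 * x + 3 + 2 * y))" for x y :: real
  have F_Suc: "F n (Suc j) = F n j * \<phi> (real n) (real j)" for n j
  proof -
    have "(4 * real n - 1)\<^sup>2 - (2 * real j + 1)\<^sup>2 = (4 * real n - 2 - 2 * real j) * (4 * real n + 2 * real j)"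
      "(4 * real n - 1)\<^sup>2 - (2 * real j + 2)\<^sup>2 = (4 * real n - 3 - 2 * real j) * (4 * real n + 1 + 2 * real j)"
      by (simp_all add: power2_eq_square algebra_simps)
    then show ?thesis unfolding FS \<phi>_def by (simp only: mult_ac)
  qed
  \<comment> \<open>Both sides are the quotient of \<open>F (n + 1) (j + 1)\<close> by
    \<open>F n j\<close>, along the two ways around a lattice square.\<close>
  have \<rho>_step: "\<rho> x y * \<phi> (x + 1) y = \<phi> x y * \<rho> x (y + 1)" if "y \<ge> 0" "x \<ge> y + 1" for x y :: real
  proof -
    \<comment> \<open>Linear factors are abstracted to variables so that clearing denominators
      cancels monomials and does not multiply the factors out.\<close>
    define a b c d e f g h i k l where atoms: "a = 4 * x + 2 * y" "b = 4 * x + 2 + 2 * y" "c = 4 * x - 1 - 2 * y"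
      "d = 4 * x + 1 - 2 * y" "e = 4 * x + 2 - 2 * y" "f = 4 * x - 2 * y" "g = 4 * x + 1 + 2 * y"
      "h = 4 * x + 3 + 2 * y" "i = 4 * x + 4 + 2 * y" "k = 4 * x + 5 + 2 * y" "l = 4 * x - 3 - 2 * y"
    define m where "m = 4 * x - 2 - 2 * y"
    define z where "z = ((2 * y + 1) / (2 * y + 2))\<^sup>2 * ((4 * y + 5) / (4 * y + 1))"
    have nz: "d \<noteq> 0" "e \<noteq> 0" "f \<noteq> 0" "g \<noteq> 0" "h \<noteq> 0" "k \<noteq> 0" "l \<noteq> 0" "m \<noteq> 0"
      using that unfolding atoms m_def by auto
    have "\<rho> x y = a * b * c * d / (e * f * g * h)" "\<phi> (x + 1) y = z * (e * i / (d * k))"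
      "\<phi> x y = z * (m * a / (l * g))" "\<rho> x (y + 1) = b * i * l * c / (f * m * h * k)"
      unfolding \<rho>_def \<phi>_def z_def atoms m_def by (simp_all add: algebra_simps)
    note eqs = this
    show ?thesis unfolding eqs using nz by (simp add: field_simps)
  qed
  have ratio: "F (Suc n) j = F n j * \<rho> (real n) (real j)" if "n \<ge> 1" "j \<le> n" for n j
    using that(2)
  proof (induction j)
    case 0
    have "4 * real n - 1 > 0" "real n > 0" using that by auto
    then show ?case by (simp add: F0 \<rho>_def divide_simps)
  next
    case (Suc j)
    then have "F (Suc n) (Suc j) = F n j * (\<rho> (real n) (real j) * \<phi> (real n + 1) (real j))"
      by (simp add: F_Suc add.commute)
    also have "\<dots> = F n (Suc j) * \<rho> (real n) (real (Suc j))"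
      using Suc.prems by (subst \<rho>_step) (simp_all add: F_Suc add.commute)
    finally show ?case .
  qed
  \<comment> \<open>The Wilf-Zeilberger equation \<open>F (n + 1) j - F n j = R n (j + 1) * F n (j +
    1) - R n j * F n j\<close>, divided by \<open>F n j\<close>.\<close>
  have cert: "\<rho> x y - 1 = R x (y + 1) * \<phi> x y - R x y" if "y \<ge> 0" "x \<ge> y + 1" for x y :: real
  proof -
    \<comment> \<open>A common denominator of the three rational functions; the factors of
      \<open>R x (y + 1)\<close> and \<open>\<phi> x y\<close> that are foreign to it cancel in
      their product.\<close>
    define D where "D = x * (2 * x + 1) * (4 * y + 1) * (2 * x + 1 - y) * (2 * x - y) * (4 * x + 1 + 2 * y) * (4 * x + 3 + 2 * y)"
    have pos: "x > 0" "2 * x + 1 > 0" "4 * y + 1 > 0" "2 * x + 1 - y > 0" "2 * x - y > 0"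
      "4 * x + 1 + 2 * y > 0" "4 * x + 3 + 2 * y > 0" "4 * y + 5 > 0" "2 * x - 1 - y > 0" "4 * x - 3 - 2 * y > 0"
      "y + 1 > 0" using that by auto
    have D: "D > 0" unfolding D_def using pos by (intro mult_pos_pos)
    have "\<rho> x y = (2 * x + y) * (2 * x + 1 + y) * (4 * x - 1 - 2 * y) * (4 * x + 1 - 2 * y) * x * (2 * x + 1) * (4 * y + 1) / D"
    proof -
      define a b c d e f where atoms: "a = 2 * x + 1 - y" "b = 2 * x - y" "c = 4 * x + 1 + 2 * y" "d = 4 * x + 3 + 2 * y"
         "e = 2 * x + 1" "f = 4 * y + 1"
      define p q r t where atoms2: "p = 2 * x + y" "q = 2 * x + 1 + y" "r = 4 * x - 1 - 2 * y" "t = 4 * x + 1 - 2 * y"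
      have nz: "a \<noteq> 0" "b \<noteq> 0" "c \<noteq> 0" "d \<noteq> 0" "e \<noteq> 0" "f \<noteq> 0" "x \<noteq> 0" using pos unfolding atoms by auto
      have "\<rho> x y = (2 * p) * (2 * q) * r * t / ((2 * a) * (2 * b) * c * d)"
        unfolding \<rho>_def atoms atoms2 by (simp add: algebra_simps)
      also have "\<dots> = p * q * r * t * x * e * f / (x * e * f * a * b * c * d)"
        using nz by (simp add: field_simps)
      finally show ?thesis unfolding D_def atoms atoms2 .
    qed
    moreover have "R x y = - (y\<^sup>2 * (4 * x + 1) * (4 * x - 1 - 2 * y) * (4 * x * (2 * x + 1) + 1 - 2 * y\<^sup>2 + y)) *
        (4 * x + 3 + 2 * y) / D"
    proof -
      define a b c d e f where atoms: "a = 2 * x + 1 - y" "b = 2 * x - y" "c = 4 * x + 1 + 2 * y" "d = 4 * x + 3 + 2 * y"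
         "e = 2 * x + 1" "f = 4 * y + 1"
      define w where "w = - (y\<^sup>2 * (4 * x + 1) * (4 * x - 1 - 2 * y) * (4 * x * (2 * x + 1) + 1 - 2 * y\<^sup>2 + y))"
      have nz: "a \<noteq> 0" "b \<noteq> 0" "c \<noteq> 0" "d \<noteq> 0" "e \<noteq> 0" "f \<noteq> 0" "x \<noteq> 0" using pos unfolding atoms by auto
      have "R x y = w / (x * e * f * c * b * a)"
        unfolding R_def atoms w_def ..
      also have "\<dots> = w * d / (x * e * f * a * b * c * d)"
        using nz by (simp add: field_simps)
      finally show ?thesis unfolding D_def atoms w_def .
    qed
    moreover have "R x (y + 1) * \<phi> x y = - ((2 * y + 1)\<^sup>2 * (4 * x + 1) * (4 * x * (2 * x + 1) - 2 * y\<^sup>2 - 3 * y) *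
        (2 * x + y) * (2 * x + 1 - y)) / D"
    proof -
      define a b c d e f where atoms: "a = 2 * x + 1 - y" "b = 2 * x - y" "c = 4 * x + 1 + 2 * y" "d = 4 * x + 3 + 2 * y"
         "e = 2 * x + 1" "f = 4 * y + 1"
      define g h i k p where atoms2: "g = 4 * y + 5" "h = 2 * x - 1 - y" "i = 4 * x - 3 - 2 * y" "k = y + 1" "p = 2 * x + y"
      define u v w where "u = 4 * x * (2 * x + 1) - 2 * y\<^sup>2 - 3 * y" "v = 4 * x + 1" "w = 2 * y + 1"
      have nz: "a \<noteq> 0" "b \<noteq> 0" "c \<noteq> 0" "d \<noteq> 0" "e \<noteq> 0" "f \<noteq> 0" "x \<noteq> 0" "g \<noteq> 0" "h \<noteq> 0" "i \<noteq> 0" "k \<noteq> 0"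
        using pos unfolding atoms atoms2 by auto
      have R: "R x (y + 1) = - (k\<^sup>2 * v * i * u) / (x * e * g * d * h * b)"
        unfolding R_def atoms atoms2 u_v_w_def by (simp add: power2_eq_square algebra_simps)
      have \<phi>: "\<phi> x y = (w / (2 * k))\<^sup>2 * (g / f) * ((2 * h) * (2 * p) / (i * c))"
        unfolding \<phi>_def atoms atoms2 u_v_w_def by (simp add: algebra_simps)
      have "R x (y + 1) * \<phi> x y = - (w\<^sup>2 * v * u * p * a) / (x * e * f * a * b * c * d)"
        unfolding R \<phi> using nz by (simp add: field_simps power2_eq_square)
      then show ?thesis unfolding D_def atoms atoms2 u_v_w_def .
    qed
    moreover have "1 = D / D" using D by simp
    ultimately have "\<rho> x y - 1 - (R x (y + 1) * \<phi> x y - R x y) =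
      ((2 * x + y) * (2 * x + 1 + y) * (4 * x - 1 - 2 * y) * (4 * x + 1 - 2 * y) * x * (2 * x + 1) * (4 * y + 1) - D
       - (- ((2 * y + 1)\<^sup>2 * (4 * x + 1) * (4 * x * (2 * x + 1) - 2 * y\<^sup>2 - 3 * y) * (2 * x + y) * (2 * x + 1 - y)) -
         - (y\<^sup>2 * (4 * x + 1) * (4 * x - 1 - 2 * y) * (4 * x * (2 * x + 1) + 1 - 2 * y\<^sup>2 + y)) * (4 * x + 3 + 2 * y))) / D"
      by (simp only: diff_divide_distrib)
    also have "\<dots> = 0"
      unfolding D_def by (simp add: power2_eq_square algebra_simps)
    finally show ?thesis by simp
  qed
  \<comment> \<open>The lower end of the telescoping sum is 0 because of the factor
    \<open>y\<^sup>2\<close> in \<open>R\<close>.\<close>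
  have partial: "(\<Sum>j<k. F (Suc n) j - F n j) = R (real n) (real k) * F n k" if "n \<ge> 1" "k \<le> n" for n k
    using that(2)
  proof (induction k)
    case 0
    then show ?case by (simp add: R_def)
  next
    case (Suc k)
    have "F (Suc n) k - F n k = F n k * (\<rho> (real n) (real k) - 1)"
      using ratio[of n k] that Suc.prems by (simp add: algebra_simps)
    also have "\<dots> = R (real n) (real (Suc k)) * F n (Suc k) - R (real n) (real k) * F n k"
      using Suc.prems by (subst cert) (simp_all add: F_Suc algebra_simps)
    finally show ?case using Suc by simp
  qed
  \<comment> \<open>The sum for \<open>n + 1\<close> has one term more, \<open>F (n + 1) n\<close>,
    which is \<open>\<rho> n n * F n n\<close>; it cancels what telescoping leaves at the upper
    end.\<close>
  have boundary: "\<rho> x x + R x x = 0" if "x > 0" for x :: real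
  proof -
    define a b c where atoms: "a = 3 * x + 1" "b = 2 * x - 1" "c = 6 * x + 1"
    define d e f where atoms2: "d = x + 1" "e = 2 * x + 1" "f = 4 * x + 1"
    have nz: "c \<noteq> 0" "d \<noteq> 0" "e \<noteq> 0" "f \<noteq> 0" "x \<noteq> 0" using that unfolding atoms atoms2 by auto
    have \<rho>: "\<rho> x x = (6 * x) * (2 * a) * b * e / ((2 * d) * (2 * x) * c * (3 * e))"
      unfolding \<rho>_def atoms atoms2 by (simp add: algebra_simps)
    have R: "R x x = - (x\<^sup>2 * f * b * (a * e)) / (x * e * f * c * x * d)"
      unfolding R_def atoms atoms2 by (simp add: power2_eq_square algebra_simps)
    show ?thesis unfolding \<rho> R using nz by (simp add: field_simps power2_eq_square)
  qed
  show ?thesis using \<open>n \<ge> 1\<close>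
  proof (induction n rule: dec_induct)
    case base
    then show ?case by (simp add: F0)
  next
    case (step n)
    have "(\<Sum>j<Suc n. F (Suc n) j) - (\<Sum>j<n. F n j) = (\<rho> (real n) (real n) + R (real n) (real n)) * F n n"
      using partial[of n n] ratio[of n n] step by (simp add: sum_subtractf algebra_simps)
    then show ?case using step boundary[of "real n"] by simp
  qed
qed

lemma poly_cheb_0_odd: "odd k \<Longrightarrow> poly (cheb L k) 0 = 0"
  using poly_cheb_reflect[of L k 0] by simp

text \<open>At the centre only even degrees count, and for either value of \<open>N\<close> those
  below \<open>N\<close> are the \<open>2 * j\<close> with \<open>j < n\<close>.\<close>

lemma poly_kernel_0:
  assumes n: "n \<ge> 1" and N: "N = 2 * n - 1 \<or> N = 2 * n"
  shows "poly (kernel (2 * n - 1) N) 0 = 1 / 3"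
proof -
  define m where "m = 2 * n - 1"
  define L where "L = 4 * real n - 1"
  have L: "2 * real m + 1 = L" using n by (simp add: m_def L_def of_nat_diff)
  define t where "t k = poly (cheb L k) 0" for k
  define h where "h k = lsum m (cheb L k * cheb L k)" for k
  define F where "F n j = 1 / (4 * real n - 1) * (\<Prod>i<j. ((2 * real i + 1) / (2 * real i + 2))\<^sup>2 *
      ((4 * real i + 5) / (4 * real i + 1)) *
      (((4 * real n - 1)\<^sup>2 - (2 * real i + 1)\<^sup>2) / ((4 * real n - 1)\<^sup>2 - (2 * real i + 2)\<^sup>2)))" for n j
  have h_pos: "h k > 0" if "k \<le> 2 * m" for k
    using lsum_cheb_square_pos[OF that] by (simp add: h_def L)
  \<comment> \<open>The quotient of consecutive even terms comes from the recurrence at 0 and from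
    two steps of \<open>lsum_cheb_square\<close>; of the factor \<open>a\<close> squared in the
    numerator, one \<open>a\<close> cancels against the norm.\<close>
  have term_eq: "(t (2 * j))\<^sup>2 / h (2 * j) = F n j" if "j < n" for j
    using that
  proof (induction j)
    case 0
    have "h 0 = L" using lsum_cheb_square(1)[of m] unfolding L h_def .
    then show ?case by (simp add: t_def F_def L_def)
  next
    case (Suc j)
    define s where "s = real j"
    define a b where "a = L\<^sup>2 - (2 * s + 1)\<^sup>2" and "b = L\<^sup>2 - (2 * s + 2)\<^sup>2"
    have "2 * s + 2 < L" using Suc.prems by (simp add: s_def L_def)
    moreover have "s \<ge> 0" by (simp add: s_def)
    ultimately have ab: "a > 0" "b > 0"
      unfolding a_def b_def by (auto intro!: power_strict_mono)
    have t: "(2 * s + 2) * t (2 * Suc j) = - ((2 * s + 1) * a * t (2 * j))"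
      using poly_cheb_rec[of "Suc (2 * j)" L 0] by (simp add: t_def s_def a_def algebra_simps del: cheb.simps)
    have h1: "(4 * s + 3) * h (Suc (2 * j)) = (4 * s + 1) * a * h (2 * j)"
      using lsum_cheb_square(2)[of "2 * j" m] unfolding L h_def[symmetric] by (simp add: s_def a_def algebra_simps)
    have h2: "(4 * s + 5) * h (2 * Suc j) = (4 * s + 3) * b * h (Suc (2 * j))"
      using lsum_cheb_square(2)[of "Suc (2 * j)" m] unfolding L h_def[symmetric] by (simp add: s_def b_def algebra_simps)
    have t': "t (2 * Suc j) = - ((2 * s + 1) * a * t (2 * j)) / (2 * s + 2)"
      using t \<open>s \<ge> 0\<close> by (simp add: field_simps)
    have h': "h (2 * Suc j) = (4 * s + 1) * a * b * h (2 * j) / (4 * s + 5)"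
    proof -
      have "(4 * s + 5) * h (2 * Suc j) = b * ((4 * s + 3) * h (Suc (2 * j)))" using h2 by (simp only: mult_ac)
      then have "(4 * s + 5) * h (2 * Suc j) = (4 * s + 1) * a * b * h (2 * j)" unfolding h1 by (simp only: mult_ac)
      then show ?thesis using \<open>s \<ge> 0\<close> by (simp add: field_simps)
    qed
    have "(t (2 * Suc j))\<^sup>2 / h (2 * Suc j) =
        (t (2 * j))\<^sup>2 / h (2 * j) * (((2 * s + 1) / (2 * s + 2))\<^sup>2 * ((4 * s + 5) / (4 * s + 1)) * (a / b))"
    proof -
      define u v w x where "u = 2 * s + 1" "v = 2 * s + 2" "w = 4 * s + 5" "x = 4 * s + 1"
      have "j \<le> m" using Suc.prems by (auto simp: m_def)
      then have "u \<noteq> 0" "v \<noteq> 0" "w \<noteq> 0" "x \<noteq> 0" "h (2 * j) \<noteq> 0"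
        using \<open>s \<ge> 0\<close> h_pos[of "2 * j"] by (auto simp: u_v_w_x_def)
      then show ?thesis
        unfolding t' h' u_v_w_x_def[symmetric] using ab by (simp add: field_simps power2_eq_square)
    qed
    also have "\<dots> = F n (Suc j)"
      using Suc by (simp add: F_def s_def a_def b_def L_def)
    finally show ?case .
  qed
  have "poly (kernel m N) 0 = (\<Sum>k<N. (t k)\<^sup>2 / h k)"
    unfolding kernel_def L t_def h_def by (simp add: poly_sum power2_eq_square)
  also have "\<dots> = (\<Sum>k\<in>(*) 2 ` {..<n}. (t k)\<^sup>2 / h k)"
  proof (rule sum.mono_neutral_right)
    show "(*) 2 ` {..<n} \<subseteq> {..<N}" using N by auto
    show "\<forall>k\<in>{..<N} - (*) 2 ` {..<n}. (t k)\<^sup>2 / h k = 0"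
    proof
      fix k assume k: "k \<in> {..<N} - (*) 2 ` {..<n}"
      have "odd k"
      proof
        assume "even k"
        then obtain j where "k = 2 * j" by (elim evenE)
        moreover from this have "j < n" using k N by auto
        ultimately show False using k by auto
      qed
      then show "(t k)\<^sup>2 / h k = 0" by (simp add: t_def poly_cheb_0_odd)
    qed
  qed simp
  also have "\<dots> = (\<Sum>j<n. F n j)"
    by (subst sum.reindex) (auto simp: inj_on_def term_eq)
  also have "\<dots> = 1 / 3"
    by (rule wz_sum) (use n in \<open>auto simp: F_def\<close>)
  finally show ?thesis by (simp add: m_def)
qed

text \<open>\<open>- 2 * n\<close> is the middle of the column \<open>{- (4 * n - 1)..-1}\<close>. A
  tiling with no path through it has a hole there. Positivity serves the later division by the
  total.\<close>

lemma sum_path_count_squares_third: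
  assumes n: "n \<ge> 1" and NM: "N = 2 * n - 1 \<and> M = 2 * n \<or> N = 2 * n \<and> M = 2 * n - 1"
  shows "(\<Sum>P\<in>{P \<in> particles N M N. - 2 * int n \<notin> P}. (path_count M N P)\<^sup>2) =
    1 / 3 * (\<Sum>P\<in>particles N M N. (path_count M N P)\<^sup>2)"
    and "(\<Sum>P\<in>particles N M N. (path_count M N P)\<^sup>2) > 0"
proof -
  define m where "m = 2 * n - 1"
  define c where "c = - 2 * int n"
  define X where "X = {- int (M + N)..-1}"
  have NM': "M + N = 2 * m + 1" "N \<le> 2 * m + 1" "N > 0" and c: "c = - int m - 1"
    using NM n by (auto simp: m_def c_def)
  have X: "X = (\<lambda>i. int i - int (2 * m + 1)) ` {..<2 * m + 1}"
  proof (intro Set.set_eqI iffI)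
    fix x assume "x \<in> X"
    then show "x \<in> (\<lambda>i. int i - int (2 * m + 1)) ` {..<2 * m + 1}"
      unfolding X_def NM' by (intro image_eqI[of _ _ "nat (x + int (2 * m + 1))"]) auto
  qed (auto simp: X_def NM')
  have finX: "finite X" and cX: "c \<in> X" and cardX: "card X = M + N"
    using NM'(1) c by (auto simp: X_def)
  have parts: "particles N M N = {P. P \<subseteq> X \<and> card P = M}"
    by (simp add: particles_def slots_left X_def add.commute)
  obtain \<kappa> where \<kappa>: "\<kappa> > 0" "\<And>P. P \<subseteq> X \<Longrightarrow> (path_count M N P)\<^sup>2 = \<kappa> * sqdisc (X - P)"
    using path_count_square_eq_sqdisc[of M N] unfolding X_def by blast
  have holes: "(\<Sum>P | P \<in> particles N M N \<and> R P. (path_count M N P)\<^sup>2) =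
      \<kappa> * (\<Sum>H | H \<subseteq> X \<and> card H = N \<and> R (X - H). sqdisc H)" for R
  proof -
    have "(\<Sum>P | P \<in> particles N M N \<and> R P. (path_count M N P)\<^sup>2) =
        (\<Sum>H | H \<subseteq> X \<and> card H = N \<and> R (X - H). \<kappa> * sqdisc H)"
      by (rule sum.reindex_bij_witness[of _ "\<lambda>H. X - H" "\<lambda>H. X - H"])
        (use finX cardX \<kappa>(2) in \<open>auto simp: parts double_diff card_Diff_subset finite_subset\<close>)
    then show ?thesis by (simp add: sum_distrib_left)
  qed
  \<comment> \<open>\<open>kernel\<close> belongs to nodes centred at 0; the translation moves the
    centre to \<open>c = - m - 1\<close>.\<close>
  define Q where "Q = pcompose (kernel m N) [:real m + 1, 1:]"
  have Q: "poly Q x = poly (kernel m N) (x + real m + 1)" for x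
    by (simp add: Q_def poly_pcompose algebra_simps)
  have "(\<Sum>H | H \<subseteq> X \<and> card H = N \<and> c \<in> H. sqdisc H) =
      poly Q (of_int c) * (\<Sum>H | H \<subseteq> X \<and> card H = N. sqdisc H)"
  proof (rule sum_sqdisc_containing[OF finX cX])
    show "degree Q < N" using degree_kernel[of N m] NM'(3) by (simp add: Q_def degree_pcompose)
    fix q :: "real poly" assume q: "degree q < N"
    define r where "r = pcompose q [:- real m - 1, 1:]"
    have "(\<Sum>x\<in>X. poly Q (of_int x) * poly q (of_int x)) =
        (\<Sum>i<2 * m + 1. poly Q (real i - real (2 * m + 1)) * poly q (real i - real (2 * m + 1)))"
      unfolding X by (subst sum.reindex) (auto simp: inj_on_def)
    also have "\<dots> = lsum m (kernel m N * r)"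
      unfolding lsum_def by (intro sum.cong refl) (simp add: Q r_def poly_pcompose algebra_simps)
    also have "\<dots> = poly r 0"
      using q NM'(2) by (intro kernel_reproduces) (simp_all add: r_def degree_pcompose)
    finally show "(\<Sum>x\<in>X. poly Q (of_int x) * poly q (of_int x)) = poly q (of_int c)"
      by (simp add: r_def poly_pcompose c)
  qed
  moreover have "poly Q (of_int c) = 1 / 3"
    using poly_kernel_0[of n N] n NM by (auto simp: Q c m_def)
  ultimately have third: "(\<Sum>H | H \<subseteq> X \<and> card H = N \<and> c \<in> H. sqdisc H) =
      1 / 3 * (\<Sum>H | H \<subseteq> X \<and> card H = N. sqdisc H)" by simp
  have all: "(\<Sum>P\<in>particles N M N. (path_count M N P)\<^sup>2) = \<kappa> * (\<Sum>H | H \<subseteq> X \<and> card H = N. sqdisc H)"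
    using holes[of "\<lambda>_. True"] by simp
  have "{H. H \<subseteq> X \<and> card H = N \<and> c \<notin> X - H} = {H. H \<subseteq> X \<and> card H = N \<and> c \<in> H}"
    using cX by auto
  then have "(\<Sum>P | P \<in> particles N M N \<and> c \<notin> P. (path_count M N P)\<^sup>2) =
      \<kappa> * (\<Sum>H | H \<subseteq> X \<and> card H = N \<and> c \<in> H. sqdisc H)"
    using holes[of "\<lambda>P. c \<notin> P"] by simp
  then show "(\<Sum>P\<in>{P \<in> particles N M N. - 2 * int n \<notin> P}. (path_count M N P)\<^sup>2) =
    1 / 3 * (\<Sum>P\<in>particles N M N. (path_count M N P)\<^sup>2)"
    using third unfolding all c_def by simp
  obtain H where "H \<subseteq> X" "card H = N"
    using obtain_subset_with_card_n[of N X] cardX by auto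
  then have "(\<Sum>H | H \<subseteq> X \<and> card H = N. sqdisc H) > 0"
    using finX by (intro sum_pos) (auto intro!: sqdisc_pos intro: finite_subset)
  then show "(\<Sum>P\<in>particles N M N. (path_count M N P)\<^sup>2) > 0"
    unfolding all using \<kappa>(1) by simp
qed

section \<open>Matchings of unit triangles\<close>

text \<open>Every vertical edge is the left side of one unit triangle and the right side of another. A rhombus
  joins the triangle to the right of an edge \<open>e\<close> to the triangle to the left of an edge \<open>f\<close> in
  \<open>targets e\<close>; it is crossed by no path iff \<open>f = e\<close>.\<close>

fun targets :: "nat \<times> int \<Rightarrow> (nat \<times> int) set" where
  "targets (b, a) = {(b, a), (Suc b, a), (Suc b, a - 1)}"

definition below :: "nat \<Rightarrow> nat \<Rightarrow> nat \<Rightarrow> (nat \<times> int) set" where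
  "below N M k = {(b, a). b < k \<and> a \<in> slots N M b}"

lemma below_Suc: "below N M (Suc k) = below N M k \<union> {k} \<times> slots N M k"
  by (auto simp: below_def less_Suc_eq)

lemma mem_below_Suc: "(b, a) \<in> below N M (Suc k) \<longleftrightarrow> (b, a) \<in> below N M k \<or> b = k \<and> a \<in> slots N M k"
  by (auto simp: below_Suc)

lemma below_less: "(b, a) \<in> below N M k \<Longrightarrow> b < k"
  by (simp add: below_def)

lemma not_below [simp]: "k \<le> b \<Longrightarrow> (b, a) \<notin> below N M k"
  by (simp add: below_def)

lemma finite_below [simp]: "finite (below N M k)"
  by (induction k) (auto simp: below_Suc, simp add: below_def)

text \<open>The edges of column 0 count as already covered, so that the empty matching is the
  partial matching with particle set \<open>slots N M 0\<close>.\<close>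

definition partial_matchings ::
  "nat \<Rightarrow> nat \<Rightarrow> int set \<Rightarrow> nat \<Rightarrow> int set \<Rightarrow> (nat \<times> int \<Rightarrow> nat \<times> int) set" where
  "partial_matchings N M C k P = {\<phi> \<in> extensional (below N M k).
     inj_on \<phi> (below N M k) \<and> (\<forall>e\<in>below N M k. \<phi> e \<in> targets e) \<and>
     (\<forall>e\<in>below N M k \<inter> {N} \<times> C. \<phi> e = e) \<and>
     (\<forall>e\<in>below N M k. fst (\<phi> e) \<noteq> 0) \<and>
     \<phi> ` below N M k \<union> {0} \<times> slots N M 0 = below N M k \<union> {k} \<times> P}"

lemma finite_partial_matchings [simp]: "finite (partial_matchings N M C k P)"
proof (rule finite_subset)
  show "partial_matchings N M C k P \<subseteq> (\<Pi>\<^sub>E e\<in>below N M k. targets e)"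
    by (auto simp: partial_matchings_def PiE_def)
  have "finite (targets e)" for e by (cases e) auto
  then show "finite (\<Pi>\<^sub>E e\<in>below N M k. targets e)" by (intro finite_PiE) auto
qed

lemma card_partial_matchings_0:
  assumes "P \<in> particles N M 0"
  shows "card (partial_matchings N M C 0 P) = 1"
proof -
  have "P = slots N M 0"
    using assms by (intro card_subset_eq) (auto simp: particles_def slots_left)
  then have "partial_matchings N M C 0 P = {\<lambda>_. undefined}"
    by (auto simp: partial_matchings_def below_def)
  then show ?thesis by simp
qed

lemma not_in_moved_image:
  assumes "S \<subseteq> P" "a \<notin> moved S ` P"
  shows "a - 1 \<notin> S" "a \<notin> P - S"
proof -
  have "moved S (a - 1) = a" if "a - 1 \<in> S" using that by (simp add: moved_def)
  then show "a - 1 \<notin> S" using assms by (metis image_eqI subsetD)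
  have "moved S a = a" if "a \<notin> S" using that by (simp add: moved_def)
  then show "a \<notin> P - S" using assms by (metis DiffE image_eqI)
qed

lemma inj_moved_pred:
  assumes "S \<subseteq> P" "inj_on (moved S) P" "p \<in> P" "p \<notin> S"
  shows "p - 1 \<notin> S"
proof
  assume "p - 1 \<in> S"
  then have "moved S (p - 1) = moved S p" "p - 1 \<in> P"
    using assms by (auto simp: moved_def)
  then show False using inj_onD[OF assms(2), of "p - 1" p] assms(3) by simp
qed

text \<open>The last column is peeled off. Its edges are matched to themselves exactly when no path
  crosses them, so the values there are determined by \<open>P'\<close> and the set \<open>S\<close>
  of particles \<open>p\<close> reached from \<open>p + 1\<close>. The image of \<open>P'\<close>
  under \<open>moved S\<close> consists of the crossed edges, whose left triangles the earlier
  columns must cover.\<close>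

lemma partial_matchings_Suc_bij:
  fixes N M k :: nat and P' C :: "int set"
  defines "V \<equiv> {S \<in> shifts (slots N M k) P'. k = N \<longrightarrow> C \<inter> moved S ` P' = {}}"
  assumes C: "C \<subseteq> slots N M N"
  shows "\<exists>f. bij_betw f (partial_matchings N M C (Suc k) P')
    (SIGMA S:V. partial_matchings N M C k (moved S ` P'))"
proof -
  let ?B = "below N M"
  define downs where "downs \<phi> = {p \<in> P'. p + 1 \<in> slots N M k \<and> \<phi> (k, p + 1) = (Suc k, p)}"
    for \<phi> :: "nat \<times> int \<Rightarrow> nat \<times> int"
  define f where "f \<phi> = (downs \<phi>, restrict \<phi> (?B k))" for \<phi>
  \<comment> \<open>For \<open>S\<close> in \<open>V\<close> the two alternatives leading to column
    \<open>k + 1\<close> exclude each other, because \<open>moved S\<close> is injective on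
    \<open>P'\<close>.\<close>
  define extend where "extend S \<psi> = restrict (\<lambda>(b, a). if b < k then \<psi> (b, a)
      else if a - 1 \<in> S then (Suc k, a - 1) else if a \<in> P' - S then (Suc k, a) else (k, a)) (?B (Suc k))"
    for S :: "int set" and \<psi> :: "nat \<times> int \<Rightarrow> nat \<times> int"
  have fwd: "downs \<phi> \<in> V" "restrict \<phi> (?B k) \<in> partial_matchings N M C k (moved (downs \<phi>) ` P')"
    "extend (downs \<phi>) (restrict \<phi> (?B k)) = \<phi>"
  if \<phi>: "\<phi> \<in> partial_matchings N M C (Suc k) P'" for \<phi>
  proof -
    define S P where "S = downs \<phi>" and "P = moved S ` P'"
    have ext: "\<phi> \<in> extensional (?B (Suc k))" and inj: "inj_on \<phi> (?B (Suc k))"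
      and adj: "\<And>e. e \<in> ?B (Suc k) \<Longrightarrow> \<phi> e \<in> targets e"
      and forced: "\<And>e. e \<in> ?B (Suc k) \<Longrightarrow> e \<in> {N} \<times> C \<Longrightarrow> \<phi> e = e"
      and col0: "\<And>e. e \<in> ?B (Suc k) \<Longrightarrow> fst (\<phi> e) \<noteq> 0"
      and img: "\<phi> ` ?B (Suc k) \<union> {0} \<times> slots N M 0 = ?B (Suc k) \<union> {Suc k} \<times> P'"
      using \<phi> unfolding partial_matchings_def by simp_all
    have moved_slot: "moved S p \<in> slots N M k \<and> \<phi> (k, moved S p) = (Suc k, p)" if p: "p \<in> P'" for p
    proof (cases "p \<in> S")
      case True
      then show ?thesis by (simp add: S_def downs_def moved_def)
    next
      case False
      have "(Suc k, p) \<in> \<phi> ` ?B (Suc k) \<union> {0} \<times> slots N M 0" unfolding img using p by simp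
      then obtain b a where e: "(b, a) \<in> ?B (Suc k)" "\<phi> (b, a) = (Suc k, p)" by auto
      then have b: "b = k" and a: "a = p \<or> a = p + 1"
        using adj[OF e(1)] by (auto simp: mem_below_Suc dest: below_less)
      have slot: "a \<in> slots N M k"
        using e(1) b by (auto simp: mem_below_Suc dest: below_less)
      then have "a \<noteq> p + 1"
        using e b False p by (auto simp: S_def downs_def)
      then show ?thesis
        using e a b slot False by (auto simp: moved_def)
    qed
    have SP: "S \<subseteq> P'" by (auto simp: S_def downs_def)
    have inj_moved: "inj_on (moved S) P'"
    proof (rule inj_onI)
      fix p q assume pq: "p \<in> P'" "q \<in> P'" "moved S p = moved S q"
      then have "(Suc k, p) = \<phi> (k, moved S q)" using moved_slot[of p] by metis
      also have "\<dots> = (Suc k, q)" using moved_slot[of q] pq(2) by blast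
      finally show "p = q" by simp
    qed
    have P: "P \<subseteq> slots N M k" using moved_slot by (auto simp: P_def)
    \<comment> \<open>A target in column \<open>k + 1\<close> is a particle \<open>p\<close>, and by
      injectivity of \<open>\<phi>\<close> its only source is \<open>moved S p\<close>.\<close>
    have stay: "\<phi> (k, a) = (k, a) \<longleftrightarrow> a \<notin> P" if a: "a \<in> slots N M k" for a
    proof
      assume "\<phi> (k, a) = (k, a)"
      then show "a \<notin> P" using moved_slot by (auto simp: P_def)
    next
      assume "a \<notin> P"
      have e: "(k, a) \<in> ?B (Suc k)" using a by (simp add: mem_below_Suc)
      show "\<phi> (k, a) = (k, a)"
      proof (rule ccontr)
        assume "\<phi> (k, a) \<noteq> (k, a)"
        then obtain p where p: "\<phi> (k, a) = (Suc k, p)" using adj[OF e] by auto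
        then have "(Suc k, p) \<in> ?B (Suc k) \<union> {Suc k} \<times> P'" using imageI[OF e, of \<phi>] unfolding img[symmetric] by (simp add: p)
        then have "p \<in> P'" by (auto simp: below_def)
        then have "\<phi> (k, moved S p) = \<phi> (k, a)" "(k, moved S p) \<in> ?B (Suc k)"
          using moved_slot p by (auto simp: mem_below_Suc)
        then have "moved S p = a" using inj_onD[OF inj, of "(k, moved S p)" "(k, a)"] e by simp
        then show False using \<open>a \<notin> P\<close> \<open>p \<in> P'\<close> by (auto simp: P_def)
      qed
    qed
    have "C \<inter> P = {}" if "k = N"
    proof -
      have "c \<notin> P" if "c \<in> C" for c
        using that C \<open>k = N\<close> stay[of c] forced[of "(N, c)"] by (auto simp: mem_below_Suc)
      then show ?thesis by auto
    qed
    then show "downs \<phi> \<in> V"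
      using inj_moved P by (auto simp: V_def shifts_def S_def[symmetric] P_def[symmetric])
         (simp add: S_def downs_def)
    have below_img: "\<phi> e \<in> ?B k \<union> {k} \<times> P" if e: "e \<in> ?B k" for e
    proof -
      obtain b a where ba: "e = (b, a)" by (cases e)
      obtain b' a' where ba': "\<phi> e = (b', a')" by (cases "\<phi> e")
      have eS: "e \<in> ?B (Suc k)" using e by (auto simp: ba mem_below_Suc)
      have "b < k" using e below_less unfolding ba by blast
      moreover have "(b', a') \<in> targets (b, a)" using adj[OF eS] unfolding ba'[unfolded ba] ba .
      ultimately have "b' \<le> k" by auto
      moreover have "(b', a') \<in> ?B (Suc k) \<union> {Suc k} \<times> P'"
        using imageI[OF eS, of \<phi>] unfolding img[symmetric] ba' by (rule UnI1)
      ultimately have mem: "(b', a') \<in> ?B (Suc k)" by auto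
      show ?thesis
      proof (cases "b' = k")
        case True
        have "a' \<in> P"
        proof (rule ccontr)
          assume "a' \<notin> P"
          moreover have "a' \<in> slots N M k" using mem True by (auto simp: mem_below_Suc dest: below_less)
          ultimately have "\<phi> (k, a') = \<phi> e" using stay True ba' by simp
          then have "e = (k, a')" using inj_onD[OF inj, of "(k, a')" e] eS mem True by simp
          then show False using e below_less by blast
        qed
        then show ?thesis using True ba' by simp
      next
        case False
        then show ?thesis using mem ba' by (simp add: mem_below_Suc)
      qed
    qed
    have "\<phi> ` ?B k \<union> {0} \<times> slots N M 0 = ?B k \<union> {k} \<times> P"
    proof (intro equalityI subsetI)
      fix x assume "x \<in> \<phi> ` ?B k \<union> {0} \<times> slots N M 0"
      then show "x \<in> ?B k \<union> {k} \<times> P"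
      proof
        assume "x \<in> \<phi> ` ?B k"
        then show ?thesis using below_img by blast
      next
        assume "x \<in> {0} \<times> slots N M 0"
        then obtain a where x: "x = (0, a)" "a \<in> slots N M 0" by auto
        show ?thesis
        proof (cases "k = 0")
          case True
          \<comment> \<open>An edge of column 0 has no triangle of the hexagon on its left, so
            \<open>col0\<close> forces it to send a path to the right.\<close>
          have "a \<in> P"
          proof (rule ccontr)
            assume "a \<notin> P"
            then have "\<phi> (0, a) = (0, a)" using stay[of a] x True by simp
            then show False using col0[of "(0, a)"] x True by (simp add: mem_below_Suc)
          qed
          then show ?thesis using x True by simp
        next
          case False
          then show ?thesis using x by (simp add: below_def)
        qed
      qed
    next
      fix x assume x: "x \<in> ?B k \<union> {k} \<times> P"
      obtain b a where ba: "x = (b, a)" by (cases x)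
      have "x \<in> ?B (Suc k)" using x P by (auto simp: below_Suc)
      then have "x \<in> \<phi> ` ?B (Suc k) \<union> {0} \<times> slots N M 0" using img by blast
      then show "x \<in> \<phi> ` ?B k \<union> {0} \<times> slots N M 0"
      proof
        assume "x \<in> \<phi> ` ?B (Suc k)"
        then obtain b' a' where e: "(b', a') \<in> ?B (Suc k)" "\<phi> (b', a') = (b, a)" using ba by force
        have e': "(b', a') \<in> ?B k"
        proof (rule ccontr)
          assume "(b', a') \<notin> ?B k"
          then have b': "b' = k" "a' \<in> slots N M k" using e(1) by (simp_all add: mem_below_Suc)
          have "b \<le> k" using x below_less[of b a N M k] unfolding ba by auto
          then have "\<phi> (k, a') = (k, a')" "b = k" "a = a'" using adj[OF e(1)] e b' by auto
          then have "a \<notin> P" using stay b' by blast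
          then show False using x ba \<open>b = k\<close> by (auto dest: below_less)
        qed
        show ?thesis using imageI[OF e', of \<phi>] unfolding e(2) ba by (rule UnI1)
      qed auto
    qed
    moreover have sub: "e \<in> ?B (Suc k)" if "e \<in> ?B k" for e using that by (simp add: below_Suc)
    then have "inj_on \<phi> (?B k)" by (intro inj_on_subset[OF inj] subsetI)
    moreover have "\<forall>e\<in>?B k. \<phi> e \<in> targets e" "\<forall>e\<in>?B k \<inter> {N} \<times> C. \<phi> e = e" "\<forall>e\<in>?B k. fst (\<phi> e) \<noteq> 0"
      using sub adj forced col0 by blast+
    ultimately show "restrict \<phi> (?B k) \<in> partial_matchings N M C k (moved (downs \<phi>) ` P')"
      unfolding partial_matchings_def S_def[symmetric] P_def[symmetric]
      by simp
    show "extend (downs \<phi>) (restrict \<phi> (?B k)) = \<phi>"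
    proof (rule extensionalityI[of _ "?B (Suc k)"])
      fix e assume e: "e \<in> ?B (Suc k)"
      obtain b a where ba: "e = (b, a)" by (cases e)
      show "extend (downs \<phi>) (restrict \<phi> (?B k)) e = \<phi> e"
      proof (cases "b < k")
        case True
        then show ?thesis using e by (auto simp: extend_def ba mem_below_Suc)
      next
        case False
        then have b: "b = k" "a \<in> slots N M k" using e by (auto simp: ba mem_below_Suc dest: below_less)
        show ?thesis
        proof (cases "a \<in> P")
          case True
          then obtain p where p: "p \<in> P'" "a = moved S p" by (auto simp: P_def)
          then have "\<phi> e = (Suc k, p)" using moved_slot b ba by simp
          moreover have "p - 1 \<notin> S" if "p \<notin> S"
            using inj_moved_pred[OF SP inj_moved p(1) that] .
          ultimately show ?thesis
                  using e p(1) b unfolding extend_def S_def[symmetric] ba p(2)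
                  by (cases "p \<in> S") (simp_all add: moved_def)
        next
          case False
          then have "a - 1 \<notin> S" "a \<notin> P' - S"
            using not_in_moved_image[OF SP, of a] unfolding P_def by simp_all
          then show ?thesis
            using e b stay[of a] False unfolding extend_def S_def[symmetric] by (auto simp: ba)
        qed
      qed
    qed (use ext in \<open>simp_all add: extend_def\<close>)
  qed
  have bwd: "extend S \<psi> \<in> partial_matchings N M C (Suc k) P'" "f (extend S \<psi>) = (S, \<psi>)"
    if S: "S \<in> V" and \<psi>: "\<psi> \<in> partial_matchings N M C k (moved S ` P')" for S \<psi>
  proof -
    define P \<phi> where "P = moved S ` P'" and "\<phi> = extend S \<psi>"
    have SP: "S \<subseteq> P'" and inj_moved: "inj_on (moved S) P'" and P: "P \<subseteq> slots N M k"
      and ok: "k = N \<Longrightarrow> C \<inter> P = {}"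
      using S by (auto simp: V_def shifts_def P_def)
    have ext: "\<psi> \<in> extensional (?B k)" and inj: "inj_on \<psi> (?B k)"
      and adj: "\<And>e. e \<in> ?B k \<Longrightarrow> \<psi> e \<in> targets e"
      and forced: "\<And>e. e \<in> ?B k \<Longrightarrow> e \<in> {N} \<times> C \<Longrightarrow> \<psi> e = e"
      and col0: "\<And>e. e \<in> ?B k \<Longrightarrow> fst (\<psi> e) \<noteq> 0"
      and img: "\<psi> ` ?B k \<union> {0} \<times> slots N M 0 = ?B k \<union> {k} \<times> P"
      using \<psi> unfolding partial_matchings_def P_def by simp_all
    have \<phi>_below: "\<phi> e = \<psi> e" if "e \<in> ?B k" for e
      using that by (cases e) (auto simp: \<phi>_def extend_def mem_below_Suc dest: below_less)
    have \<phi>_moved: "\<phi> (k, moved S p) = (Suc k, p)" if p: "p \<in> P'" for p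
    proof -
      have "moved S p \<in> slots N M k" using p P by (auto simp: P_def)
      moreover have "p - 1 \<notin> S" if "p \<notin> S"
        using inj_moved_pred[OF SP inj_moved p that] .
      ultimately show ?thesis using p by (auto simp: \<phi>_def extend_def moved_def mem_below_Suc)
    qed
    have \<phi>_stay: "\<phi> (k, a) = (k, a)" if "a \<in> slots N M k" "a \<notin> P" for a
    proof -
      have "a - 1 \<notin> S" "a \<notin> P' - S"
        using that(2) not_in_moved_image[OF SP, of a] unfolding P_def by simp_all
      then show ?thesis using that(1) by (auto simp: \<phi>_def extend_def mem_below_Suc)
    qed
    have column: "(\<exists>p\<in>P'. a = moved S p \<and> \<phi> (k, a) = (Suc k, p)) \<or> a \<notin> P \<and> \<phi> (k, a) = (k, a)"
      if "a \<in> slots N M k" for a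
      using that \<phi>_moved \<phi>_stay by (cases "a \<in> P") (auto simp: P_def)
    have \<psi>_img: "\<psi> e \<in> ?B k \<union> {k} \<times> P" if "e \<in> ?B k" for e
      using that img by blast
    have col0': "a \<in> P" if "k = 0" "a \<in> slots N M k" for a
    proof -
      have "(0, a) \<in> ?B k \<union> {k} \<times> P" using that unfolding img[symmetric] by simp
      then show ?thesis using that(1) by simp
    qed
    have "inj_on \<phi> (?B (Suc k))"
    proof -
      have Bk: "inj_on \<phi> (?B k)" using inj inj_on_cong[of "?B k" \<phi> \<psi>] \<phi>_below by simp
      have "inj_on \<phi> ({k} \<times> slots N M k)"
      proof (rule inj_onI)
        fix x y assume xy: "x \<in> {k} \<times> slots N M k" "y \<in> {k} \<times> slots N M k" "\<phi> x = \<phi> y"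
        then obtain a b where "x = (k, a)" "y = (k, b)" "a \<in> slots N M k" "b \<in> slots N M k" by auto
        then show "x = y" using column[of a] column[of b] xy(3) by auto
      qed
      note col = this
      have neq: "\<phi> e \<noteq> \<phi> (k, a)" if "e \<in> ?B k" "a \<in> slots N M k" for e a
      proof -
        have "\<phi> (k, a) \<notin> ?B k \<union> {k} \<times> P" using column[OF that(2)] by auto
        moreover have "\<phi> e \<in> ?B k \<union> {k} \<times> P"
          using \<psi>_img[OF that(1)] \<phi>_below[OF that(1)] by simp
        ultimately show ?thesis by (intro notI) simp
      qed
      show ?thesis
      proof (rule inj_onI)
        fix x y assume xy: "x \<in> ?B (Suc k)" "y \<in> ?B (Suc k)" "\<phi> x = \<phi> y"
        then consider "x \<in> ?B k" "y \<in> ?B k" | "x \<in> {k} \<times> slots N M k" "y \<in> {k} \<times> slots N M k"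
          | a where "x \<in> ?B k" "y = (k, a)" "a \<in> slots N M k"
          | a where "y \<in> ?B k" "x = (k, a)" "a \<in> slots N M k"
          unfolding below_Suc by blast
        then show "x = y"
        proof cases
          case 1
          then show ?thesis using inj_onD[OF Bk xy(3)] by simp
        next
          case 2
          then show ?thesis using inj_onD[OF col xy(3)] by simp
        next
          case 3
          then show ?thesis using neq xy(3) by simp
        next
          case 4
          then show ?thesis using neq[OF 4(1,3)] xy(3) by metis
        qed
      qed
    qed
    moreover have "\<phi> e \<in> targets e \<and> fst (\<phi> e) \<noteq> 0" if eB: "e \<in> ?B (Suc k)" for e
    proof (cases "e \<in> ?B k")
      case True
      then show ?thesis using adj[OF True] col0[OF True] \<phi>_below[OF True] by simp
    next
      case False
      then obtain a where a: "e = (k, a)" "a \<in> slots N M k"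
        using eB by (cases e) (auto simp: mem_below_Suc)
      moreover have "k \<noteq> 0 \<or> a \<in> P" using col0' a(2) by blast
      ultimately show ?thesis
        using column[OF a(2)] by (auto simp: moved_def)
    qed
    moreover have "\<phi> e = e" if "e \<in> ?B (Suc k)" "e \<in> {N} \<times> C" for e
    proof -
      from that(2) obtain c where c: "e = (N, c)" "c \<in> C" by auto
      show ?thesis
      proof (cases "e \<in> ?B k")
        case True
        then show ?thesis using forced that \<phi>_below by simp
      next
        case False
        then have "k = N" "c \<in> slots N M k" using that(1) c by (auto simp: mem_below_Suc)
        then show ?thesis using ok c \<phi>_stay by auto
      qed
    qed
    moreover have "\<phi> ` ?B (Suc k) \<union> {0} \<times> slots N M 0 = ?B (Suc k) \<union> {Suc k} \<times> P'"
    proof -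
      have "\<phi> ` ({k} \<times> slots N M k) = {k} \<times> (slots N M k - P) \<union> {Suc k} \<times> P'"
      proof -
        have "{k} \<times> slots N M k = (\<lambda>p. (k, moved S p)) ` P' \<union> {k} \<times> (slots N M k - P)"
          using P by (auto simp: P_def)
        moreover have "\<phi> ` (\<lambda>p. (k, moved S p)) ` P' = (\<lambda>p. (Suc k, p)) ` P'"
          unfolding image_image by (rule image_cong) (simp_all add: \<phi>_moved)
        moreover have "(\<lambda>p. (Suc k, p)) ` P' = {Suc k} \<times> P'" by auto
        moreover have "\<phi> ` ({k} \<times> (slots N M k - P)) = (\<lambda>x. x) ` ({k} \<times> (slots N M k - P))"
          by (rule image_cong) (auto simp: \<phi>_stay)
        ultimately show ?thesis by (simp only: image_Un Un_commute image_ident)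
      qed
      moreover have "\<phi> ` ?B k = \<psi> ` ?B k" using \<phi>_below by (rule image_cong[OF refl])
      ultimately have "\<phi> ` ?B (Suc k) \<union> {0} \<times> slots N M 0 =
          (\<psi> ` ?B k \<union> {0} \<times> slots N M 0) \<union> {k} \<times> (slots N M k - P) \<union> {Suc k} \<times> P'"
        by (simp only: below_Suc image_Un Un_ac)
      also have "\<dots> = ?B (Suc k) \<union> {Suc k} \<times> P'"
      proof -
        have "{k} \<times> slots N M k = {k} \<times> P \<union> {k} \<times> (slots N M k - P)" using P by auto
        then show ?thesis unfolding img below_Suc by (simp only: Un_ac)
      qed
      finally show ?thesis .
    qed
    ultimately show "extend S \<psi> \<in> partial_matchings N M C (Suc k) P'"
      unfolding partial_matchings_def \<phi>_def[symmetric]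
      by simp (simp add: \<phi>_def extend_def)
    have "p \<in> S" if "p \<in> P'" "p + 1 \<in> slots N M k" "\<phi> (k, p + 1) = (Suc k, p)" for p
    proof (rule ccontr)
      assume "p \<notin> S"
      then have m: "moved S p = p" by (simp add: moved_def)
      then have "p \<in> slots N M k" using that(1) P by (force simp: P_def)
      then show False
        using inj_onD[OF \<open>inj_on \<phi> (?B (Suc k))\<close>, of "(k, p)" "(k, p + 1)"] \<phi>_moved[OF that(1)] that m
        by (simp add: mem_below_Suc)
    qed
    moreover have "p \<in> P' \<and> p + 1 \<in> slots N M k \<and> \<phi> (k, p + 1) = (Suc k, p)" if "p \<in> S" for p
    proof -
      have "moved S p = p + 1" "p \<in> P'" using that SP by (auto simp: moved_def)
      then show ?thesis using \<phi>_moved[of p] P unfolding P_def by (metis image_eqI subsetD)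
    qed
    ultimately have "downs \<phi> = S" by (auto simp: downs_def)
    moreover have "restrict \<phi> (?B k) = \<psi>"
      by (rule extensionalityI[of _ "?B k"]) (simp_all add: ext \<phi>_below)
    ultimately show "f (extend S \<psi>) = (S, \<psi>)" by (simp add: f_def \<phi>_def)
  qed
  have "bij_betw f (partial_matchings N M C (Suc k) P') (SIGMA S:V. partial_matchings N M C k (moved S ` P'))"
    by (rule bij_betw_byWitness[where f' = "\<lambda>(S, \<psi>). extend S \<psi>"])
      (use fwd bwd in \<open>auto simp: f_def\<close>)
  then show ?thesis by blast
qed

lemma card_partial_matchings_Suc:
  assumes "C \<subseteq> slots N M N" "P' \<in> particles N M (Suc k)"
  shows "card (partial_matchings N M C (Suc k) P') =
    (\<Sum>S\<in>{S \<in> shifts (slots N M k) P'. k = N \<longrightarrow> C \<inter> moved S ` P' = {}}.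
      card (partial_matchings N M C k (moved S ` P')))"
proof -
  obtain f where "bij_betw f (partial_matchings N M C (Suc k) P')
      (SIGMA S:{S \<in> shifts (slots N M k) P'. k = N \<longrightarrow> C \<inter> moved S ` P' = {}}.
        partial_matchings N M C k (moved S ` P'))"
    using partial_matchings_Suc_bij[OF assms(1)] by blast
  from bij_betw_same_card[OF this] show ?thesis
    using finite_particle[OF assms(2)] by (simp add: card_SigmaI)
qed

text \<open>The edges whose left triangle lies in the hexagon; \<open>below N M (2 * N)\<close>
  contains those whose right triangle does.\<close>

definition ends :: "nat \<Rightarrow> nat \<Rightarrow> (nat \<times> int) set" where
  "ends N M = {(b, a). 0 < b \<and> b \<le> 2 * N \<and> a \<in> slots N M b}"

definition matchings :: "nat \<Rightarrow> nat \<Rightarrow> (nat \<times> int \<Rightarrow> nat \<times> int) set" where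
  "matchings N M = {\<phi> \<in> extensional (below N M (2 * N)).
     bij_betw \<phi> (below N M (2 * N)) (ends N M) \<and> (\<forall>e\<in>below N M (2 * N). \<phi> e \<in> targets e)}"

text \<open>\<open>C = {}\<close> will count all tilings, and a singleton those that contain the
  corresponding rhombus of the middle column. A matching is complete when the paths occupy the whole
  last column.\<close>

lemma card_matchings:
  assumes "N \<ge> 1" and C: "C \<subseteq> slots N M N"
  shows "real (card {\<phi> \<in> matchings N M. \<forall>c\<in>C. \<phi> (N, c) = (N, c)}) =
    (\<Sum>P\<in>{P \<in> particles N M N. C \<inter> P = {}}. (path_count M N P)\<^sup>2)"
proof -
  have "below N M (2 * N) \<union> {2 * N} \<times> slots N M (2 * N) = {(b, a). b \<le> 2 * N \<and> a \<in> slots N M b}"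
    by (auto simp: below_def intro!: le_neq_implies_less)
  also have "\<dots> = ends N M \<union> {0} \<times> slots N M 0"
    by (auto simp: ends_def intro!: gr0I)
  finally have all: "below N M (2 * N) \<union> {2 * N} \<times> slots N M (2 * N) = ends N M \<union> {0} \<times> slots N M 0" .
  have img: "(\<forall>e\<in>B. fst (\<phi> e) \<noteq> 0) \<and>
      \<phi> ` B \<union> {0} \<times> slots N M 0 = ends N M \<union> {0} \<times> slots N M 0 \<longleftrightarrow> \<phi> ` B = ends N M"
    for B and \<phi> :: "nat \<times> int \<Rightarrow> nat \<times> int"
  proof -
    have "fst x = 0" if "x \<in> {0} \<times> slots N M 0" for x using that by auto
    moreover have "fst x \<noteq> 0" if "x \<in> ends N M" for x using that by (auto simp: ends_def)
    ultimately show ?thesis by blast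
  qed
  have "below N M (2 * N) \<inter> {N} \<times> C = {N} \<times> C"
  using assms by (auto simp: below_def)
  then have "{\<phi> \<in> matchings N M. \<forall>c\<in>C. \<phi> (N, c) = (N, c)} = partial_matchings N M C (2 * N) (slots N M (2 * N))"
    unfolding matchings_def partial_matchings_def bij_betw_def all img by auto
  then show ?thesis
    using count_eq_sum_path_count_squares[of N M "\<lambda>k P. real (card (partial_matchings N M C k P))" "\<lambda>P. C \<inter> P = {}"]
      assms by (simp add: card_partial_matchings_0 card_partial_matchings_Suc)
qed

section \<open>Geometry of the triangulation\<close>

text \<open>Affine coordinates in which the lattice points are the integral points and the hexagon is cut out
  by bounds on \<open>b\<close>, \<open>a\<close> and \<open>a + b\<close>.\<close>

definition pt :: "nat \<Rightarrow> real \<Rightarrow> real \<Rightarrow> real \<times> real" where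
  "pt M b a = (sqrt 3 / 2 * b, real M / 2 + a + b / 2)"

definition cb :: "real \<times> real \<Rightarrow> real" where
  "cb p = 2 / sqrt 3 * fst p"

definition ca :: "nat \<Rightarrow> real \<times> real \<Rightarrow> real" where
  "ca M p = snd p - real M / 2 - fst p / sqrt 3"

lemma cb_pt [simp]: "cb (pt M b a) = b" and ca_pt [simp]: "ca M (pt M b a) = a"
  by (simp_all add: cb_def ca_def pt_def)

lemma pt_coords [simp]: "pt M (cb p) (ca M p) = p"
  by (cases p) (simp add: cb_def ca_def pt_def)

lemma pt_eq_iff [simp]: "pt M b a = pt M b' a' \<longleftrightarrow> b = b' \<and> a = a'"
  by (metis cb_pt ca_pt)

lemma pt_affine2:
  assumes "u + v = 1"
  shows "u *\<^sub>R pt M b a + v *\<^sub>R pt M b' a' = pt M (u * b + v * b') (u * a + v * a')"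
proof -
  have "u * (real M / 2) + v * (real M / 2) = real M / 2"
    using assms by (metis distrib_right mult_1)
  then show ?thesis by (simp add: pt_def algebra_simps add_divide_distrib)
qed

lemma pt_affine3:
  assumes "u + v + w = 1"
  shows "u *\<^sub>R pt M b a + v *\<^sub>R pt M b' a' + w *\<^sub>R pt M b'' a'' =
    pt M (u * b + v * b' + w * b'') (u * a + v * a' + w * a'')"
proof -
  have "u * (real M / 2) + v * (real M / 2) + w * (real M / 2) = real M / 2"
    using assms by (metis distrib_right mult_1)
  then show ?thesis by (simp add: pt_def algebra_simps add_divide_distrib)
qed

lemma coords_affine:
  assumes "u + v = 1"
  shows "cb (u *\<^sub>R p + v *\<^sub>R q) = u * cb p + v * cb q"
    and "ca M (u *\<^sub>R p + v *\<^sub>R q) = u * ca M p + v * ca M q"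
  using pt_affine2[OF assms, of M "cb p" "ca M p" "cb q" "ca M q"] by (metis cb_pt ca_pt pt_coords)+

text \<open>The hexagon and the unit triangles all have sides in the three lattice directions, so
  each is an intersection of three strips and one notion serves for both.\<close>

definition hexbox :: "nat \<Rightarrow> real \<Rightarrow> real \<Rightarrow> real \<Rightarrow> real \<Rightarrow> real \<Rightarrow> real \<Rightarrow> (real \<times> real) set" where
  "hexbox M b b' a a' s s' = {p. b \<le> cb p \<and> cb p \<le> b' \<and> a \<le> ca M p \<and> ca M p \<le> a' \<and>
     s \<le> cb p + ca M p \<and> cb p + ca M p \<le> s'}"

lemma pt_in_hexbox [simp]:
  "pt M x y \<in> hexbox M b b' a a' s s' \<longleftrightarrow>
    b \<le> x \<and> x \<le> b' \<and> a \<le> y \<and> y \<le> a' \<and> s \<le> x + y \<and> x + y \<le> s'"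
  by (simp add: hexbox_def)

lemma convex_hexbox: "convex (hexbox M b b' a a' s s')"
proof -
  have ge: "l \<le> u * x + v * y" if "l \<le> x" "l \<le> y" "0 \<le> u" "0 \<le> v" "u + v = 1" for l u v x y :: real
    using convex_bound_le[of "- x" "- l" "- y" u v] that by simp
  show ?thesis
  proof (rule convexI)
    fix p q u v
    assume p: "p \<in> hexbox M b b' a a' s s'" and q: "q \<in> hexbox M b b' a a' s s'"
      and uv: "0 \<le> u" "0 \<le> v" "u + v = (1::real)"
    have sum: "u * cb p + v * cb q + (u * ca M p + v * ca M q) =
        u * (cb p + ca M p) + v * (cb q + ca M q)" by (simp add: algebra_simps)
    show "u *\<^sub>R p + v *\<^sub>R q \<in> hexbox M b b' a a' s s'"
      using p q unfolding hexbox_def mem_Collect_eq coords_affine[OF uv(3)] sum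
      by (intro conjI ge convex_bound_le uv) auto
  qed
qed

lemma convex_pt_segment:
  assumes "convex S" "pt M b a \<in> S" "pt M b' a' \<in> S" "0 \<le> t" "t \<le> 1"
  shows "pt M (b + t * (b' - b)) (a + t * (a' - a)) \<in> S"
proof -
  have "(1 - t) *\<^sub>R pt M b a + t *\<^sub>R pt M b' a' \<in> S"
    using assms by (intro convexD) auto
  moreover have "(1 - t) *\<^sub>R pt M b a + t *\<^sub>R pt M b' a' = pt M (b + t * (b' - b)) (a + t * (a' - a))"
    by (subst pt_affine2) (simp_all add: algebra_simps)
  ultimately show ?thesis by simp
qed

text \<open>For the inclusion of the box in the hull, a point is placed on a vertical segment whose
  ends lie on two sides of the hexagon, hence between vertices. These sides change at
  \<open>x = N\<close>.\<close>

lemma hexagon_eq_hexbox: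
  assumes "N \<ge> 1"
  shows "hexagon N M = hexbox M 0 (2 * real N) (- (real M + real N)) 0 (- real M) (real N)"
proof -
  let ?V = "{pt M 0 0, pt M 0 (- real M), pt M (real N) 0, pt M (real N) (- (real M + real N)),
      pt M (2 * real N) (- real N), pt M (2 * real N) (- (real M + real N))}"
  have "hexagon N M = convex hull ?V"
    unfolding hexagon_def by (rule arg_cong[where f = "(hull) convex"]) (simp add: pt_def field_simps)
  also have "\<dots> = hexbox M 0 (2 * real N) (- (real M + real N)) 0 (- real M) (real N)" (is "_ = ?H")
  proof (intro equalityI subsetI)
    fix p assume "p \<in> convex hull ?V"
    moreover have "convex hull ?V \<subseteq> ?H" by (rule hull_minimal) (auto simp: convex_hexbox)
    ultimately show "p \<in> ?H" by blast
  next
    fix p assume p: "p \<in> ?H"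
    define x y where "x = cb p" and "y = ca M p"
    have pxy: "p = pt M x y" by (simp add: x_def y_def)
    have ineq: "0 \<le> x" "x \<le> 2 * real N" "- (real M + real N) \<le> y" "y \<le> 0" "- real M \<le> x + y" "x + y \<le> real N"
      using p by (simp_all add: pxy)
    have cvx: "convex (convex hull ?V)" by (rule convex_convex_hull)
    have V: "v \<in> convex hull ?V" if "v \<in> ?V" for v using that by (rule hull_inc)
    have N: "real N > 0" using assms by simp
    have column: "pt M x y \<in> convex hull ?V"
      if "pt M x l \<in> convex hull ?V" "pt M x h \<in> convex hull ?V" "l \<le> y" "y \<le> h" for l h
    proof (cases "l = h")
      case True
      then show ?thesis using that by simp
    next
      case False
      then have "l < h" using that by simp
      then show ?thesis
        using convex_pt_segment[OF cvx that(1,2), of "(y - l) / (h - l)"] that(3,4) by simp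
    qed
    show "p \<in> convex hull ?V"
    proof (cases "x \<le> real N")
      case True
      have t: "0 \<le> x / real N" "x / real N \<le> 1" using True ineq N by simp_all
      have "pt M x 0 \<in> convex hull ?V"
        using convex_pt_segment[OF cvx _ _ t, of M 0 0 "real N" 0] N V by simp
      moreover have "pt M x (- real M - x) \<in> convex hull ?V"
        using convex_pt_segment[OF cvx _ _ t, of M 0 "- real M" "real N" "- (real M + real N)"] N V by simp
      ultimately show ?thesis unfolding pxy using ineq by (intro column[of "- real M - x" 0]) auto
    next
      case False
      have t: "0 \<le> (x - real N) / real N" "(x - real N) / real N \<le> 1" using False ineq N by simp_all
      have "pt M x (real N - x) \<in> convex hull ?V"
        using convex_pt_segment[OF cvx _ _ t, of M "real N" 0 "2 * real N" "- real N"] N V by simp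
      moreover have "pt M x (- (real M + real N)) \<in> convex hull ?V"
        using convex_pt_segment[OF cvx _ _ t, of M "real N" "- (real M + real N)" "2 * real N" "- (real M + real N)"] N V
        by simp
      ultimately show ?thesis unfolding pxy using ineq by (intro column[of "- (real M + real N)" "real N - x"]) auto
    qed
  qed
  finally show ?thesis .
qed

text \<open>The unit triangle in the cell \<open>[b, b + 1] \<times> [a, a + 1]\<close> of the affine coordinates; it lies below
  or above the diagonal of the cell according to \<open>s = a + b\<close> or \<open>s = a + b + 1\<close>.\<close>

fun tri :: "nat \<Rightarrow> int \<times> int \<times> int \<Rightarrow> (real \<times> real) set" where
  "tri M (b, a, s) = hexbox M b (b + 1) a (a + 1) s (s + 1)"

text \<open>For any other \<open>s\<close> the three strips meet in at most one point.\<close>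

definition cells :: "(int \<times> int \<times> int) set" where
  "cells = {(b, a, s). s = a + b \<or> s = a + b + 1}"

lemma convex_hull_tri_lower:
  "convex hull {pt M (of_int b) (of_int a), pt M (of_int b) (of_int a + 1), pt M (of_int b + 1) (of_int a)} =
    tri M (b, a, a + b)" (is "convex hull ?V = _")
proof (intro equalityI subsetI)
  fix p assume "p \<in> convex hull ?V"
  moreover have "convex hull ?V \<subseteq> tri M (b, a, a + b)"
    by (rule hull_minimal) (auto simp: convex_hexbox)
  ultimately show "p \<in> tri M (b, a, a + b)" by blast
next
  fix p assume p: "p \<in> tri M (b, a, a + b)"
  define x y where "x = cb p" and "y = ca M p"
  have pxy: "p = pt M x y" by (simp add: x_def y_def)
  define v w where "v = y - of_int a" and "w = x - of_int b"
  have "p = (1 - v - w) *\<^sub>R pt M (of_int b) (of_int a) + v *\<^sub>R pt M (of_int b) (of_int a + 1) +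
      w *\<^sub>R pt M (of_int b + 1) (of_int a)"
    by (subst pt_affine3) (simp_all add: pxy v_def w_def algebra_simps)
  moreover have "0 \<le> v" "0 \<le> w" "0 \<le> 1 - v - w"
    using p by (simp_all add: pxy v_def w_def)
  moreover have "1 - v - w + v + w = 1" by simp
  ultimately show "p \<in> convex hull ?V" unfolding convex_hull_3 by blast
qed

lemma convex_hull_tri_upper:
  "convex hull {pt M (of_int b + 1) (of_int a + 1), pt M (of_int b) (of_int a + 1), pt M (of_int b + 1) (of_int a)} =
    tri M (b, a, a + b + 1)" (is "convex hull ?V = _")
proof (intro equalityI subsetI)
  fix p assume "p \<in> convex hull ?V"
  moreover have "convex hull ?V \<subseteq> tri M (b, a, a + b + 1)"
    by (rule hull_minimal) (auto simp: convex_hexbox)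
  ultimately show "p \<in> tri M (b, a, a + b + 1)" by blast
next
  fix p assume p: "p \<in> tri M (b, a, a + b + 1)"
  define x y where "x = cb p" and "y = ca M p"
  have pxy: "p = pt M x y" by (simp add: x_def y_def)
  define v w where "v = of_int b + 1 - x" and "w = of_int a + 1 - y"
  have "p = (1 - v - w) *\<^sub>R pt M (of_int b + 1) (of_int a + 1) + v *\<^sub>R pt M (of_int b) (of_int a + 1) +
      w *\<^sub>R pt M (of_int b + 1) (of_int a)"
    by (subst pt_affine3) (simp_all add: pxy v_def w_def algebra_simps)
  moreover have "0 \<le> v" "0 \<le> w" "0 \<le> 1 - v - w"
    using p by (simp_all add: pxy v_def w_def)
  moreover have "1 - v - w + v + w = 1" by simp
  ultimately show "p \<in> convex hull ?V" unfolding convex_hull_3 by blast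
qed

lemma tri_subset_hexagon:
  assumes "N \<ge> 1" "(b, a, s) \<in> cells"
  shows "tri M (b, a, s) \<subseteq> hexagon N M \<longleftrightarrow>
    0 \<le> b \<and> b < 2 * int N \<and> - int (M + N) \<le> a \<and> a \<le> -1 \<and> - int M \<le> s \<and> s \<le> int N - 1"
    (is "_ \<longleftrightarrow> ?R")
proof
  assume "tri M (b, a, s) \<subseteq> hexagon N M"
  then have sub: "pt M x y \<in> hexagon N M" if "pt M x y \<in> tri M (b, a, s)" for x y
    using that by blast
  show ?R
  proof (cases "s = a + b")
    case True
    then have "pt M (of_int b) (of_int a) \<in> hexagon N M" "pt M (of_int b + 1) (of_int a) \<in> hexagon N M"
      "pt M (of_int b) (of_int a + 1) \<in> hexagon N M"
      by (auto intro!: sub)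
    then show ?thesis
      unfolding hexagon_eq_hexbox[OF assms(1)] pt_in_hexbox using True by linarith
  next
    case False
    then have s: "s = a + b + 1" using assms by (simp add: cells_def)
    then have "pt M (of_int b + 1) (of_int a + 1) \<in> hexagon N M" "pt M (of_int b + 1) (of_int a) \<in> hexagon N M"
      "pt M (of_int b) (of_int a + 1) \<in> hexagon N M"
      by (auto intro!: sub)
    then show ?thesis
      unfolding hexagon_eq_hexbox[OF assms(1)] pt_in_hexbox using s by linarith
  qed
next
  assume R: ?R
  have "real_of_int b + 1 \<le> 2 * real N" "- (real M + real N) \<le> real_of_int a" "real_of_int a + 1 \<le> 0"
    "- real M \<le> real_of_int s" "real_of_int s + 1 \<le> real N" "0 \<le> real_of_int b"
    using R by linarith+
  then show "tri M (b, a, s) \<subseteq> hexagon N M"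
    unfolding hexagon_eq_hexbox[OF assms(1)] by (auto simp: hexbox_def)
qed

text \<open>A point interior to its own triangle and outside every other one. It reduces covering
  and overlap of regions to the membership of one point per cell.\<close>

fun centroid :: "nat \<Rightarrow> int \<times> int \<times> int \<Rightarrow> real \<times> real" where
  "centroid M (b, a, s) = (if s = a + b then pt M (of_int b + 1 / 3) (of_int a + 1 / 3)
     else pt M (of_int b + 2 / 3) (of_int a + 2 / 3))"

lemma int_in_unit_interval:
  assumes "real_of_int k \<le> x" "x \<le> of_int k + 1" "of_int l < x" "x < of_int l + 1"
  shows "k = l"
  using assms by linarith

lemma centroid_in_tri_iff:
  assumes "t \<in> cells" "t' \<in> cells"
  shows "centroid M t \<in> tri M t' \<longleftrightarrow> t = t'"
proof -
  obtain b a s b' a' s' where t: "t = (b, a, s)" "t' = (b', a', s')" by (cases t, cases t')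
  have "t = t'" if "centroid M t \<in> tri M t'"
  proof (cases "s = a + b")
    case True
    have "b' = b" by (rule int_in_unit_interval[of _ "of_int b + 1 / 3"]) (use that True t in auto)
    moreover have "a' = a" by (rule int_in_unit_interval[of _ "of_int a + 1 / 3"]) (use that True t in auto)
    moreover have "s' = s"
      by (rule int_in_unit_interval[of _ "of_int b + 1 / 3 + (of_int a + 1 / 3)"]) (use that True t in auto)
    ultimately show ?thesis using t by simp
  next
    case False
    then have s: "s = a + b + 1" using assms t by (simp add: cells_def)
    have "b' = b" by (rule int_in_unit_interval[of _ "of_int b + 2 / 3"]) (use that False t in auto)
    moreover have "a' = a" by (rule int_in_unit_interval[of _ "of_int a + 2 / 3"]) (use that False t in auto)
    moreover have "s' = s"
      by (rule int_in_unit_interval[of _ "of_int b + 2 / 3 + (of_int a + 2 / 3)"]) (use that False s t in auto)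
    ultimately show ?thesis using t by simp
  qed
  moreover have "centroid M t \<in> tri M t" using assms by (auto simp: t cells_def)
  ultimately show ?thesis by blast
qed

lemma cb_eq_inner: "cb p = (2 / sqrt 3, 0) \<bullet> p"
  and ca_eq_inner: "ca M p = (- 1 / sqrt 3, 1) \<bullet> p - real M / 2"
  by (cases p; simp add: cb_def ca_def inner_prod_def)+

lemma open_hexbox_interior:
  "{p. b < cb p \<and> cb p < b' \<and> a < ca M p \<and> ca M p < a' \<and> s < cb p + ca M p \<and> cb p + ca M p < s'}
    \<subseteq> interior (hexbox M b b' a a' s s')"
  unfolding hexbox_def cb_eq_inner ca_eq_inner
  by (rule interior_maximal) (auto intro!: open_Collect_conj open_Collect_less continuous_intros)

lemma centroid_in_interior:
  assumes "t \<in> cells"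
  shows "centroid M t \<in> interior (tri M t)"
proof -
  obtain b a s where t: "t = (b, a, s)" by (cases t)
  show ?thesis
    using assms by (auto simp: t cells_def intro!: subsetD[OF open_hexbox_interior])
qed

lemma interior_line_empty:
  "interior {p. cb p = k} = {}" "interior {p. ca M p = k} = {}" "interior {p. cb p + ca M p = k} = {}"
proof -
  show "interior {p. cb p = k} = {}"
    unfolding cb_eq_inner by (rule interior_hyperplane) (simp add: zero_prod_def)
  have "{p. ca M p = k} = {p. (- 1 / sqrt 3, 1) \<bullet> p = k + real M / 2}"
    unfolding ca_eq_inner by auto
  then show "interior {p. ca M p = k} = {}"
    by (simp only:) (rule interior_hyperplane, simp add: zero_prod_def)
  have "cb p + ca M p = ((2 / sqrt 3, 0) + (- 1 / sqrt 3, 1)) \<bullet> p - real M / 2" for p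
    unfolding cb_eq_inner ca_eq_inner by (simp only: inner_add_left)
  then have "{p. cb p + ca M p = k} = {p. ((2 / sqrt 3, 0) + (- 1 / sqrt 3, 1)) \<bullet> p = k + real M / 2}"
    by auto
  then show "interior {p. cb p + ca M p = k} = {}"
    by (simp only:) (rule interior_hyperplane, simp add: zero_prod_def)
qed

lemma closed_tri: "closed (tri M t)"
proof -
  obtain b a s where t: "t = (b, a, s)" by (cases t)
  show ?thesis
    unfolding t tri.simps hexbox_def cb_eq_inner ca_eq_inner
    by (intro closed_Collect_conj closed_Collect_le continuous_intros)
qed

text \<open>Distinct triples differ in one of the three directions, in which two unit strips with
  integral bounds share at most a line.\<close>

lemma interior_tri_inter_empty:
  assumes "t \<noteq> t'"
  shows "interior (tri M t \<inter> tri M t') = {}"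
proof -
  obtain b a s b' a' s' where t: "t = (b, a, s)" "t' = (b', a', s')" by (cases t, cases t')
  have line: "\<exists>k. \<forall>x. real_of_int i \<le> x \<and> x \<le> of_int i + 1 \<and> real_of_int j \<le> x \<and> x \<le> of_int j + 1 \<longrightarrow> x = k"
    if "i \<noteq> j" for i j
  proof (cases "i < j")
    case True
    then have "real_of_int i + 1 \<le> of_int j" by linarith
    then show ?thesis by (intro exI[of _ "real_of_int j"]) auto
  next
    case False
    then have "real_of_int j + 1 \<le> of_int i" using that by linarith
    then show ?thesis by (intro exI[of _ "real_of_int i"]) auto
  qed
  consider "b \<noteq> b'" | "a \<noteq> a'" | "s \<noteq> s'" using assms t by auto
  then obtain k where "tri M t \<inter> tri M t' \<subseteq> {p. cb p = k} \<or> tri M t \<inter> tri M t' \<subseteq> {p. ca M p = k} \<or>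
      tri M t \<inter> tri M t' \<subseteq> {p. cb p + ca M p = k}"
  proof cases
    case 1
    then obtain k where "\<forall>x. real_of_int b \<le> x \<and> x \<le> of_int b + 1 \<and> real_of_int b' \<le> x \<and> x \<le> of_int b' + 1 \<longrightarrow> x = k"
      using line by blast
    then show ?thesis by (intro that[of k]) (auto simp: t hexbox_def)
  next
    case 2
    then obtain k where "\<forall>x. real_of_int a \<le> x \<and> x \<le> of_int a + 1 \<and> real_of_int a' \<le> x \<and> x \<le> of_int a' + 1 \<longrightarrow> x = k"
      using line by blast
    then show ?thesis by (intro that[of k]) (auto simp: t hexbox_def)
  next
    case 3
    then obtain k where "\<forall>x. real_of_int s \<le> x \<and> x \<le> of_int s + 1 \<and> real_of_int s' \<le> x \<and> x \<le> of_int s' + 1 \<longrightarrow> x = k"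
      using line by blast
    then show ?thesis by (intro that[of k]) (auto simp: t hexbox_def)
  qed
  then have "interior (tri M t \<inter> tri M t') \<subseteq> {}"
    by (elim disjE) (drule interior_mono, simp only: interior_line_empty)+
  then show ?thesis by simp
qed

section \<open>Unit triangles and rhombi of the lattice\<close>

definition ipt :: "nat \<Rightarrow> int \<Rightarrow> int \<Rightarrow> real \<times> real" where
  "ipt M b a = pt M (of_int b) (of_int a)"

lemma ipt_eq_iff [simp]: "ipt M b a = ipt M b' a' \<longleftrightarrow> b = b' \<and> a = a'"
  by (simp add: ipt_def)

lemma lattice_points_eq: "lattice_points M = {ipt M b a | b a. True}"
  unfolding lattice_points_def ipt_def pt_def by (force simp: algebra_simps)

text \<open>The units of the Eisenstein integers, here the six neighbours of a lattice point. Four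
  times the form is \<open>(2 * x + y)\<^sup>2 + 3 * y\<^sup>2\<close>, which bounds
  \<open>y\<close>, and by symmetry \<open>x\<close>.\<close>

lemma eisenstein_units:
  fixes x y :: int
  shows "x\<^sup>2 + x * y + y\<^sup>2 = 1 \<longleftrightarrow> (x, y) \<in> {(1, 0), (0, 1), (-1, 1), (-1, 0), (0, -1), (1, -1)}"
proof
  assume *: "x\<^sup>2 + x * y + y\<^sup>2 = 1"
  have bound: "v \<in> {-1, 0, 1}" if "u\<^sup>2 + u * v + v\<^sup>2 = 1" for u v :: int
  proof -
    have "(2 * u + v)\<^sup>2 + 3 * v\<^sup>2 = 4" using that by (simp add: power2_eq_square algebra_simps)
    then have "3 * v\<^sup>2 \<le> 4" using zero_le_power2[of "2 * u + v"] by linarith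
    then have "v\<^sup>2 \<le> 1" by simp
    then have "\<bar>v\<bar> \<le> 1" by (simp add: abs_square_le_1)
    then show ?thesis by auto
  qed
  have "y \<in> {-1, 0, 1}" using bound[OF *] .
  moreover have "x \<in> {-1, 0, 1}" using bound[of y x] * by (simp add: algebra_simps)
  ultimately show "(x, y) \<in> {(1, 0), (0, 1), (-1, 1), (-1, 0), (0, -1), (1, -1)}"
    using * by auto
qed auto

lemma dist_ipt_eq_1_iff:
  "dist (ipt M b a) (ipt M b' a') = 1 \<longleftrightarrow>
    (b' - b, a' - a) \<in> {(1, 0), (0, 1), (-1, 1), (-1, 0), (0, -1), (1, -1)}"
proof -
  let ?x = "b' - b" and ?y = "a' - a"
  have "(dist (ipt M b a) (ipt M b' a'))\<^sup>2 =
      (sqrt 3 / 2 * b - sqrt 3 / 2 * b')\<^sup>2 + (a + b / 2 - (a' + b' / 2))\<^sup>2"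
    by (simp add: ipt_def pt_def dist_Pair_Pair dist_real_def) (simp add: algebra_simps)
  also have "\<dots> = of_int (?x\<^sup>2 + ?x * ?y + ?y\<^sup>2)"
    by (simp add: power2_eq_square field_simps)
  finally have "(dist (ipt M b a) (ipt M b' a'))\<^sup>2 = of_int (?x\<^sup>2 + ?x * ?y + ?y\<^sup>2)" .
  moreover have "d = 1 \<longleftrightarrow> d\<^sup>2 = 1" if "d \<ge> 0" for d :: real
    using that by (auto simp: power2_eq_1_iff)
  ultimately have "dist (ipt M b a) (ipt M b' a') = 1 \<longleftrightarrow> ?x\<^sup>2 + ?x * ?y + ?y\<^sup>2 = 1"
    using zero_le_dist[of "ipt M b a" "ipt M b' a'"] by (metis of_int_eq_1_iff)
  then show ?thesis unfolding eisenstein_units .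
qed

definition lower_vertices :: "nat \<Rightarrow> int \<Rightarrow> int \<Rightarrow> (real \<times> real) set" where
  "lower_vertices M b a = {ipt M b a, ipt M b (a + 1), ipt M (b + 1) a}"

definition upper_vertices :: "nat \<Rightarrow> int \<Rightarrow> int \<Rightarrow> (real \<times> real) set" where
  "upper_vertices M b a = {ipt M (b + 1) (a + 1), ipt M b (a + 1), ipt M (b + 1) a}"

lemma convex_hull_vertices:
  "convex hull lower_vertices M b a = tri M (b, a, a + b)"
  "convex hull upper_vertices M b a = tri M (b, a, a + b + 1)"
  using convex_hull_tri_lower[of M b a] convex_hull_tri_upper[of M b a]
  by (simp_all only: lower_vertices_def upper_vertices_def ipt_def of_int_add of_int_1)

lemma unit_triple_cases:
  assumes "unit_triple M p q r"
  shows "\<exists>b a. {p, q, r} = lower_vertices M b a \<or> {p, q, r} = upper_vertices M b a"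
proof -
  have "p \<in> lattice_points M" "q \<in> lattice_points M" "r \<in> lattice_points M"
    using assms by (auto simp: unit_triple_def)
  then obtain b a b1 a1 b2 a2 where pt: "p = ipt M b a" "q = ipt M b1 a1" "r = ipt M b2 a2"
    unfolding lattice_points_eq by blast
  define x y u v where "x = b1 - b" and "y = a1 - a" and "u = b2 - b" and "v = a2 - a"
  have 1: "(x, y) \<in> {(1, 0), (0, 1), (-1, 1), (-1, 0), (0, -1), (1, -1)}"
    and 2: "(u, v) \<in> {(1, 0), (0, 1), (-1, 1), (-1, 0), (0, -1), (1, -1)}"
    and 3: "(u - x, v - y) \<in> {(1, 0), (0, 1), (-1, 1), (-1, 0), (0, -1), (1, -1)}"
    using assms unfolding unit_triple_def pt dist_ipt_eq_1_iff by (simp_all add: x_def y_def u_def v_def)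
  have qr: "q = ipt M (b + x) (a + y)" "r = ipt M (b + u) (a + v)"
    by (simp_all add: pt x_def y_def u_def v_def)
  \<comment> \<open>The six triangles around \<open>p\<close>, each with its other two vertices in
    both orders.\<close>
  have "x = 1 \<and> y = 0 \<and> u = 0 \<and> v = 1 \<or> x = 0 \<and> y = 1 \<and> u = -1 \<and> v = 1 \<or>
      x = -1 \<and> y = 1 \<and> u = -1 \<and> v = 0 \<or> x = -1 \<and> y = 0 \<and> u = 0 \<and> v = -1 \<or>
      x = 0 \<and> y = -1 \<and> u = 1 \<and> v = -1 \<or> x = 1 \<and> y = -1 \<and> u = 1 \<and> v = 0 \<or>
      x = 0 \<and> y = 1 \<and> u = 1 \<and> v = 0 \<or> x = -1 \<and> y = 1 \<and> u = 0 \<and> v = 1 \<or>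
      x = -1 \<and> y = 0 \<and> u = -1 \<and> v = 1 \<or> x = 0 \<and> y = -1 \<and> u = -1 \<and> v = 0 \<or>
      x = 1 \<and> y = -1 \<and> u = 0 \<and> v = -1 \<or> x = 1 \<and> y = 0 \<and> u = 1 \<and> v = -1"
    using 1 2 3 unfolding insert_iff empty_iff prod.inject by (smt (verit))
  then have "{p, q, r} \<in> {lower_vertices M b a, upper_vertices M (b - 1) a, lower_vertices M (b - 1) a,
      upper_vertices M (b - 1) (a - 1), lower_vertices M b (a - 1), upper_vertices M b (a - 1)}"
    unfolding qr pt(1) lower_vertices_def upper_vertices_def
    by (elim disjE conjE) (simp_all add: insert_commute)
  then show ?thesis by blast
qed

text \<open>Two vertices determine a lower triangle. The maxima of their coordinates are what
  determines an upper triangle with the same side, so the third conclusion locates the neighbour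
  across that side.\<close>

lemma two_lower_vertices:
  assumes "ipt M x y \<in> lower_vertices M b a" "ipt M u v \<in> lower_vertices M b a" "(x, y) \<noteq> (u, v)"
  shows "b = min x u" "a = min y v" "(max x u, max y v) \<in> {(b, a + 1), (b + 1, a), (b + 1, a + 1)}"
  using assms unfolding lower_vertices_def insert_iff empty_iff ipt_eq_iff prod.inject
  by (elim disjE conjE FalseE; simp)+

lemma two_upper_vertices:
  assumes "ipt M x y \<in> upper_vertices M b a" "ipt M u v \<in> upper_vertices M b a" "(x, y) \<noteq> (u, v)"
  shows "b = max x u - 1" "a = max y v - 1"
  using assms unfolding upper_vertices_def insert_iff empty_iff ipt_eq_iff prod.inject
  by (elim disjE conjE FalseE; simp)+

lemma shared_edge:
  assumes "p \<noteq> q" "p \<in> A" "q \<in> A" "p \<in> B" "q \<in> B"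
  shows "A = lower_vertices M b a \<Longrightarrow> B = lower_vertices M b' a' \<Longrightarrow> A = B"
    and "A = upper_vertices M b a \<Longrightarrow> B = upper_vertices M b' a' \<Longrightarrow> A = B"
    and "A = lower_vertices M b a \<Longrightarrow> B = upper_vertices M b' a' \<Longrightarrow>
      (b', a') \<in> {(b - 1, a), (b, a - 1), (b, a)}"
proof -
  have pts: "\<exists>x y u v. p = ipt M x y \<and> q = ipt M u v"
    if "A \<in> {lower_vertices M b a, upper_vertices M b a}"
  proof -
    have "\<exists>x y. z = ipt M x y" if "z \<in> A" for z
      using that \<open>A \<in> _\<close> unfolding lower_vertices_def upper_vertices_def by (elim insertE emptyE) auto
    then show ?thesis using assms(2,3) by blast
  qed
  show "A = B" if AB: "A = lower_vertices M b a" "B = lower_vertices M b' a'"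
  proof -
    obtain x y u v where pq: "p = ipt M x y" "q = ipt M u v" using pts AB by blast
    have ne: "(x, y) \<noteq> (u, v)" using assms(1) pq by auto
    have mem: "ipt M x y \<in> lower_vertices M b a" "ipt M u v \<in> lower_vertices M b a"
      "ipt M x y \<in> lower_vertices M b' a'" "ipt M u v \<in> lower_vertices M b' a'"
      using assms(2-5) unfolding AB pq by auto
    have "b = b' \<and> a = a'"
      using two_lower_vertices(1,2)[OF mem(1,2) ne] two_lower_vertices(1,2)[OF mem(3,4) ne] by simp
    then show ?thesis using AB by simp
  qed
  show "A = B" if AB: "A = upper_vertices M b a" "B = upper_vertices M b' a'"
  proof -
    obtain x y u v where pq: "p = ipt M x y" "q = ipt M u v" using pts AB by blast
    have ne: "(x, y) \<noteq> (u, v)" using assms(1) pq by auto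
    have mem: "ipt M x y \<in> upper_vertices M b a" "ipt M u v \<in> upper_vertices M b a"
      "ipt M x y \<in> upper_vertices M b' a'" "ipt M u v \<in> upper_vertices M b' a'"
      using assms(2-5) unfolding AB pq by auto
    have "b = b' \<and> a = a'"
      using two_upper_vertices(1,2)[OF mem(1,2) ne] two_upper_vertices(1,2)[OF mem(3,4) ne] by simp
    then show ?thesis using AB by simp
  qed
  show "(b', a') \<in> {(b - 1, a), (b, a - 1), (b, a)}"
    if AB: "A = lower_vertices M b a" "B = upper_vertices M b' a'"
  proof -
    obtain x y u v where pq: "p = ipt M x y" "q = ipt M u v" using pts AB by blast
    have ne: "(x, y) \<noteq> (u, v)" using assms(1) pq by auto
    have mem: "ipt M x y \<in> lower_vertices M b a" "ipt M u v \<in> lower_vertices M b a"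
      "ipt M x y \<in> upper_vertices M b' a'" "ipt M u v \<in> upper_vertices M b' a'"
      using assms(2-5) unfolding AB pq by auto
    show ?thesis
      using two_lower_vertices(3)[OF mem(1,2) ne] two_upper_vertices[OF mem(3,4) ne] by auto
  qed
qed

text \<open>Each unit triangle has one vertical side, lower ones on the left and upper ones on the
  right, so it is indexed by that side. The end cell of an edge begins one column earlier; for
  column 0 it is outside the hexagon.\<close>

fun start_cell :: "nat \<times> int \<Rightarrow> int \<times> int \<times> int" where
  "start_cell (b, a) = (int b, a, a + int b)"

fun end_cell :: "nat \<times> int \<Rightarrow> int \<times> int \<times> int" where
  "end_cell (b, a) = (int b - 1, a, a + int b)"

definition tile :: "nat \<Rightarrow> nat \<times> int \<Rightarrow> nat \<times> int \<Rightarrow> (real \<times> real) set" where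
  "tile M e f = tri M (start_cell e) \<union> tri M (end_cell f)"

lemma start_cell_in_cells [simp]: "start_cell e \<in> cells"
  and end_cell_in_cells [simp]: "end_cell f \<in> cells"
  by (cases e, simp add: cells_def) (cases f, simp add: cells_def)

lemma start_cell_eq_iff [simp]: "start_cell e = start_cell e' \<longleftrightarrow> e = e'"
  and end_cell_eq_iff [simp]: "end_cell f = end_cell f' \<longleftrightarrow> f = f'"
  and start_cell_neq_end_cell [simp]: "start_cell e \<noteq> end_cell f" "end_cell f \<noteq> start_cell e"
  by (cases e; cases e'; cases f; cases f'; auto)+

lemma mem_below_iff:
  "(b, a) \<in> below N M (2 * N) \<longleftrightarrow>
    b < 2 * N \<and> - int (M + N) \<le> a \<and> a \<le> -1 \<and> - int M \<le> a + int b \<and> a + int b \<le> int N - 1"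
  by (simp add: below_def slots_def)

lemma mem_ends_iff:
  "(b, a) \<in> ends N M \<longleftrightarrow>
    0 < b \<and> b \<le> 2 * N \<and> - int (M + N) \<le> a \<and> a \<le> -1 \<and> - int M \<le> a + int b \<and> a + int b \<le> int N - 1"
  by (simp add: ends_def slots_def)

lemma start_cell_subset_hexagon:
  "N \<ge> 1 \<Longrightarrow> tri M (start_cell e) \<subseteq> hexagon N M \<longleftrightarrow> e \<in> below N M (2 * N)"
  using start_cell_in_cells[of e] by (cases e) (simp add: tri_subset_hexagon mem_below_iff del: tri.simps start_cell_in_cells, auto)

lemma end_cell_subset_hexagon:
  "N \<ge> 1 \<Longrightarrow> tri M (end_cell f) \<subseteq> hexagon N M \<longleftrightarrow> f \<in> ends N M"
  using end_cell_in_cells[of f] by (cases f) (simp add: tri_subset_hexagon mem_ends_iff del: tri.simps end_cell_in_cells, auto)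

text \<open>Two triangles of the same kind that share a side are equal, so a rhombus joins a lower
  and an upper one, and the three sides of the lower one lead to the three \<open>targets\<close>.
  In the converse direction \<open>p\<close> and \<open>q\<close> span the common side.\<close>

lemma rhombi_eq:
  assumes "N \<ge> 1"
  shows "rhombi N M = {tile M e f | e f. e \<in> below N M (2 * N) \<and> f \<in> ends N M \<and> f \<in> targets e}"
proof (intro equalityI subsetI)
  fix R assume "R \<in> rhombi N M"
  then obtain p q r s where R: "R = convex hull {p, q, r} \<union> convex hull {p, q, s}"
    and pqr: "unit_triple M p q r" and pqs: "unit_triple M p q s" and "r \<noteq> s"
    and hex: "convex hull {p, q, r} \<subseteq> hexagon N M" "convex hull {p, q, s} \<subseteq> hexagon N M"
    unfolding rhombi_def by blast
  have "p \<noteq> q" "r \<noteq> p" "r \<noteq> q" using pqr by (auto simp: unit_triple_def)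
  then have neq: "{p, q, r} \<noteq> {p, q, s}" using \<open>r \<noteq> s\<close> by auto
  note edge = shared_edge[OF \<open>p \<noteq> q\<close>]
  have result: "R \<in> {tile M e f | e f. e \<in> below N M (2 * N) \<and> f \<in> ends N M \<and> f \<in> targets e}"
    if AB: "{A, B} = {{p, q, r}, {p, q, s}}" "A = lower_vertices M b a" "B = upper_vertices M b' a'" for A B b a b' a'
  proof -
    have "A = {p, q, r} \<and> B = {p, q, s} \<or> A = {p, q, s} \<and> B = {p, q, r}"
      using AB(1) by (simp add: doubleton_eq_iff)
    then have RAB: "R = convex hull A \<union> convex hull B" and pq: "p \<in> A" "q \<in> A" "p \<in> B" "q \<in> B"
      and sub: "convex hull A \<subseteq> hexagon N M" "convex hull B \<subseteq> hexagon N M"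
      using R hex by auto
    have adj: "(b', a') \<in> {(b - 1, a), (b, a - 1), (b, a)}" by (rule edge(3)[OF pq AB(2,3)])
    have A: "convex hull A = tri M (b, a, a + b)" and B: "convex hull B = tri M (b', a', a' + b' + 1)"
      unfolding AB(2,3) by (rule convex_hull_vertices)+
    have b: "0 \<le> b" using sub(1) tri_subset_hexagon[OF assms, of b a "a + b" M] unfolding A by (simp add: cells_def del: tri.simps)
    have b': "0 \<le> b'" using sub(2) tri_subset_hexagon[OF assms, of b' a' "a' + b' + 1" M] unfolding B by (simp add: cells_def del: tri.simps)
    have "convex hull A = tri M (start_cell (nat b, a))" "convex hull B = tri M (end_cell (nat (b' + 1), a'))"
      unfolding A B using b b' by (simp_all add: add_ac)
    then have "R = tile M (nat b, a) (nat (b' + 1), a')" "(nat b, a) \<in> below N M (2 * N)" "(nat (b' + 1), a') \<in> ends N M"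
      using RAB sub start_cell_subset_hexagon[OF assms] end_cell_subset_hexagon[OF assms] by (simp_all only: tile_def)
    moreover have "(nat (b' + 1), a') \<in> targets (nat b, a)" using adj b b' by auto
    ultimately show ?thesis by blast
  qed
  obtain b a b' a' where d1: "{p, q, r} = lower_vertices M b a \<or> {p, q, r} = upper_vertices M b a"
    and d2: "{p, q, s} = lower_vertices M b' a' \<or> {p, q, s} = upper_vertices M b' a'"
    using unit_triple_cases[OF pqr] unit_triple_cases[OF pqs] by metis
  show "R \<in> {tile M e f | e f. e \<in> below N M (2 * N) \<and> f \<in> ends N M \<and> f \<in> targets e}"
    using d1
  proof
    assume 1: "{p, q, r} = lower_vertices M b a"
    show ?thesis
      using d2
    proof
      assume 2: "{p, q, s} = lower_vertices M b' a'"
      have "{p, q, r} = {p, q, s}" by (intro edge(1)[OF _ _ _ _ 1 2]) simp_all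
      then show ?thesis using neq by simp
    next
      assume "{p, q, s} = upper_vertices M b' a'"
      then show ?thesis by (intro result[OF refl 1])
    qed
  next
    assume 1: "{p, q, r} = upper_vertices M b a"
    show ?thesis
      using d2
    proof
      assume 2: "{p, q, s} = upper_vertices M b' a'"
      have "{p, q, r} = {p, q, s}" by (intro edge(2)[OF _ _ _ _ 1 2]) simp_all
      then show ?thesis using neq by simp
    next
      assume "{p, q, s} = lower_vertices M b' a'"
      then show ?thesis by (rule result[OF insert_commute _ 1])
    qed
  qed
next
  fix R assume "R \<in> {tile M e f | e f. e \<in> below N M (2 * N) \<and> f \<in> ends N M \<and> f \<in> targets e}"
  then obtain b a f where R: "R = tile M (b, a) f" and e: "(b, a) \<in> below N M (2 * N)"
    and f: "f \<in> ends N M" "f \<in> targets (b, a)" by auto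
  have hex: "tri M (start_cell (b, a)) \<subseteq> hexagon N M" "tri M (end_cell f) \<subseteq> hexagon N M"
    using e f start_cell_subset_hexagon[OF assms] end_cell_subset_hexagon[OF assms] by blast+
  have lower: "convex hull (lower_vertices M (int b) a) = tri M (start_cell (b, a))"
    by (simp only: convex_hull_vertices start_cell.simps)
  have rhombus: "R \<in> rhombi N M"
    if "unit_triple M p q r" "unit_triple M p q s" "r \<noteq> s" "{p, q, r} = lower_vertices M (int b) a"
      "convex hull {p, q, s} = tri M (end_cell f)" for p q r s
  proof -
    have "R = convex hull {p, q, r} \<union> convex hull {p, q, s}"
      "convex hull {p, q, r} \<subseteq> hexagon N M" "convex hull {p, q, s} \<subseteq> hexagon N M"
      unfolding that(4,5) lower R tile_def using hex by simp_all
    then show ?thesis using that(1-3) unfolding rhombi_def by blast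
  qed
  have lat: "ipt M x y \<in> lattice_points M" for x y by (auto simp: lattice_points_eq)
  consider "f = (b, a)" | "f = (Suc b, a)" | "f = (Suc b, a - 1)" using f(2) by auto
  then show "R \<in> rhombi N M"
  proof cases
    case 1
    show ?thesis
    proof (rule rhombus[of "ipt M (int b) a" "ipt M (int b) (a + 1)" "ipt M (int b + 1) a" "ipt M (int b - 1) (a + 1)"])
      have "{ipt M (int b) a, ipt M (int b) (a + 1), ipt M (int b - 1) (a + 1)} = upper_vertices M (int b - 1) a"
        by (auto simp: upper_vertices_def)
      then show "convex hull {ipt M (int b) a, ipt M (int b) (a + 1), ipt M (int b - 1) (a + 1)} = tri M (end_cell f)"
        by (simp only: convex_hull_vertices) (simp add: 1)
    qed (auto simp: unit_triple_def dist_ipt_eq_1_iff lat lower_vertices_def)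
  next
    case 2
    show ?thesis
    proof (rule rhombus[of "ipt M (int b) (a + 1)" "ipt M (int b + 1) a" "ipt M (int b) a" "ipt M (int b + 1) (a + 1)"])
      have "{ipt M (int b) (a + 1), ipt M (int b + 1) a, ipt M (int b + 1) (a + 1)} = upper_vertices M (int b) a"
        by (auto simp: upper_vertices_def)
      then show "convex hull {ipt M (int b) (a + 1), ipt M (int b + 1) a, ipt M (int b + 1) (a + 1)} = tri M (end_cell f)"
        by (simp only: convex_hull_vertices) (simp add: 2 add_ac)
    qed (auto simp: unit_triple_def dist_ipt_eq_1_iff lat lower_vertices_def)
  next
    case 3
    show ?thesis
    proof (rule rhombus[of "ipt M (int b) a" "ipt M (int b + 1) a" "ipt M (int b) (a + 1)" "ipt M (int b + 1) (a - 1)"])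
      have "{ipt M (int b) a, ipt M (int b + 1) a, ipt M (int b + 1) (a - 1)} = upper_vertices M (int b) (a - 1)"
        by (auto simp: upper_vertices_def)
      then show "convex hull {ipt M (int b) a, ipt M (int b + 1) a, ipt M (int b + 1) (a - 1)} = tri M (end_cell f)"
        by (simp only: convex_hull_vertices) (simp add: 3 add_ac)
    qed (auto simp: unit_triple_def dist_ipt_eq_1_iff lat lower_vertices_def)
  qed
qed

lemma hexagon_covered:
  assumes "N \<ge> 1" "p \<in> hexagon N M"
  obtains e where "e \<in> below N M (2 * N)" "p \<in> tri M (start_cell e)"
  | f where "f \<in> ends N M" "p \<in> tri M (end_cell f)"
proof -
  define x y where "x = cb p" and "y = ca M p"
  have p: "p = pt M x y" by (simp add: x_def y_def)
  have ineq: "0 \<le> x" "x \<le> 2 * real N" "- (real M + real N) \<le> y" "y \<le> 0" "- real M \<le> x + y" "x + y \<le> real N"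
    using assms unfolding hexagon_eq_hexbox[OF assms(1)] by (simp_all add: p)
  \<comment> \<open>The floors are capped so that points on the right and upper sides of the hexagon
    still get strips inside it.\<close>
  define b a s where "b = min \<lfloor>x\<rfloor> (2 * int N - 1)" and "a = min \<lfloor>y\<rfloor> (-1)" and "s = min \<lfloor>x + y\<rfloor> (int N - 1)"
  have range: "0 \<le> b" "b \<le> 2 * int N - 1" "- int (M + N) \<le> a" "a \<le> -1" "- int M \<le> s" "s \<le> int N - 1"
    using ineq assms(1) unfolding b_def a_def s_def by (auto simp: le_floor_iff)
  have bx: "of_int b \<le> x" "x \<le> of_int b + 1" and ay: "of_int a \<le> y" "y \<le> of_int a + 1"
    and sxy: "of_int s \<le> x + y" "x + y \<le> of_int s + 1"
    using ineq unfolding b_def a_def s_def min_def by (simp_all; linarith)+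
  have nb: "int (nat b) = b" using range by simp
  consider "s = a + b" | "s = a + b + 1" | "s = a + b + 2" | "s = a + b - 1"
    using bx ay sxy by linarith
  then show thesis
  proof cases
    case 1
    have "(nat b, a) \<in> below N M (2 * N)" unfolding mem_below_iff nb using range 1 by auto
    moreover have "p \<in> tri M (start_cell (nat b, a))"
      unfolding p using bx ay sxy range(1) by (simp add: nb 1)
    ultimately show thesis by (rule that(1))
  next
    case 2
    have nb': "int (nat (b + 1)) = b + 1" using range by simp
    have "(nat (b + 1), a) \<in> ends N M" unfolding mem_ends_iff nb' using range 2 by auto
    moreover have "p \<in> tri M (end_cell (nat (b + 1), a))"
      unfolding p using bx ay sxy range(1) by (simp add: nb' 2)
    ultimately show thesis by (rule that(2))
  next
    case 3
    \<comment> \<open>Both caps on \<open>b\<close> and \<open>a\<close> would be active, which puts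
      the point at \<open>x = 2 * N\<close>, \<open>y = 0\<close>, outside the hexagon.\<close>
    then have "real_of_int s = of_int a + of_int b + 2" by simp
    then have "x = of_int b + 1" "y = of_int a + 1" using bx ay sxy by linarith+
    then have "\<lfloor>x\<rfloor> \<noteq> b" "\<lfloor>y\<rfloor> \<noteq> a" by linarith+
    then have "b = 2 * int N - 1" "a = -1" unfolding b_def a_def by (auto simp: min_def split: if_splits)
    then show thesis using \<open>x = of_int b + 1\<close> \<open>y = of_int a + 1\<close> ineq assms(1) by simp
  next
    case 4
    \<comment> \<open>Here the cap on \<open>s\<close> is active: the point is a lattice point with
      \<open>x + y = N\<close>, and it is the right vertex of the lower triangle one column to the
      left.\<close>
    then have "real_of_int s = of_int a + of_int b - 1" by simp
    then have xy: "x = of_int b" "y = of_int a" using bx ay sxy by linarith+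
    then have "\<lfloor>x + y\<rfloor> = a + b" by (metis add.commute floor_of_int of_int_add)
    then have ab: "a + b = int N" using 4 unfolding s_def by auto
    have nb': "int (nat (b - 1)) = b - 1" using range ab by simp
    have "(nat (b - 1), a) \<in> below N M (2 * N)" unfolding mem_below_iff nb' using range ab by auto
    moreover have "p \<in> tri M (start_cell (nat (b - 1), a))"
      unfolding p using xy ab range by (simp add: nb')
    ultimately show thesis by (rule that(1))
  qed
qed

lemma centroid_in_tile_iff:
  assumes "t \<in> cells"
  shows "centroid M t \<in> tile M e f \<longleftrightarrow> t = start_cell e \<or> t = end_cell f"
  using assms by (simp add: tile_def centroid_in_tri_iff)

lemma tile_eq_iff: "tile M e f = tile M e' f' \<longleftrightarrow> e = e' \<and> f = f'"
proof
  assume eq: "tile M e f = tile M e' f'"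
  have "centroid M (start_cell e) \<in> tile M e' f'" "centroid M (end_cell f) \<in> tile M e' f'"
    unfolding eq[symmetric] by (simp_all add: centroid_in_tile_iff)
  then show "e = e' \<and> f = f'" by (simp add: centroid_in_tile_iff)
qed simp

lemma tri_overlap:
  assumes "t \<in> cells" "tri M t \<subseteq> A" "tri M t \<subseteq> B"
  shows "\<not> disjnt (interior A) (interior B)"
proof -
  have "centroid M t \<in> interior A" "centroid M t \<in> interior B"
    using centroid_in_interior[OF assms(1), of M] interior_mono[OF assms(2)] interior_mono[OF assms(3)] by blast+
  then show ?thesis by (auto simp: disjnt_def)
qed

text \<open>The tiles meet in a union of four intersections of distinct triangles. These have empty
  interior, and since they are closed, so has their union.\<close>

lemma disjnt_interior_tiles:
  assumes "e \<noteq> e'" "f \<noteq> f'"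
  shows "disjnt (interior (tile M e f)) (interior (tile M e' f'))"
proof -
  define I where "I t t' = tri M t \<inter> tri M t'" for t t'
  have closed: "closed (I t t')" for t t' unfolding I_def by (intro closed_Int closed_tri)
  have empty: "interior (I t t') = {}" if "t \<noteq> t'" for t t'
    unfolding I_def by (rule interior_tri_inter_empty[OF that])
  have "tile M e f \<inter> tile M e' f' = (I (start_cell e) (start_cell e') \<union> I (start_cell e) (end_cell f')) \<union>
      (I (end_cell f) (start_cell e') \<union> I (end_cell f) (end_cell f'))"
    unfolding tile_def I_def by (simp only: Int_Un_distrib Int_Un_distrib2 Un_ac)
  also have "interior \<dots> = {}"
    using assms by (simp add: interior_closed_Un_empty_interior closed closed_Un empty)
  finally show ?thesis
    by (simp add: disjnt_def interior_Int)
qed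

section \<open>Tilings as matchings, and the central rhombus\<close>

definition tiling_of :: "nat \<Rightarrow> nat \<Rightarrow> (nat \<times> int \<Rightarrow> nat \<times> int) \<Rightarrow> (real \<times> real) set set" where
  "tiling_of N M \<phi> = (\<lambda>e. tile M e (\<phi> e)) ` below N M (2 * N)"

lemma tile_in_tiling_of_iff: "tile M e f \<in> tiling_of N M \<phi> \<longleftrightarrow> e \<in> below N M (2 * N) \<and> \<phi> e = f"
  by (auto simp: tiling_of_def tile_eq_iff)

lemma tiling_of_in_rhombus_tilings:
  assumes "N \<ge> 1" "\<phi> \<in> matchings N M"
  shows "tiling_of N M \<phi> \<in> rhombus_tilings N M"
proof -
  let ?B = "below N M (2 * N)"
  have bij: "bij_betw \<phi> ?B (ends N M)" and adj: "\<And>e. e \<in> ?B \<Longrightarrow> \<phi> e \<in> targets e"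
    using assms(2) by (simp_all add: matchings_def)
  have ends: "\<phi> e \<in> ends N M" if "e \<in> ?B" for e using bij that by (simp add: bij_betw_apply)
  have rhombi: "tiling_of N M \<phi> \<subseteq> rhombi N M"
    unfolding rhombi_eq[OF assms(1)] tiling_of_def using ends adj by blast
  have "pairwise (\<lambda>R S. disjnt (interior R) (interior S)) (tiling_of N M \<phi>)"
    unfolding tiling_of_def
  proof (intro pairwiseI, elim imageE)
    fix R S e e' assume *: "R = tile M e (\<phi> e)" "S = tile M e' (\<phi> e')" "e \<in> ?B" "e' \<in> ?B" "R \<noteq> S"
    then have "e \<noteq> e'" by auto
    moreover from this have "\<phi> e \<noteq> \<phi> e'" using bij_betw_imp_inj_on[OF bij] *(3,4) by (auto dest: inj_onD)
    ultimately show "disjnt (interior R) (interior S)"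
      unfolding *(1,2) by (rule disjnt_interior_tiles)
  qed
  moreover have "\<Union>(tiling_of N M \<phi>) = hexagon N M"
  proof (intro equalityI subsetI)
    fix p assume "p \<in> \<Union>(tiling_of N M \<phi>)"
    then obtain e where e: "e \<in> ?B" "p \<in> tile M e (\<phi> e)" by (auto simp: tiling_of_def)
    then show "p \<in> hexagon N M"
      using start_cell_subset_hexagon[OF assms(1), of M e] end_cell_subset_hexagon[OF assms(1), of M "\<phi> e"] ends[OF e(1)]
      by (auto simp: tile_def)
  next
    fix p assume "p \<in> hexagon N M"
    then show "p \<in> \<Union>(tiling_of N M \<phi>)"
    proof (rule hexagon_covered[OF assms(1)])
      fix e assume "e \<in> ?B" "p \<in> tri M (start_cell e)"
      then show ?thesis by (auto simp: tiling_of_def tile_def)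
    next
      fix f assume f: "f \<in> ends N M" "p \<in> tri M (end_cell f)"
      have "f \<in> \<phi> ` ?B" using bij f(1) by (simp add: bij_betw_def)
      then show ?thesis using f(2) by (auto simp: tiling_of_def tile_def)
    qed
  qed
  ultimately show ?thesis using rhombi by (simp add: rhombus_tilings_def)
qed

text \<open>Every cell of the hexagon lies in exactly one tile: some tile covers its centroid and
  hence contains the cell, and two tiles containing it would have overlapping interiors. Applied to
  start cells this makes \<phi> a function, applied to end cells a bijection.\<close>

lemma rhombus_tiling_is_tiling_of:
  assumes "N \<ge> 1" "T \<in> rhombus_tilings N M"
  shows "\<exists>\<phi>\<in>matchings N M. tiling_of N M \<phi> = T"
proof -
  let ?B = "below N M (2 * N)"
  have sub: "T \<subseteq> rhombi N M" and disj: "pairwise (\<lambda>R S. disjnt (interior R) (interior S)) T"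
    and union: "\<Union>T = hexagon N M"
    using assms(2) by (auto simp: rhombus_tilings_def)
  have tiles: "\<exists>e f. R = tile M e f \<and> e \<in> ?B \<and> f \<in> ends N M \<and> f \<in> targets e" if "R \<in> T" for R
    using that sub unfolding rhombi_eq[OF assms(1)] by blast
  have cover: "\<exists>R\<in>T. centroid M t \<in> R" if "t \<in> cells" "tri M t \<subseteq> hexagon N M" for t
  proof -
    have "centroid M t \<in> hexagon N M"
      using that centroid_in_tri_iff[of t t M] by blast
    then show ?thesis unfolding union[symmetric] by blast
  qed
  have same: "R = S" if "R \<in> T" "S \<in> T" "t \<in> cells" "tri M t \<subseteq> R" "tri M t \<subseteq> S" for R S t
    using pairwiseD[OF disj that(1,2)] tri_overlap[OF that(3-5)] by blast
  have starts: "\<exists>f. tile M e f \<in> T" if e: "e \<in> ?B" for e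
  proof -
    obtain R where R: "R \<in> T" "centroid M (start_cell e) \<in> R"
      using cover[of "start_cell e"] start_cell_subset_hexagon[OF assms(1), of M e] e by auto
    obtain e' f where R': "R = tile M e' f" using tiles[OF R(1)] by blast
    then have "e' = e" using R(2) by (simp add: centroid_in_tile_iff)
    then show ?thesis using R(1) R' by blast
  qed
  have ends: "\<exists>e. tile M e f \<in> T" if f: "f \<in> ends N M" for f
  proof -
    obtain R where R: "R \<in> T" "centroid M (end_cell f) \<in> R"
      using cover[of "end_cell f"] end_cell_subset_hexagon[OF assms(1), of M f] f by auto
    obtain e f' where R': "R = tile M e f'" using tiles[OF R(1)] by blast
    then have "f' = f" using R(2) by (simp add: centroid_in_tile_iff)
    then show ?thesis using R(1) R' by blast
  qed
  have unique_end: "f = f'" if "tile M e f \<in> T" "tile M e f' \<in> T" for e f f'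
  proof -
    have "tile M e f = tile M e f'"
      by (rule same[OF that, of "start_cell e"]) (auto simp: tile_def)
    then show ?thesis by (simp add: tile_eq_iff)
  qed
  have unique_start: "e = e'" if "tile M e f \<in> T" "tile M e' f \<in> T" for e e' f
  proof -
    have "tile M e f = tile M e' f"
      by (rule same[OF that, of "end_cell f"]) (auto simp: tile_def)
    then show ?thesis by (simp add: tile_eq_iff)
  qed
  define \<phi> where "\<phi> = restrict (\<lambda>e. SOME f. tile M e f \<in> T) ?B"
  have \<phi>: "tile M e (\<phi> e) \<in> T" if "e \<in> ?B" for e
    using someI_ex[OF starts[OF that]] that by (simp add: \<phi>_def)
  have \<phi>_eq: "e \<in> ?B \<and> f \<in> ends N M \<and> f \<in> targets e \<and> \<phi> e = f" if ef: "tile M e f \<in> T" for e f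
  proof -
    obtain e' f' where "tile M e f = tile M e' f'" and *: "e' \<in> ?B" "f' \<in> ends N M" "f' \<in> targets e'"
      using tiles[OF ef] by blast
    then have "e = e'" "f = f'" by (simp_all add: tile_eq_iff)
    then show ?thesis using * unique_end[OF \<phi> ef] by simp
  qed
  have "bij_betw \<phi> ?B (ends N M)"
  proof (rule bij_betwI')
    fix e e' assume "e \<in> ?B" "e' \<in> ?B"
    then show "\<phi> e = \<phi> e' \<longleftrightarrow> e = e'" using \<phi> unique_start by metis
  next
    fix e assume "e \<in> ?B"
    then show "\<phi> e \<in> ends N M" using \<phi> \<phi>_eq by blast
  next
    fix f assume "f \<in> ends N M"
    then obtain e where "tile M e f \<in> T" using ends by blast
    then show "\<exists>e\<in>?B. f = \<phi> e" using \<phi>_eq by blast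
  qed
  moreover have "\<phi> e \<in> targets e" if "e \<in> ?B" for e using \<phi>[OF that] \<phi>_eq by blast
  ultimately have "\<phi> \<in> matchings N M" by (simp add: matchings_def \<phi>_def)
  moreover have "tiling_of N M \<phi> = T"
  proof (intro equalityI subsetI)
    fix R assume "R \<in> tiling_of N M \<phi>"
    then show "R \<in> T" using \<phi> by (auto simp: tiling_of_def)
  next
    fix R assume R: "R \<in> T"
    then obtain e f where ef: "R = tile M e f" using tiles by blast
    then show "R \<in> tiling_of N M \<phi>" using \<phi>_eq[of e f] R by (simp add: tile_in_tiling_of_iff)
  qed
  ultimately show ?thesis by blast
qed

lemma bij_betw_tiling_of:
  assumes "N \<ge> 1"
  shows "bij_betw (tiling_of N M) (matchings N M) (rhombus_tilings N M)"
proof (rule bij_betw_imageI)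
  show "inj_on (tiling_of N M) (matchings N M)"
  proof (rule inj_onI)
    fix \<phi> \<psi> assume \<phi>: "\<phi> \<in> matchings N M" and \<psi>: "\<psi> \<in> matchings N M" and eq: "tiling_of N M \<phi> = tiling_of N M \<psi>"
    show "\<phi> = \<psi>"
    proof (rule extensionalityI[of _ "below N M (2 * N)"])
      fix e assume "e \<in> below N M (2 * N)"
      then have "tile M e (\<phi> e) \<in> tiling_of N M \<psi>" by (simp add: tile_in_tiling_of_iff flip: eq)
      then show "\<phi> e = \<psi> e" by (simp add: tile_in_tiling_of_iff)
    qed (use \<phi> \<psi> in \<open>simp_all add: matchings_def\<close>)
  qed
  show "tiling_of N M ` matchings N M = rhombus_tilings N M"
    using tiling_of_in_rhombus_tilings[OF assms] rhombus_tiling_is_tiling_of[OF assms] by blast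
qed

text \<open>The hypothesis makes \<open>c\<close> the middle position of column \<open>N\<close>.
  The edge \<open>(N, c)\<close> is the vertical diagonal of the central rhombus and cuts it into
  the triangles on both sides of this edge.\<close>

lemma central_rhombus_eq_tile:
  assumes "int (M + N) + 1 = - 2 * c"
  shows "central_rhombus N = tile M (N, c) (N, c)"
proof -
  have "real_of_int (int (M + N) + 1) = real_of_int (- 2 * c)"
    using assms by (rule arg_cong)
  then have c: "real_of_int c = - (real M + real N + 1) / 2" by simp
  let ?V = "{pt M (real N - 1) (of_int c + 1), pt M (real N + 1) (of_int c),
      pt M (real N) (of_int c + 1), pt M (real N) (of_int c)}"
  have "central_rhombus N = convex hull ?V"
    unfolding central_rhombus_def by (rule arg_cong[where f = "(hull) convex"]) (simp add: pt_def c field_simps)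
  also have "\<dots> = tile M (N, c) (N, c)"
  proof (intro equalityI subsetI)
    fix p assume "p \<in> convex hull ?V"
    moreover have "convex hull ?V \<subseteq> hexbox M (real N - 1) (real N + 1) c (c + 1) (c + N) (c + N + 1)"
      by (rule hull_minimal) (auto simp: convex_hexbox)
    ultimately have "p \<in> hexbox M (real N - 1) (real N + 1) c (c + 1) (c + N) (c + N + 1)" by blast
    then show "p \<in> tile M (N, c) (N, c)"
      by (cases "cb p \<le> real N") (auto simp: tile_def hexbox_def)
  next
    fix p assume "p \<in> tile M (N, c) (N, c)"
    moreover have "tri M (start_cell (N, c)) \<subseteq> convex hull ?V"
    proof -
      have "tri M (start_cell (N, c)) =
          convex hull {pt M (real N) (of_int c), pt M (real N) (of_int c + 1), pt M (real N + 1) (of_int c)}"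
        using convex_hull_tri_lower[of M "int N" c] by (simp del: tri.simps)
      then show ?thesis by (simp only:) (rule hull_mono, auto)
    qed
    moreover have "tri M (end_cell (N, c)) \<subseteq> convex hull ?V"
    proof -
      have "tri M (end_cell (N, c)) =
          convex hull {pt M (real N) (of_int c + 1), pt M (real N - 1) (of_int c + 1), pt M (real N) (of_int c)}"
        using convex_hull_tri_upper[of M "int N - 1" c] by (simp del: tri.simps)
      then show ?thesis by (simp only:) (rule hull_mono, auto)
    qed
    ultimately show "p \<in> convex hull ?V" unfolding tile_def by blast
  qed
  finally show ?thesis .
qed

lemma central_rhombus_third:
  assumes n: "n \<ge> 1" and NM: "N = 2 * n - 1 \<and> M = 2 * n \<or> N = 2 * n \<and> M = 2 * n - 1"
  shows "real (card {T \<in> rhombus_tilings N M. central_rhombus N \<in> T}) / real (card (rhombus_tilings N M)) = 1 / 3"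
proof -
  define c where "c = - 2 * int n"
  have N: "N \<ge> 1" using NM n by auto
  have c: "int (M + N) + 1 = - 2 * c" using NM n by (auto simp: c_def)
  have mem: "(N, c) \<in> below N M (2 * N)" and slot: "c \<in> slots N M N"
    using N c by (auto simp: mem_below_iff slots_def)
  have bij: "bij_betw (tiling_of N M) (matchings N M) (rhombus_tilings N M)"
    by (rule bij_betw_tiling_of[OF N])
  have central: "central_rhombus N \<in> tiling_of N M \<phi> \<longleftrightarrow> \<phi> (N, c) = (N, c)" for \<phi>
    unfolding central_rhombus_eq_tile[OF c] tile_in_tiling_of_iff using mem by simp
  have "bij_betw (tiling_of N M) {\<phi> \<in> matchings N M. \<phi> (N, c) = (N, c)} {T \<in> rhombus_tilings N M. central_rhombus N \<in> T}"
    using bij central by (rule bij_betw_Collect)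
  then have "real (card {T \<in> rhombus_tilings N M. central_rhombus N \<in> T}) =
      (\<Sum>P\<in>{P \<in> particles N M N. c \<notin> P}. (path_count M N P)\<^sup>2)"
    using card_matchings[OF N, of "{c}" M] slot by (simp add: bij_betw_same_card)
  moreover have "real (card (rhombus_tilings N M)) = (\<Sum>P\<in>particles N M N. (path_count M N P)\<^sup>2)"
    using card_matchings[OF N, of "{}" M] bij_betw_same_card[OF bij] by simp
  ultimately show ?thesis
    using sum_path_count_squares_third[OF n NM] unfolding c_def by simp
qed

theorem corollary3:
  fixes n :: nat
  assumes "n \<ge> 1"
  shows "real (card {T \<in> rhombus_tilings (2 * n - 1) (2 * n). central_rhombus (2 * n - 1) \<in> T})
           / real (card (rhombus_tilings (2 * n - 1) (2 * n))) = 1 / 3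
       \<and> real (card {T \<in> rhombus_tilings (2 * n) (2 * n - 1). central_rhombus (2 * n) \<in> T})
           / real (card (rhombus_tilings (2 * n) (2 * n - 1))) = 1 / 3"
  using central_rhombus_third[OF assms] by blast

end
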